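(* Let $\mathcal{L}$ be a line arrangement consisting of $m$ lines intersecting in one point. Let $(n_1,\dots,n_k)\in\mathbb{N}^k$ be a $k$-tuple, and let $\tilde{\mathcal{L}}=T_{(n_1,\dots,n_k)}(\mathcal{L})$. Then, in addition to the original intersection point of $\mathcal{L}$, for every $1\le i\le k$, $\tilde{\mathcal{L}}$ has an $m$-tacnode of order $n_i-1$, and another singular point which is a blow down of an $m$-tacnode of order $n_1+\cdots+n_k-1$ (i.e., the curve has the following singularities: $[m],[m_{n_1}],\dots,[m_{n_k}]$ and $[m(n_1+\cdots+n_k),\,m_{n_1+\cdots+n_k}]$). The degree of the resulting curve is $m(n_1+\cdots+n_k+1)$.
   Context: Curves are complex plane projective curves and $\mathbb{N}=\{1,2,3,\dots\}$. Singularity types: if a singular point $P$ is resolved by a sequence of $s$ blow-ups, with only one singular point appearing at each blow-up, and $t_i>1$ ($1\le i\le s$) is the multiplicity of the curve at $P$ before the $i$-th blow-up, then $[t_1,\dots,t_s]$ is called the type of the singularity. A sequence of $r$ equal multiplicities $l$ is abbreviated $l_r$ (e.g. $[2,2,2]=[2_3]$). An $m$-tacnode is a singular point where $m$ smooth branches of the curve have a common tangent at the same point; an $m$-tacnode of order $k$ is an $m$-tacnode such that the higher derivatives of the branches are also equal up to order $k$ (the usual tacnode is a $2$-tacnode of order $1$). A blow down of an $m$-tacnode is the singular point obtained from an $m$-tacnode located on an exceptional curve when that curve is blown down. The Hirzebruch surface $F_n$ is the $\mathbb{P}^1$-bundle over $\mathbb{P}^1$ whose exceptional section has self-intersection $-n$.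 Elementary transformations: the first type ($F_n$ to $F_{n+1}$) blows up a point on the exceptional section and then blows down the proper transform of the fiber through that point. The second type ($F_n$ to $F_{n-1}$) blows up a point on a fiber $Q$, outside the exceptional section, and then blows down the proper transform of $Q$. In both cases the transformation is said to be performed on that fiber; the new fiber (the exceptional curve of the blow-up) replaces the old one and is called its proper transform. Construction of $T_{(n_1,\dots,n_k)}$ applied to a curve $C$ (here $C=\mathcal{L}$): take $k$ different lines $Q_1,\dots,Q_k$, all meeting $C$ transversally and intersecting in a point $O$ outside $C$, in such a way that, for a disk $D$ centered at $O$, the intersection points of the lines with the boundary of $D$ are organized counterclockwise. An additional line $P$ also passes through $O$ and intersects $C$ transversally. Blow up $O$ to get $F_1$. Apply $n_i$ elementary transformations of the first type on the proper transform of $Q_i$ for all $i$, reaching $F_{(\sum n_i)+1}$. Then apply $\sum n_i$ elementary transformations of the second type on the proper transform of $P$, returning to $F_1$. Finally blow down the exceptional section to get $\mathbb{P}^2$. This defines the Cremona transformation $T_{(n_1,\dots,n_k)}$; the image of $C$ is its proper transform.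
   Formalization: In the elementary transformations of the second type on P, the blown-up point is required to lie off the current curve as well as off the exceptional section; otherwise a branch misses the exceptional section and the stated degree and singularities fail (e.g. m=2, n=(1) gives degree 3, not 4). *)

theory Defs
  imports
    "HOL-Complex_Analysis.Complex_Analysis"
    "HOL-Computational_Algebra.Computational_Algebra"
begin

section \<open>Polynomials in two and three variables\<close>

text \<open>An element of \<open>\<complex>[x][y]\<close> is evaluated at \<open>(x, y)\<close>, an element of \<open>\<complex>[x][y][z]\<close>
  at the vector \<open>(x, y, z)\<close>; the innermost coefficients belong to \<open>x\<close>.\<close>

definition ev2 :: "complex poly poly \<Rightarrow> complex \<times> complex \<Rightarrow> complex" where
  "ev2 f z = poly (poly f [:snd z:]) (fst z)"

definition ev3 :: "complex poly poly poly \<Rightarrow> complex ^ 3 \<Rightarrow> complex" where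
  "ev3 F v = ev2 (poly F [:[:v $ 3:]:]) (v $ 1, v $ 2)"

definition is_form :: "nat \<Rightarrow> complex poly poly poly \<Rightarrow> bool" where
  "is_form d F \<longleftrightarrow> F \<noteq> 0 \<and>
     (\<forall>i j k. coeff (coeff (coeff F k) j) i \<noteq> 0 \<longrightarrow> i + j + k = d)"


section \<open>Algebraic surfaces covered by affine planes\<close>

text \<open>All surfaces occurring here are smooth, and every point has a Zariski neighbourhood
  isomorphic to the affine plane. Such a surface is given by a set of parametrizations
  \<open>\<complex>\<^sup>2 \<rightarrow> 'a\<close>, any two of which differ by a change of coordinates that is regular
  (locally a quotient of polynomials) wherever it is defined.\<close>

type_synonym 'a atlas = "(complex \<times> complex \<Rightarrow> 'a) set"

definition points :: "'a atlas \<Rightarrow> 'a set" where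
  "points \<X> = (\<Union>c\<in>\<X>. range c)"

definition regular_at :: "'a atlas \<Rightarrow> (complex \<times> complex \<Rightarrow> 'a) \<Rightarrow> complex \<times> complex \<Rightarrow> bool" where
  "regular_at \<X> f z \<longleftrightarrow> (\<exists>c\<in>\<X>. \<exists>p1 p2 q. ev2 q z \<noteq> 0 \<and>
     (\<forall>w. ev2 q w \<noteq> 0 \<longrightarrow> f w = c (ev2 p1 w / ev2 q w, ev2 p2 w / ev2 q w)))"

definition is_atlas :: "'a atlas \<Rightarrow> bool" where
  "is_atlas \<X> \<longleftrightarrow> (\<forall>c\<in>\<X>. inj c) \<and>
     (\<forall>c\<in>\<X>. \<forall>d\<in>\<X>. \<forall>z. c z \<in> range d \<longrightarrow> regular_at {d} c z)"

definition zclosure :: "'a atlas \<Rightarrow> 'a set \<Rightarrow> 'a set" where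
  \<comment> \<open>Closure in the classical topology, chart by chart. It is only applied to Zariski-locally
     closed sets, for which it agrees with the Zariski closure.\<close>
  "zclosure \<X> S = (\<Union>c\<in>\<X>. c ` closure (c -` S))"

text \<open>The map \<open>\<pi>\<close> from the surface \<open>\<Y>\<close> to the surface \<open>\<X>\<close> is the blow-up of the point \<open>p\<close>:
  an isomorphism away from \<open>p\<close>, and in suitable coordinates centred at \<open>p\<close> it is
  \<open>(u, v) \<mapsto> (u, u v)\<close> and \<open>(u, v) \<mapsto> (u v, v)\<close> in two planes glued along
  \<open>(u, v) \<mapsto> (1 / v, u v)\<close>. Read from \<open>\<Y>\<close> to \<open>\<X>\<close>, this is the blow-down of the
  exceptional curve, the fibre of \<open>\<pi>\<close> over \<open>p\<close>.\<close>

definition blow_up :: "'a atlas \<Rightarrow> 'a \<Rightarrow> 'b atlas \<Rightarrow> ('b \<Rightarrow> 'a) \<Rightarrow> bool" where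
  "blow_up \<X> p \<Y> \<pi> \<longleftrightarrow>
     is_atlas \<X> \<and> is_atlas \<Y> \<and>
     (\<forall>d\<in>\<Y>. \<forall>z. regular_at \<X> (\<pi> \<circ> d) z) \<and>
     bij_betw \<pi> {y \<in> points \<Y>. \<pi> y \<noteq> p} (points \<X> - {p}) \<and>
     (\<forall>c\<in>\<X>. \<forall>z. c z \<noteq> p \<longrightarrow>
        regular_at \<Y> (inv_into {y \<in> points \<Y>. \<pi> y \<noteq> p} \<pi> \<circ> c) z) \<and>
     (\<exists>c d1 d2.
        is_atlas (insert c \<X>) \<and> is_atlas (insert d1 (insert d2 \<Y>)) \<and>
        c (0, 0) = p \<and> range c \<subseteq> points \<X> \<and>
        range d1 \<union> range d2 = {y \<in> points \<Y>. \<pi> y \<in> range c} \<and>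
        (\<forall>u v. \<pi> (d1 (u, v)) = c (u, u * v)) \<and>
        (\<forall>u v. \<pi> (d2 (u, v)) = c (u * v, v)) \<and>
        (\<forall>u v w. d1 (u, v) = d2 w \<longleftrightarrow> v \<noteq> 0 \<and> w = (1 / v, u * v)))"

definition proper_transform :: "'b atlas \<Rightarrow> ('b \<Rightarrow> 'a) \<Rightarrow> 'a \<Rightarrow> 'a set \<Rightarrow> 'b set" where
  "proper_transform \<Y> \<pi> p C = zclosure \<Y> {y \<in> points \<Y>. \<pi> y \<in> C - {p}}"


section \<open>The projective plane and the Hirzebruch surfaces\<close>

text \<open>A point of the projective plane is the set of its homogeneous coordinate vectors.\<close>

type_synonym pt2 = "(complex ^ 3) set"

definition proj :: "complex ^ 3 \<Rightarrow> pt2" where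
  "proj v = {c *s v |c. c \<noteq> 0}"

definition P2 :: "pt2 atlas" where
  "P2 = {\<lambda>z. proj (M *v vector [fst z, snd z, 1]) |M :: complex ^ 3 ^ 3. invertible M}"

definition is_line :: "pt2 set \<Rightarrow> bool" where
  "is_line l \<longleftrightarrow> (\<exists>a::complex ^ 3. a \<noteq> 0 \<and>
     l = {proj v |v. v \<noteq> 0 \<and> (\<Sum>i\<in>UNIV. a $ i * v $ i) = 0})"

text \<open>The projective line is \<open>\<complex> \<union> {\<infinity>}\<close> with \<open>\<infinity>\<close> written \<open>None\<close>. As a set, every Hirzebruch
  surface is \<open>\<P>\<^sup>1 \<times> \<P>\<^sup>1\<close> (base coordinate, fibre coordinate); the bundle \<open>F\<^sub>n\<close> is glued from
  \<open>\<complex> \<times> \<P>\<^sup>1\<close> with coordinates \<open>(x, y)\<close> and \<open>\<complex> \<times> \<P>\<^sup>1\<close> with coordinates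
  \<open>(1 / x, y / x\<^sup>n)\<close>. In terms of \<open>w = 1 / y\<close> the gluing multiplies by \<open>x\<^sup>n\<close>, so that the section
  \<open>y = \<infinity>\<close> has self-intersection \<open>- n\<close>.\<close>

type_synonym P1 = "complex option"
type_synonym hpt = "P1 \<times> P1"

definition recip :: "complex \<Rightarrow> P1" where
  "recip w = (if w = 0 then None else Some (1 / w))"

definition hirz :: "nat \<Rightarrow> hpt atlas" where
  "hirz n =
    {\<lambda>(x, y). (Some x, Some y),
     \<lambda>(x, w). (Some x, recip w),
     \<lambda>(x, y). (recip x, if x = 0 then Some y else Some (y / x ^ n)),
     \<lambda>(x, w). (recip x, if x = 0 then recip w else recip (w * x ^ n))}"

definition exc_section :: "hpt set" where
  "exc_section = {z. snd z = None}"

definition fibre :: "P1 \<Rightarrow> hpt set" where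
  "fibre a = {z. fst z = a}"

fun plane_vec :: "hpt \<Rightarrow> complex ^ 3" where
  "plane_vec (Some x, Some y) = vector [1, x, y]"
| "plane_vec (None, Some y) = vector [0, 1, y]"
| "plane_vec (a, None) = vector [0, 0, 1]"

text \<open>\<open>F\<^sub>1\<close> as the blow-up of the plane at \<open>Op\<close>, with the exceptional section as exceptional
  curve. The last clause fixes coordinates: in some projective frame in which \<open>Op\<close> is
  \<open>(0, 0, 1)\<close>, the fibre over \<open>x\<close> is mapped to the line through \<open>Op\<close> and \<open>(1, x, 0)\<close>. It is no
  restriction, since the automorphisms of \<open>F\<^sub>1\<close> come from projectivities fixing \<open>Op\<close>.\<close>

definition plane_blow_up :: "pt2 \<Rightarrow> (hpt \<Rightarrow> pt2) \<Rightarrow> bool" where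
  "plane_blow_up Op \<sigma> \<longleftrightarrow>
     blow_up P2 Op (hirz 1) \<sigma> \<and> {z. \<sigma> z = Op} = exc_section \<and>
     (\<exists>M :: complex ^ 3 ^ 3. invertible M \<and> \<sigma> = (\<lambda>z. proj (M *v plane_vec z)))"


section \<open>Elementary transformations\<close>

text \<open>An elementary transformation from \<open>F\<^sub>n\<close> to \<open>F\<^sub>n\<^sub>'\<close> with centre \<open>p\<close> is given by the surface
  \<open>\<Y> \<subseteq> F\<^sub>n \<times> F\<^sub>n\<^sub>'\<close> (the closure of its graph) whose first projection is the blow-up of \<open>p\<close> and whose
  second projection blows down the proper transform of the fibre through \<open>p\<close>. The two
  bundles are identified over the base, so that the new fibre has the same base
  coordinate as the fibre it replaces.\<close>

type_synonym graph = "(hpt \<times> hpt) atlas"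

definition elementary :: "nat \<Rightarrow> hpt \<Rightarrow> nat \<Rightarrow> graph \<Rightarrow> bool" where
  "elementary n p n' \<Y> \<longleftrightarrow> (\<exists>p'.
     blow_up (hirz n) p \<Y> fst \<and> blow_up (hirz n') p' \<Y> snd \<and>
     {z \<in> points \<Y>. snd z = p'} = proper_transform \<Y> fst p (fibre (fst p)) \<and>
     snd ` proper_transform \<Y> fst p exc_section = exc_section \<and>
     (\<forall>z\<in>points \<Y>. fst (fst z) = fst (snd z)))"

definition curve_image :: "graph \<Rightarrow> hpt \<Rightarrow> hpt set \<Rightarrow> hpt set" where
  "curve_image \<Y> p C = snd ` proper_transform \<Y> fst p C"

text \<open>\<open>first_seq as n C n' C' R\<close>: successive elementary transformations of the first type,
  performed on the fibres over the base points \<open>as\<close>, lead from \<open>F\<^sub>n\<close> and the curve \<open>C\<close> to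
  \<open>F\<^sub>n\<^sub>'\<close> and the curve \<open>C'\<close>; \<open>R\<close> is the induced correspondence between points. In transformations
  of the second type the point blown up is an arbitrary point of the fibre outside the
  exceptional section and outside the curve.\<close>

inductive first_seq ::
    "P1 list \<Rightarrow> nat \<Rightarrow> hpt set \<Rightarrow> nat \<Rightarrow> hpt set \<Rightarrow> (hpt \<times> hpt) set \<Rightarrow> bool" where
  "first_seq [] n C n C Id"
| "elementary n (a, None) (Suc n) \<Y> \<Longrightarrow>
   first_seq as (Suc n) (curve_image \<Y> (a, None) C) n' C' R \<Longrightarrow>
   first_seq (a # as) n C n' C' (points \<Y> O R)"

inductive second_seq ::
    "P1 list \<Rightarrow> nat \<Rightarrow> hpt set \<Rightarrow> nat \<Rightarrow> hpt set \<Rightarrow> (hpt \<times> hpt) set \<Rightarrow> bool" where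
  "second_seq [] n C n C Id"
| "elementary (Suc n) (a, Some y) n \<Y> \<Longrightarrow> (a, Some y) \<notin> C \<Longrightarrow>
   second_seq as n (curve_image \<Y> (a, Some y) C) n' C' R \<Longrightarrow>
   second_seq (a # as) (Suc n) C n' C' (points \<Y> O R)"


section \<open>The Cremona transformations\<close>

text \<open>\<open>cremona ns Op Qs P C C' R\<close>: the curve \<open>C'\<close> is the image of \<open>C\<close> under a Cremona transformation
  \<open>T\<close> with parameters \<open>ns\<close> constructed from the lines \<open>Qs\<close> and \<open>P\<close> through \<open>Op\<close>, and \<open>R\<close> is the
  correspondence between points induced by \<open>T\<close>.\<close>

definition cremona ::
    "nat list \<Rightarrow> pt2 \<Rightarrow> pt2 set list \<Rightarrow> pt2 set \<Rightarrow> pt2 set \<Rightarrow> pt2 set \<Rightarrow> (pt2 \<times> pt2) set \<Rightarrow> bool" where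
  "cremona ns Op Qs P C C' R \<longleftrightarrow>
     (\<exists>\<sigma> as b C1 R1 C2 R2 Op' \<sigma>'.
        plane_blow_up Op \<sigma> \<and> length as = length ns \<and>
        (\<forall>i<length ns. proper_transform (hirz 1) \<sigma> Op (Qs ! i) = fibre (as ! i)) \<and>
        proper_transform (hirz 1) \<sigma> Op P = fibre b \<and>
        first_seq (concat (map2 replicate ns as)) 1 (proper_transform (hirz 1) \<sigma> Op C)
          (sum_list ns + 1) C1 R1 \<and>
        second_seq (replicate (sum_list ns) b) (sum_list ns + 1) C1 1 C2 R2 \<and>
        plane_blow_up Op' \<sigma>' \<and> C' = \<sigma>' ` C2 \<and>
        R = {(\<sigma> x, \<sigma>' y) |x y. (x, y) \<in> R1 O R2})"

text \<open>The line \<open>l\<close> meets the union of the lines in \<open>\<A>\<close> only in smooth points of that curve, with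
  different tangents.\<close>

definition transversal :: "pt2 set \<Rightarrow> pt2 set set \<Rightarrow> bool" where
  "transversal l \<A> \<longleftrightarrow> l \<notin> \<A> \<and> (\<forall>x\<in>l \<inter> \<Union>\<A>. \<exists>!a. a \<in> \<A> \<and> x \<in> a)"

text \<open>The lines in \<open>Qs\<close> meet the boundary of some disk centred at \<open>Op\<close> in counterclockwise order.
  The disk is any embedded topological disk, which makes sense for arbitrary
  complex lines; the condition only concerns the numbering of the lines.\<close>

definition counterclockwise :: "pt2 \<Rightarrow> pt2 set list \<Rightarrow> bool" where
  "counterclockwise Op Qs \<longleftrightarrow>
     (\<exists>(D :: complex \<Rightarrow> complex ^ 3) \<theta>.
        continuous_on (cball 0 1) D \<and> 0 \<notin> D ` cball 0 1 \<and>
        inj_on (proj \<circ> D) (cball 0 1) \<and> proj (D 0) = Op \<and>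
        strict_mono_on {..<length Qs} \<theta> \<and>
        (\<forall>i<length Qs. 0 \<le> \<theta> i \<and> \<theta> i < 2 * pi \<and> proj (D (cis (\<theta> i))) \<in> Qs ! i))"


section \<open>Singularities of plane curves\<close>

definition mult0 :: "complex poly poly \<Rightarrow> nat" where
  "mult0 f = (LEAST d. \<exists>i j. i + j = d \<and> coeff (coeff f j) i \<noteq> 0)"

text \<open>\<open>strict_transform f e g\<close>: after the origin has been blown up, the proper transform of the
  curve \<open>f = 0\<close> has the local equation \<open>g = 0\<close> at the point \<open>e\<close> of the exceptional curve;
  \<open>Some s\<close> is the tangent direction \<open>y = s x\<close> and \<open>None\<close> is the direction \<open>x = 0\<close>.\<close>

fun strict_transform :: "complex poly poly \<Rightarrow> P1 \<Rightarrow> complex poly poly \<Rightarrow> bool" where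
  "strict_transform f (Some s) g \<longleftrightarrow>
     (\<forall>u v. ev2 f (u, u * (s + v)) = u ^ mult0 f * ev2 g (u, v))"
| "strict_transform f None g \<longleftrightarrow>
     (\<forall>u v. ev2 f (u * v, v) = v ^ mult0 f * ev2 g (u, v))"

text \<open>The type \<open>[t\<^sub>1, \<dots>, t\<^sub>s]\<close> of the singularity at the origin.\<close>

inductive sing_type :: "complex poly poly \<Rightarrow> nat list \<Rightarrow> bool" where
  "mult0 f > 1 \<Longrightarrow> (\<And>e g. strict_transform f e g \<Longrightarrow> mult0 g \<le> 1) \<Longrightarrow>
   sing_type f [mult0 f]"
| "mult0 f > 1 \<Longrightarrow> strict_transform f e g \<Longrightarrow> sing_type g ts \<Longrightarrow>
   (\<And>e' g'. e' \<noteq> e \<Longrightarrow> strict_transform f e' g' \<Longrightarrow> mult0 g' \<le> 1) \<Longrightarrow>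
   sing_type f (mult0 f # ts)"

text \<open>The curve \<open>f = 0\<close> has an \<open>m\<close>-tacnode of order \<open>k\<close> at the origin: near the origin and in suitable
  linear coordinates it consists of the graphs of \<open>m\<close> holomorphic functions whose
  derivatives agree up to order \<open>k\<close> and pairwise differ in order \<open>k + 1\<close>. For \<open>k = 0\<close> this is an
  ordinary \<open>m\<close>-fold point; for \<open>k \<ge> 1\<close> the branches have a common tangent.\<close>

definition tacnode0 :: "complex poly poly \<Rightarrow> nat \<Rightarrow> nat \<Rightarrow> bool" where
  "tacnode0 f m k \<longleftrightarrow>
     (\<exists>a b c d \<epsilon> (g :: nat \<Rightarrow> complex \<Rightarrow> complex).
        a * d - b * c \<noteq> 0 \<and> \<epsilon> > 0 \<and>
        (\<forall>j<m. g j holomorphic_on ball 0 \<epsilon> \<and> g j 0 = 0) \<and>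
        (\<forall>x\<in>ball 0 \<epsilon>. \<forall>y\<in>ball 0 \<epsilon>.
           ev2 f (a * x + b * y, c * x + d * y) = 0 \<longleftrightarrow> (\<exists>j<m. y = g j x)) \<and>
        (\<forall>j<m. \<forall>l\<le>k. (deriv ^^ l) (g j) 0 = (deriv ^^ l) (g 0) 0) \<and>
        inj_on (\<lambda>j. (deriv ^^ Suc k) (g j) 0) {..<m})"

text \<open>The blow-down of such a point: after one blow-up the curve meets the exceptional curve in a
  single point, where it has an \<open>m\<close>-tacnode of order \<open>k\<close>.\<close>

definition tacnode_blow_down0 :: "complex poly poly \<Rightarrow> nat \<Rightarrow> nat \<Rightarrow> bool" where
  "tacnode_blow_down0 f m k \<longleftrightarrow>
     (\<exists>e g. strict_transform f e g \<and> tacnode0 g m k \<and>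
        (\<forall>e' g'. e' \<noteq> e \<longrightarrow> strict_transform f e' g' \<longrightarrow> mult0 g' = 0))"

definition plane_curve :: "nat \<Rightarrow> complex poly poly poly \<Rightarrow> pt2 set \<Rightarrow> bool" where
  "plane_curve d F C \<longleftrightarrow> is_form d F \<and> squarefree F \<and> C = {proj v |v. v \<noteq> 0 \<and> ev3 F v = 0}"

text \<open>\<open>f = 0\<close> is an equation of the curve \<open>F = 0\<close> in an affine chart in which \<open>x\<close> is the origin.\<close>

definition local_equation :: "complex poly poly poly \<Rightarrow> pt2 \<Rightarrow> complex poly poly \<Rightarrow> bool" where
  "local_equation F x f \<longleftrightarrow> (\<exists>M :: complex ^ 3 ^ 3. invertible M \<and> proj (M *v vector [0, 0, 1]) = x \<and>
     (\<forall>u v. ev2 f (u, v) = ev3 F (M *v vector [u, v, 1])))"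

definition singular_point :: "complex poly poly poly \<Rightarrow> pt2 \<Rightarrow> bool" where
  "singular_point F x \<longleftrightarrow> (\<exists>f. local_equation F x f \<and> mult0 f > 1)"

definition has_type :: "complex poly poly poly \<Rightarrow> pt2 \<Rightarrow> nat list \<Rightarrow> bool" where
  "has_type F x ts \<longleftrightarrow> (\<exists>f. local_equation F x f \<and> sing_type f ts)"

definition tacnode :: "complex poly poly poly \<Rightarrow> pt2 \<Rightarrow> nat \<Rightarrow> nat \<Rightarrow> bool" where
  "tacnode F x m k \<longleftrightarrow> (\<exists>f. local_equation F x f \<and> tacnode0 f m k)"

definition tacnode_blow_down :: "complex poly poly poly \<Rightarrow> pt2 \<Rightarrow> nat \<Rightarrow> nat \<Rightarrow> bool" where
  "tacnode_blow_down F x m k \<longleftrightarrow> (\<exists>f. local_equation F x f \<and> tacnode_blow_down0 f m k)"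

end

theory Submission
  imports Defs
begin

no_notation fps_nth (infixl "$" 75)

text \<open>Let \<open>l\<^sub>a\<close> be the linear form on the base that vanishes at \<open>a\<close>. In the coordinates \<open>(x, y)\<close> an
  elementary transformation of the first type over \<open>a\<close> is \<open>y \<mapsto> c l\<^sub>a(x) y + g(x)\<close> with \<open>c \<noteq> 0\<close> and \<open>g\<close> a form
  of degree \<open>n + 1\<close>, and one of the second type is the inverse of such a map: it is bijective on the
  other fibres, hence affine in \<open>y\<close>, and since the fibre over \<open>a\<close> is contracted to a point the
  coefficients are entire functions, of polynomial growth by regularity at infinity.

  The lines through \<open>V\<close> are the sections \<open>y = G + \<kappa> W\<close>, where \<open>W\<close> is the linear form that vanishes at the
  base point \<open>v\<close> of \<open>V\<close>. The transformations over \<open>a\<^sub>i\<close> multiply \<open>W\<close> by the \<open>n\<^sub>i\<close>-th power of the form of \<open>a\<^sub>i\<close>, and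
  those over \<open>b\<close> turn the equation into \<open>y l\<^sub>b\<^sup>N = G + \<kappa> W\<close> with \<open>N = \<Sum>\<^sub>i n\<^sub>i\<close> and forms \<open>G, W\<close> of degree
  \<open>N + 1\<close>. Two of these branches meet only where \<open>W = 0\<close>, with contact equal to the order of \<open>W\<close>: once
  over \<open>v\<close> and \<open>n\<^sub>i\<close> times over \<open>a\<^sub>i\<close>. At the point \<open>(0 : 0 : 1)\<close> the curve is \<open>l\<^sub>b\<^sup>N = G + \<kappa> W\<close>, which has
  multiplicity \<open>N\<close> for each \<open>\<kappa>\<close> and becomes \<open>u\<^sup>N = v (G + \<kappa> W)\<close> with \<open>G + \<kappa> W \<noteq> 0\<close> after one blow-up.\<close>

section \<open>Polynomial functions\<close>

text \<open>The obstacle is that \<open>blow_up\<close> and \<open>elementary\<close> describe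
  surfaces only through charts and abstract properties, so every coordinate expression has to be
  derived. On a fibre that is not contracted the map is entire and injective, and because the
  exceptional section is preserved it has a pole at infinity; the pole makes it a polynomial,
  injectivity makes the polynomial affine. The delicate point is where a fibre is contracted to. For
  the first type it must be a point off the exceptional section: otherwise the proper transforms of
  the fibre and of the section would meet over the blown up point, although the two curves cross
  there with different tangents. For the second type, the condition that the centres avoid the curve
  is what makes \<open>G + \<kappa> W\<close> nonzero at \<open>b\<close>. That the equation is
  squarefree, so that its degree is the degree of the curve, and that no further point is singular
  both come from one fact: on a line through (0 : 0 : 1) on which neither the linear form of
  \<open>b\<close> nor \<open>W\<close> vanishes, the product equation has simple zeros
  only.\<close>

lemma ev2_add [simp]: "ev2 (p + q) w = ev2 p w + ev2 q w"
  and ev2_diff [simp]: "ev2 (p - q) w = ev2 p w - ev2 q w"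
  and ev2_mult [simp]: "ev2 (p * q) w = ev2 p w * ev2 q w"
  and ev2_0 [simp]: "ev2 0 w = 0"
  and ev2_1 [simp]: "ev2 1 w = 1"
  by (simp_all add: ev2_def)

lemma ev2_power [simp]: "ev2 (p ^ n) w = ev2 p w ^ n"
  by (simp add: ev2_def)

lemma ev2_prod [simp]: "ev2 (prod p A) w = (\<Prod>x\<in>A. ev2 (p x) w)"
  by (induction A rule: infinite_finite_induct) auto

lemma ev2_pCons: "ev2 (pCons a p) w = poly a (fst w) + snd w * ev2 p w"
  by (simp add: ev2_def)

text \<open>Polynomiality is treated as a property of functions, so that closure rules replace
  explicit nested coefficients; \<open>ev2_inject\<close> makes the polynomial unique.\<close>

definition poly_fun2 :: "(complex \<times> complex \<Rightarrow> complex) \<Rightarrow> bool" where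
  "poly_fun2 f \<longleftrightarrow> (\<exists>p. \<forall>w. f w = ev2 p w)"

lemma poly_fun2_ev2 [simp, intro]: "poly_fun2 (ev2 p)" "poly_fun2 (\<lambda>w. ev2 p w)"
  by (auto simp: poly_fun2_def)

lemma poly_fun2_add: "poly_fun2 f \<Longrightarrow> poly_fun2 g \<Longrightarrow> poly_fun2 (\<lambda>w. f w + g w)"
  unfolding poly_fun2_def by (metis ev2_add)

lemma poly_fun2_diff: "poly_fun2 f \<Longrightarrow> poly_fun2 g \<Longrightarrow> poly_fun2 (\<lambda>w. f w - g w)"
  unfolding poly_fun2_def by (metis ev2_diff)

lemma poly_fun2_mult: "poly_fun2 f \<Longrightarrow> poly_fun2 g \<Longrightarrow> poly_fun2 (\<lambda>w. f w * g w)"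
  unfolding poly_fun2_def by (metis ev2_mult)

lemma poly_fun2_power: "poly_fun2 f \<Longrightarrow> poly_fun2 (\<lambda>w. f w ^ n)"
  unfolding poly_fun2_def by (metis ev2_power)

lemma poly_fun2_const: "poly_fun2 (\<lambda>w. c)"
  unfolding poly_fun2_def by (rule exI[of _ "[:[:c:]:]"]) (simp add: ev2_def)

lemma poly_fun2_fst: "poly_fun2 (\<lambda>w. fst w)"
  unfolding poly_fun2_def by (rule exI[of _ "[:[:0,1:]:]"]) (simp add: ev2_def)

lemma poly_fun2_snd: "poly_fun2 (\<lambda>w. snd w)"
  unfolding poly_fun2_def by (rule exI[of _ "[:0,1:]"]) (simp add: ev2_def)

lemma poly_fun2_sum: "(\<And>i. i \<in> I \<Longrightarrow> poly_fun2 (f i)) \<Longrightarrow> poly_fun2 (\<lambda>w. \<Sum>i\<in>I. f i w)"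
  by (induction I rule: infinite_finite_induct) (auto intro: poly_fun2_const poly_fun2_add)

lemma poly_fun2_prod: "(\<And>i. i \<in> I \<Longrightarrow> poly_fun2 (f i)) \<Longrightarrow> poly_fun2 (\<lambda>w. \<Prod>i\<in>I. f i w)"
  by (induction I rule: infinite_finite_induct) (auto intro: poly_fun2_const poly_fun2_mult)

lemmas poly_fun2_intros = poly_fun2_ev2 poly_fun2_add poly_fun2_diff poly_fun2_mult
  poly_fun2_power poly_fun2_const poly_fun2_fst poly_fun2_snd poly_fun2_sum poly_fun2_prod

lemma poly_fun2_poly: "poly_fun2 f \<Longrightarrow> poly_fun2 (\<lambda>w. poly p (f w))"
  by (induction p) (auto intro!: poly_fun2_intros)

lemma continuous_on_ev2 [continuous_intros]:
  "continuous_on S f \<Longrightarrow> continuous_on S (\<lambda>x. ev2 p (f x))"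
  by (induction p) (auto simp: ev2_pCons intro!: continuous_intros)

lemma isCont_ev2: "isCont (ev2 p) z"
  using continuous_on_ev2[OF continuous_on_id, of UNIV p]
  unfolding continuous_on_eq_continuous_at[OF open_UNIV] by (metis UNIV_I)

lemma tendsto_ev2 [tendsto_intros]: "(f \<longlongrightarrow> l) F \<Longrightarrow> ((\<lambda>x. ev2 p (f x)) \<longlongrightarrow> ev2 p l) F"
  using isCont_ev2 isCont_tendsto_compose by blast

text \<open>If all values vanish, every constant \<open>[:y:]\<close> is a root of \<open>p\<close>
  over the domain of polynomials in \<open>x\<close>. These are infinitely many roots, so
  \<open>p\<close> is zero.\<close>

lemma ev2_eq_0_iff: "(\<forall>w. ev2 p w = 0) \<longleftrightarrow> p = 0"
proof
  assume h: "\<forall>w. ev2 p w = 0"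
  have "poly p [:y:] = 0" for y
  proof -
    have "poly (poly p [:y:]) x = 0" for x
      using h[rule_format, of "(x, y)"] by (simp add: ev2_def)
    then show ?thesis using poly_all_0_iff_0 by blast
  qed
  moreover have "infinite (range (\<lambda>y::complex. [:y:]))"
    by (metis (no_types, lifting) finite_imageD infinite_UNIV_char_0 injI pCons_eq_iff)
  ultimately have "infinite {x. poly p x = 0}"
    by (metis (mono_tags, lifting) finite_subset image_subset_iff mem_Collect_eq)
  then show "p = 0"
    using poly_roots_finite by blast
qed auto

lemma ev2_inject: "(\<And>w. ev2 p w = ev2 q w) \<Longrightarrow> p = q"
  using ev2_eq_0_iff[of "p - q"] by auto

section \<open>Polynomial functions of three variables and homogeneity\<close>

lemma ev3_add [simp]: "ev3 (p + q) v = ev3 p v + ev3 q v"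
  and ev3_diff [simp]: "ev3 (p - q) v = ev3 p v - ev3 q v"
  and ev3_mult [simp]: "ev3 (p * q) v = ev3 p v * ev3 q v"
  and ev3_0 [simp]: "ev3 0 v = 0"
  and ev3_1 [simp]: "ev3 1 v = 1"
  by (simp_all add: ev3_def)

lemma ev3_pCons: "ev3 (pCons a p) v = ev2 a (v$1, v$2) + v$3 * ev3 p v"
proof -
  have "ev2 [:[:c:]:] w = c" for c w
    by (simp add: ev2_def)
  then show ?thesis unfolding ev3_def poly_pCons ev2_add ev2_mult by simp
qed

lemma ev3_eq_0_iff: "(\<forall>v. ev3 p v = 0) \<longleftrightarrow> p = 0"
proof
  assume h: "\<forall>v. ev3 p v = 0"
  have "poly p [:[:z:]:] = 0" for z
  proof -
    have "ev2 (poly p [:[:z:]:]) (x, y) = 0" for x y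
      using h[rule_format, of "vector [x, y, z]"] by (simp add: ev3_def)
    then show ?thesis using ev2_eq_0_iff by (metis surj_pair)
  qed
  moreover have "infinite (range (\<lambda>y::complex. [:[:y:]:]))"
    by (metis (no_types, lifting) finite_imageD infinite_UNIV_char_0 injI pCons_eq_iff)
  ultimately have "infinite {x. poly p x = 0}"
    by (metis (mono_tags, lifting) finite_subset image_subset_iff mem_Collect_eq)
  then show "p = 0"
    using poly_roots_finite by blast
qed auto

lemma ev3_inject: "(\<And>v. ev3 p v = ev3 q v) \<Longrightarrow> p = q"
  using ev3_eq_0_iff[of "p - q"] by auto

definition poly_fun3 :: "(complex ^ 3 \<Rightarrow> complex) \<Rightarrow> bool" where
  "poly_fun3 f \<longleftrightarrow> (\<exists>p. \<forall>w. f w = ev3 p w)"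

lemma poly_fun3_add: "poly_fun3 f \<Longrightarrow> poly_fun3 g \<Longrightarrow> poly_fun3 (\<lambda>w. f w + g w)"
  unfolding poly_fun3_def by (metis ev3_add)

lemma poly_fun3_diff: "poly_fun3 f \<Longrightarrow> poly_fun3 g \<Longrightarrow> poly_fun3 (\<lambda>w. f w - g w)"
  unfolding poly_fun3_def by (metis ev3_diff)

lemma poly_fun3_mult: "poly_fun3 f \<Longrightarrow> poly_fun3 g \<Longrightarrow> poly_fun3 (\<lambda>w. f w * g w)"
  unfolding poly_fun3_def by (metis ev3_mult)

lemma poly_fun3_const: "poly_fun3 (\<lambda>w. c)"
  unfolding poly_fun3_def by (rule exI[of _ "[:[:[:c:]:]:]"]) (simp add: ev3_def ev2_def)

lemma poly_fun3_power: "poly_fun3 f \<Longrightarrow> poly_fun3 (\<lambda>w. f w ^ n)"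
  by (induction n) (auto intro: poly_fun3_mult poly_fun3_const)

lemma poly_fun3_nth: "poly_fun3 (\<lambda>w. w $ i)"
proof -
  consider "i = 1" | "i = 2" | "i = 3"
    using exhaust_3 by blast
  then show ?thesis
  proof cases
    case 1
    show ?thesis unfolding poly_fun3_def 1
      by (rule exI[of _ "[:[:[:0,1:]:]:]"]) (simp add: ev3_def ev2_def)
  next
    case 2
    show ?thesis unfolding poly_fun3_def 2
      by (rule exI[of _ "[:[:0,1:]:]"]) (simp add: ev3_def ev2_def)
  next
    case 3
    show ?thesis unfolding poly_fun3_def 3
      by (rule exI[of _ "[:0,1:]"]) (simp add: ev3_def ev2_def)
  qed
qed

lemma poly_fun3_sum: "(\<And>i. i \<in> I \<Longrightarrow> poly_fun3 (f i)) \<Longrightarrow> poly_fun3 (\<lambda>w. \<Sum>i\<in>I. f i w)"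
  by (induction I rule: infinite_finite_induct) (auto intro: poly_fun3_const poly_fun3_add)

lemma poly_fun3_prod: "(\<And>i. i \<in> I \<Longrightarrow> poly_fun3 (f i)) \<Longrightarrow> poly_fun3 (\<lambda>w. \<Prod>i\<in>I. f i w)"
  by (induction I rule: infinite_finite_induct) (auto intro: poly_fun3_const poly_fun3_mult)

lemmas poly_fun3_intros = poly_fun3_add poly_fun3_diff poly_fun3_mult
  poly_fun3_power poly_fun3_const poly_fun3_nth poly_fun3_sum poly_fun3_prod

lemma poly_fun2_ev3:
  fixes g :: "complex \<times> complex \<Rightarrow> complex ^ 3"
  assumes "\<And>i. poly_fun2 (\<lambda>w. g w $ i)"
  shows "poly_fun2 (\<lambda>w. ev3 F (g w))"
proof -
  have *: "poly_fun2 (\<lambda>w. ev2 p (g w $ 1, g w $ 2))" for p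
    by (induction p) (auto simp: ev2_pCons intro!: poly_fun2_intros poly_fun2_poly assms)
  show ?thesis
    by (induction F) (auto simp: ev3_pCons intro!: poly_fun2_intros * assms)
qed

lemma poly_fun3_ev3_linear: "poly_fun3 (\<lambda>v. ev3 F ((M :: complex^3^3) *v v))"
proof -
  have lin: "poly_fun3 (\<lambda>v. (M *v v) $ i)" for i
    unfolding matrix_vector_mult_def by (auto intro!: poly_fun3_intros)
  have 1: "poly_fun3 (\<lambda>v. poly p ((M *v v) $ 1))" for p
    by (induction p) (auto intro!: poly_fun3_intros lin)
  have *: "poly_fun3 (\<lambda>v. ev2 p ((M *v v) $ 1, (M *v v) $ 2))" for p
    by (induction p) (auto simp: ev2_pCons intro!: poly_fun3_intros 1 lin)
  show ?thesis
    by (induction F) (auto simp: ev3_pCons intro!: poly_fun3_intros * lin)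
qed

text \<open>Comparing \<open>F(2v)\<close> with \<open>2\<^sup>d F(v)\<close> coefficientwise.\<close>

lemma is_form_if_homogeneous:
  assumes "F \<noteq> 0" and hom: "\<And>v. ev3 F (2 *s v) = 2 ^ d * ev3 F v"
  shows "is_form d F"
proof -
  \<comment> \<open>\<open>s1\<close>, \<open>s2\<close> and \<open>s3\<close> double the first, the
    first two and all three variables, so the coefficient of a monomial picks up its powers of 2 one
    level at a time.\<close>
  define s1 :: "complex poly \<Rightarrow> complex poly" where "s1 p = pcompose p [:0,2:]" for p
  define s2 where "s2 p = pcompose (map_poly s1 p) [:0,2:]" for p
  define s3 where "s3 p = pcompose (map_poly s2 p) [:0,2:]" for p
  have c1: "coeff (s1 p) i = 2 ^ i * coeff p i" for p i
    unfolding s1_def by (simp add: coeff_pcompose_linear)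
  have s10: "s1 0 = 0" by (simp add: s1_def)
  have c2: "coeff (s2 p) i = 2 ^ i * s1 (coeff p i)" for p i
    unfolding s2_def by (simp add: coeff_pcompose_linear coeff_map_poly s10)
  have s20: "s2 0 = 0" by (simp add: s2_def s10)
  have c3: "coeff (s3 p) i = 2 ^ i * s2 (coeff p i)" for p i
    unfolding s3_def by (simp add: coeff_pcompose_linear coeff_map_poly s20)
  have p1: "poly (s1 p) x = poly p (2 * x)" for p x
    unfolding s1_def by (simp add: poly_pcompose mult.commute)
  have s2C: "s2 (pCons a p) = [:s1 a:] + [:0, 2:] * s2 p" for a p
    unfolding s2_def by (auto simp: map_poly_pCons s10 pcompose_pCons)
  have p2: "ev2 (s2 p) (x, y) = ev2 p (2 * x, 2 * y)" for p x y
  proof (induction p)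
    case (pCons a p)
    have "ev2 [:s1 a:] (x, y) = poly a (2 * x)" "ev2 [:0, 2:] (x, y) = 2 * y"
      by (simp_all add: ev2_def p1)
    then show ?case using pCons by (simp only: s2C ev2_add ev2_mult ev2_pCons) simp
  qed (simp add: s20)
  have s3C: "s3 (pCons a p) = [:s2 a:] + [:0, 2:] * s3 p" for a p
    unfolding s3_def by (auto simp: map_poly_pCons s20 pcompose_pCons)
  have p3: "ev3 (s3 p) v = ev3 p (2 *s v)" for p v
  proof (induction p)
    case (pCons a p)
    have "ev3 [:s2 a:] v = ev2 a (2 * v$1, 2 * v$2)" "ev3 [:0, 2:] v = 2 * v $ 3"
      by (simp_all add: ev3_pCons p2) (simp add: ev2_def)
    then show ?case using pCons by (simp only: s3C ev3_add ev3_mult ev3_pCons) simp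
  qed (simp add: s3_def)
  have "s3 F = smult (2 ^ d) F"
  proof (rule ev3_inject)
    fix v
    have "ev3 (smult (2 ^ d) F) v = 2 ^ d * ev3 F v"
      by (simp add: ev3_def ev2_def)
    then show "ev3 (s3 F) v = ev3 (smult (2 ^ d) F) v" by (simp add: p3 hom)
  qed
  then have "coeff (coeff (coeff (s3 F) k) j) i = coeff (coeff (coeff (smult (2 ^ d) F) k) j) i" for i j k
    by simp
  moreover have "(2 :: complex poly) ^ k = [:2 ^ k:]" for k
    by (induction k) (auto simp: numeral_poly)
  moreover have "(2 :: complex poly poly) ^ k = [:[:2 ^ k:]:]" for k
    by (induction k) (auto simp: numeral_poly one_pCons)
  ultimately have *: "2 ^ j * (2 ^ k * (2 ^ i * coeff (coeff (coeff F k) j) i))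
      = 2 ^ d * coeff (coeff (coeff F k) j) i" for i j k
    by (simp add: c1 c2 c3)
  then have "(2::complex) ^ (i + j + k) = 2 ^ d" if "coeff (coeff (coeff F k) j) i \<noteq> 0" for i j k
    using that *[of j k i] by (simp add: power_add mult_ac)
  moreover have "n = d" if "(2::complex) ^ n = 2 ^ d" for n
    using arg_cong[OF that, of norm] by (simp add: norm_power)
  ultimately show ?thesis
    using \<open>F \<noteq> 0\<close> unfolding is_form_def by blast
qed

section \<open>Multiplicities and strict transforms\<close>

lemma mult0_eq_0: "ev2 f (0, 0) \<noteq> 0 \<Longrightarrow> mult0 f = 0"
  unfolding mult0_def by (intro Least_eq_0) (auto simp: ev2_def poly_0_coeff_0)

text \<open>The linear part is expressed as a derivative because a derivative, unlike the
  coefficients, can be followed through changes of coordinates.\<close>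

lemma ev2_has_derivative_0:
  "(ev2 f has_derivative (\<lambda>h. coeff (coeff f 0) 1 * fst h + coeff (coeff f 1) 0 * snd h)) (at (0, 0))"
proof (induction f)
  case 0
  then show ?case by (simp add: ev2_def)
next
  case (pCons a p)
  have 1: "((\<lambda>w::complex\<times>complex. poly a (fst w)) has_derivative (\<lambda>h. poly (pderiv a) 0 * fst h)) (at (0, 0))"
    by (rule has_derivative_compose[where f = fst and g = "poly a" and g' = "(*) (poly (pderiv a) 0)" and f' = fst])
      (auto intro!: derivative_eq_intros simp: poly_DERIV[unfolded has_field_derivative_def])
  have 2: "((\<lambda>w. snd w * ev2 p w) has_derivative (\<lambda>h. snd h * ev2 p (0, 0))) (at (0, 0))"
    by (rule has_derivative_eq_rhs, rule has_derivative_mult[OF has_derivative_snd[OF has_derivative_ident] pCons(2)]) auto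
  have 3: "poly (pderiv a) 0 = coeff a 1" "ev2 p (0, 0) = coeff (coeff p 0) 0"
    by (simp_all add: poly_0_coeff_0 coeff_pderiv ev2_def)
  have "ev2 (pCons a p) = (\<lambda>w. poly a (fst w) + snd w * ev2 p w)"
    by (simp add: ev2_pCons fun_eq_iff)
  then show ?case
    using has_derivative_add[OF 1 2] 3 by (simp add: mult.commute)
qed

lemma mult0_gt_1:
  assumes "mult0 f > 1"
  shows "ev2 f (0, 0) = 0" "(ev2 f has_derivative (\<lambda>_. 0)) (at (0, 0))"
proof -
  have "coeff (coeff f j) i = 0" if "i + j < 2" for i j
  proof -
    have "i + j < mult0 f" using that assms by simp
    then have "\<not> (\<exists>i' j'. i' + j' = i + j \<and> coeff (coeff f j') i' \<noteq> 0)"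
      unfolding mult0_def by (rule not_less_Least)
    then show ?thesis by blast
  qed
  then show "ev2 f (0, 0) = 0" "(ev2 f has_derivative (\<lambda>_. 0)) (at (0, 0))"
    using ev2_has_derivative_0[of f] by (simp_all add: ev2_def poly_0_coeff_0)
qed

text \<open>A linear term survives because the restriction to the exceptional curve
  \<open>u = 0\<close> has a simple zero. This is the situation of a smooth branch that crosses the
  exceptional curve transversally.\<close>

lemma mult0_le_1:
  assumes "\<And>v. ev2 f (0, v) = v * poly r v" "poly r 0 \<noteq> 0"
  shows "mult0 f \<le> 1"
proof (rule ccontr)
  assume "\<not> mult0 f \<le> 1"
  then have d: "(ev2 f has_derivative (\<lambda>_. 0)) (at (0, 0))" by (intro mult0_gt_1) auto
  have "((\<lambda>v. ev2 f (0, v)) has_derivative (\<lambda>_. 0)) (at 0)"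
  proof -
    have "(Pair (0::complex) has_derivative Pair (0::complex)) (at (0::complex))"
      by (rule has_derivative_eq_rhs, rule has_derivative_Pair[OF has_derivative_const has_derivative_ident]) auto
    from has_derivative_compose[OF this d] show ?thesis by simp
  qed
  then have "((\<lambda>v. v * poly r v) has_field_derivative 0) (at 0)"
    by (simp add: assms(1) has_field_derivative_def lambda_zero)
  moreover have "((\<lambda>v. v * poly r v) has_field_derivative poly r 0) (at 0)"
    by (auto intro!: derivative_eq_intros)
  ultimately show False using DERIV_unique assms(2) by blast
qed

text \<open>Strict transforms are determined by division by a power of \<open>u\<close>; continuity
  in \<open>u\<close> supplies the values on \<open>u = 0\<close>.\<close>

lemma ev2_eq_closure:
  assumes "\<And>u v. u \<noteq> 0 \<Longrightarrow> ev2 f (u, v) = ev2 g (u, v)"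
  shows "f = g"
proof (rule ev2_inject)
  fix w :: "complex \<times> complex"
  obtain u v where w: "w = (u, v)" by fastforce
  have "((\<lambda>x. ev2 f (x, v)) \<longlongrightarrow> ev2 f (u, v)) (at u)" "((\<lambda>x. ev2 g (x, v)) \<longlongrightarrow> ev2 g (u, v)) (at u)"
    by (intro tendsto_intros)+
  moreover have "eventually (\<lambda>x. x \<noteq> 0) (at u)"
    by (rule eventually_neq_at_within)
  then have "eventually (\<lambda>x. ev2 f (x, v) = ev2 g (x, v)) (at u)"
    by (rule eventually_mono) (use assms in auto)
  ultimately show "ev2 f w = ev2 g w"
    unfolding w using Lim_transform_eventually tendsto_unique[OF trivial_limit_at] by fast
qed

text \<open>Substituting \<open>(u, u v)\<close> turns \<open>x^i y^j\<close> into
  \<open>u^(i+j) v^j\<close>: distinct monomials stay distinct and the order in \<open>u\<close> is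
  the total degree. Divisibility by \<open>u^d\<close> bounds all degrees from below, and a nonzero
  value of \<open>g\<close> on \<open>u = 0\<close> exhibits a term of degree
  \<open>d\<close>.\<close>

lemma mult0_eqI:
  assumes eq: "\<And>u v. ev2 f (u, u * v) = u ^ d * ev2 g (u, v)" and "ev2 g (0, v0) \<noteq> 0"
  shows "mult0 f = d"
proof -
  define X where "X = [:0, 1 :: complex:]"
  have X: "X ^ k = monom 1 k" for k by (simp add: X_def monom_altdef)
  have "pcompose f [:0, X:] = smult (X ^ d) g"
  proof (rule ev2_inject)
    fix w :: "complex \<times> complex"
    obtain u v where w: "w = (u, v)" by fastforce
    have "ev2 [:0, X:] (u, v) = u * v" "ev2 [:a:] (u, v) = poly a u" for a
      by (simp_all add: ev2_def X_def)
    then have "ev2 (pcompose f [:0, X:]) (u, v) = ev2 f (u, u * v)"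
      by (induction f) (simp_all only: pcompose_0 pcompose_pCons ev2_0 ev2_add ev2_mult ev2_pCons fst_conv snd_conv)
    moreover have "ev2 (smult (X ^ d) g) (u, v) = u ^ d * ev2 g (u, v)" by (simp add: ev2_def X_def)
    ultimately show "ev2 (pcompose f [:0, X:]) w = ev2 (smult (X ^ d) g) w" using eq w by simp
  qed
  then have "coeff (pcompose f [:0, X:]) j = coeff (smult (X ^ d) g) j" for j by simp
  then have c: "coeff (monom 1 j * coeff f j) k = coeff (monom 1 d * coeff g j) k" for j k
    by (simp add: coeff_pcompose_linear X)
  have "ev2 g (0, v) = 0" if "\<And>j. coeff (coeff g j) 0 = 0" for v
    using that
  proof (induction g)
    case (pCons a p)
    have "coeff a 0 = 0" "coeff (coeff p j) 0 = 0" for j using pCons(3)[of 0] pCons(3)[of "Suc j"] by simp_all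
    then show ?case using pCons(2) by (simp add: ev2_pCons poly_0_coeff_0)
  qed simp
  then obtain j where j: "coeff (coeff g j) 0 \<noteq> 0" using assms(2) by blast
  show ?thesis
    unfolding mult0_def
  proof (rule Least_equality)
    show "\<exists>i j. i + j = d \<and> coeff (coeff f j) i \<noteq> 0"
      using c[of j d] j by (intro exI[of _ "d - j"] exI[of _ j]) (auto simp: coeff_monom_mult split: if_splits)
    show "d \<le> e" if "\<exists>i j. i + j = e \<and> coeff (coeff f j) i \<noteq> 0" for e
      using that c by (metis coeff_monom_mult diff_add_inverse2 leI le_add2 linorder_not_le mult_1)
  qed
qed

lemma strict_transform_Some_unique:
  assumes "strict_transform f (Some s) g" "strict_transform f (Some s) g'"
  shows "g = g'"
  by (rule ev2_eq_closure) (use assms in auto)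

text \<open>On \<open>u = 0\<close> the power of \<open>v\<close> cancels off the origin, so
  \<open>g\<close> and \<open>F\<close> agree there; continuity carries this to the origin.\<close>

lemma strict_transform_None_nonzero:
  assumes "strict_transform f None g" "mult0 f = m"
    and "\<And>u v. ev2 f (u * v, v) = v ^ m * F (u, v)" "isCont F (0, 0)" "F (0, 0) \<noteq> 0"
  shows "mult0 g = 0"
proof -
  have "((\<lambda>v. ev2 g (0, v)) \<longlongrightarrow> ev2 g (0, 0)) (at 0)" by (intro tendsto_intros)
  moreover have "((\<lambda>v. F (0, v)) \<longlongrightarrow> F (0, 0)) (at 0)"
    by (rule isCont_tendsto_compose[OF assms(4)]) (intro tendsto_intros)
  moreover have "ev2 g (0, v) = F (0, v)" if "v \<noteq> 0" for v
    using assms(1)[simplified, rule_format, of 0 v] assms(2) assms(3)[of 0 v] that by simp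
  then have "eventually (\<lambda>v. ev2 g (0, v) = F (0, v)) (at 0)"
    by (simp add: eventually_at_filter)
  ultimately have "ev2 g (0, 0) = F (0, 0)"
    using Lim_transform_eventually tendsto_unique[OF trivial_limit_at] by fast
  then show ?thesis using assms(5) by (intro mult0_eq_0) simp
qed

section \<open>Tacnodes\<close>

text \<open>The product of the branches \<open>v E\<^sub>k(u) = D\<^sub>k(u)\<close>.\<close>

definition branches :: "'k set \<Rightarrow> ('k \<Rightarrow> complex poly) \<Rightarrow> ('k \<Rightarrow> complex poly) \<Rightarrow> complex poly poly" where
  "branches K D E = (\<Prod>k\<in>K. [:- D k, E k:])"

lemma ev2_branches: "ev2 (branches K D E) (u, v) = (\<Prod>k\<in>K. v * poly (E k) u - poly (D k) u)"
  unfolding branches_def ev2_prod by (intro prod.cong refl) (simp add: ev2_pCons)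

text \<open>Any two of the branches \<open>v = D\<^sub>k(u) / E\<^sub>k(u)\<close> have intersection multiplicity \<open>n\<close> at the origin.\<close>

definition contact :: "'k set \<Rightarrow> ('k \<Rightarrow> complex poly) \<Rightarrow> ('k \<Rightarrow> complex poly) \<Rightarrow> nat \<Rightarrow> bool" where
  "contact K D E n \<longleftrightarrow> finite K \<and> (\<forall>k\<in>K. poly (E k) 0 \<noteq> 0 \<and> poly (D k) 0 = 0) \<and>
     (\<forall>k\<in>K. \<forall>l\<in>K. k \<noteq> l \<longrightarrow> (\<exists>U. poly U 0 \<noteq> 0 \<and> D k * E l - D l * E k = monom 1 n * U))"

text \<open>A blow-up divides every cross difference \<open>D k * E l - D l * E k\<close> by
  \<open>u\<close>, so the contact drops by one. As long as it was at least two, all branches have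
  the same slope and one singular point remains; at contact one the slopes are distinct and every
  branch goes through its own point, transversally to the exceptional curve.\<close>

lemma sing_type_branches:
  assumes "contact K D E n" "card K = m" "m \<ge> 2" "n \<ge> 1"
  shows "mult0 (branches K D E) = m" "sing_type (branches K D E) (replicate n m)"
proof -
  have fin: "finite K" using assms(1) by (auto simp: contact_def)
  have "K \<noteq> {}" using assms by auto
  have main: "mult0 (branches K D E) = m \<and> sing_type (branches K D E) (replicate n m)"
    if "contact K D E n" "n \<ge> 1" for D E
    using that
  proof (induction n arbitrary: D E)
    case 0
    then show ?case by simp
  next
    case (Suc n)
    define f where "f = branches K D E"
    have "\<forall>k\<in>K. \<exists>d. D k = pCons 0 d"
      using Suc(2) unfolding contact_def by (metis pCons_cases poly_pCons mult_zero_left add.right_neutral)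
    then obtain D1 where D1: "D k = pCons 0 (D1 k)" if "k \<in> K" for k by metis
    have E0: "poly (E k) 0 \<noteq> 0" if "k \<in> K" for k using Suc(2) that by (auto simp: contact_def)
    have cross: "\<exists>U. poly U 0 \<noteq> 0 \<and> D1 k * E l - D1 l * E k = monom 1 n * U"
      if kl: "k \<in> K" "l \<in> K" "k \<noteq> l" for k l
    proof -
      obtain U where "poly U 0 \<noteq> 0" "D k * E l - D l * E k = monom 1 (Suc n) * U"
        using Suc(2) kl unfolding contact_def by blast
      then have "pCons 0 (D1 k * E l - D1 l * E k) = pCons 0 (monom 1 n * U)"
        using D1 kl by (simp add: monom_Suc)
      with \<open>poly U 0 \<noteq> 0\<close> show ?thesis by auto
    qed
    \<comment> \<open>\<open>g s\<close> is the proper transform near the direction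
      \<open>s\<close>: since \<open>D k\<close> is \<open>u\<close> times \<open>D1 k\<close>,
      substituting \<open>u (s + v)\<close> for \<open>v\<close> takes one factor \<open>u\<close>
      out of every branch.\<close>
    define g where "g s = branches K (\<lambda>k. D1 k - smult s (E k)) E" for s
    have ev_f: "ev2 f (u, u * (s + v)) = u ^ m * ev2 (g s) (u, v)" for u s v
    proof -
      have "(\<Prod>k\<in>K. u * (s + v) * poly (E k) u - poly (D k) u)
          = (\<Prod>k\<in>K. u * (v * poly (E k) u - poly (D1 k - smult s (E k)) u))"
        by (intro prod.cong refl) (simp add: D1 algebra_simps)
      then show ?thesis
        unfolding f_def g_def ev2_branches by (simp add: prod.distrib assms(2))
    qed
    define slope where "slope k = poly (D1 k) 0 / poly (E k) 0" for k
    have g0: "ev2 (g s) (0, v) = (\<Prod>k\<in>K. poly (E k) 0 * (v + s - slope k))" for s v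
      unfolding g_def ev2_branches by (intro prod.cong refl) (simp add: slope_def E0 field_simps)
    have "infinite (UNIV - slope ` K)"
      using fin infinite_UNIV_char_0 by (metis Diff_infinite_finite finite_imageI)
    then obtain v0 where "v0 \<notin> slope ` K" by (metis DiffE finite.emptyI ex_in_conv)
    then have "ev2 (g 0) (0, v0) \<noteq> 0" using fin E0 by (auto simp: g0)
    then have mult: "mult0 f = m"
      using ev_f[of _ 0] by (intro mult0_eqI[of f m "g 0" v0]) auto
    have st: "strict_transform f (Some s) (g s)" for s
      by (simp add: ev_f mult)
    have st_eq: "h = g s" if "strict_transform f (Some s) h" for s h
      using that st by (rule strict_transform_Some_unique)
    have st_None: "mult0 h = 0" if "strict_transform f None h" for h
    proof (rule strict_transform_None_nonzero[OF that mult])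
      define F where "F w = (\<Prod>k\<in>K. poly (E k) (fst w * snd w) - fst w * poly (D1 k) (fst w * snd w))" for w
      have "(\<Prod>k\<in>K. v * poly (E k) (u * v) - poly (D k) (u * v)) =
            (\<Prod>k\<in>K. v * (poly (E k) (u * v) - u * poly (D1 k) (u * v)))" for u v
        by (intro prod.cong refl) (simp add: D1 algebra_simps)
      then show "ev2 f (u * v, v) = v ^ m * F (u, v)" for u v
        unfolding f_def ev2_branches F_def by (simp add: prod.distrib assms(2))
      show "isCont F (0, 0)"
        unfolding F_def by (intro continuous_intros)
      show "F (0, 0) \<noteq> 0" using E0 fin by (simp add: F_def)
    qed
    show ?case
    proof (cases n)
      case 0
      \<comment> \<open>At contact one the cross difference formed with \<open>D1\<close> is nonzero
        at 0, which separates the tangent directions.\<close>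
      have inj: "slope k \<noteq> slope l" if kl: "k \<in> K" "l \<in> K" "k \<noteq> l" for k l
      proof -
        obtain U where U: "poly U 0 \<noteq> 0" "D1 k * E l - D1 l * E k = monom 1 n * U"
          using cross[OF kl] by blast
        then have "poly (D1 k * E l - D1 l * E k) 0 \<noteq> 0"
          using 0 by (simp only: U(2) poly_mult) (simp add: poly_monom)
        then show ?thesis using E0 kl by (simp add: slope_def field_simps)
      qed
      have le: "mult0 h \<le> 1" if "strict_transform f e h" for e h
      proof (cases e)
        case None
        then show ?thesis using st_None that by simp
      next
        case (Some s)
        have h: "h = g s" using st_eq that Some by simp
        show ?thesis
        proof (cases "s \<in> slope ` K")
          case False
          then have "ev2 h (0, 0) \<noteq> 0" using fin E0 by (auto simp: h g0)
          then show ?thesis using mult0_eq_0 by simp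
        next
          case True
          then obtain k0 where k0: "k0 \<in> K" "s = slope k0" by auto
          \<comment> \<open>What remains on the exceptional curve after the branch through this
            point is split off; it is nonzero at 0 because the other slopes differ from
            \<open>s\<close>.\<close>
          define r where "r = smult (poly (E k0) 0) (\<Prod>k\<in>K - {k0}. smult (poly (E k) 0) [:s - slope k, 1:])"
          have "ev2 h (0, v) = v * poly r v" for v
          proof -
            have "ev2 h (0, v) = poly (E k0) 0 * v * (\<Prod>k\<in>K - {k0}. poly (E k) 0 * (v + s - slope k))"
              unfolding h g0 using prod.remove[OF fin k0(1), of "\<lambda>k. poly (E k) 0 * (v + s - slope k)"] k0(2) by simp
            also have "(\<Prod>k\<in>K - {k0}. poly (E k) 0 * (v + s - slope k)) =
                (\<Prod>k\<in>K - {k0}. poly (smult (poly (E k) 0) [:s - slope k, 1:]) v)"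
              by (intro prod.cong refl) (simp add: algebra_simps)
            finally show ?thesis unfolding r_def by (simp add: poly_prod)
          qed
          moreover have "poly r 0 \<noteq> 0"
            using E0 k0 inj fin by (auto simp: r_def poly_prod)
          ultimately show ?thesis by (rule mult0_le_1)
        qed
      qed
      have "sing_type f [mult0 f]"
        by (rule sing_type.intros(1)) (use mult assms(3) le in auto)
      then show ?thesis using mult 0 by (simp add: f_def)
    next
      case (Suc n')
      obtain k0 where k0: "k0 \<in> K" using \<open>K \<noteq> {}\<close> by auto
      define s where "s = slope k0"
      \<comment> \<open>At contact at least two the cross difference formed with \<open>D1\<close>
        still vanishes at 0, which forces a common slope.\<close>
      have s: "slope k = s" if kK: "k \<in> K" for k
      proof (cases "k = k0")
        case False
        obtain U where "D1 k * E k0 - D1 k0 * E k = monom 1 n * U"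
          using cross[OF kK k0 False] by auto
        then have "poly (D1 k * E k0 - D1 k0 * E k) 0 = 0"
          using Suc by (simp add: poly_monom)
        then show ?thesis using E0 that k0 by (simp add: s_def slope_def field_simps)
      qed (simp add: s_def)
      have "contact K (\<lambda>k. D1 k - smult s (E k)) E n"
        unfolding contact_def
      proof (intro conjI ballI impI)
        show "poly (D1 k - smult s (E k)) 0 = 0" if "k \<in> K" for k
          using s[OF that] E0[OF that] by (auto simp: slope_def)
        show "\<exists>U. poly U 0 \<noteq> 0 \<and> (D1 k - smult s (E k)) * E l - (D1 l - smult s (E l)) * E k = monom 1 n * U"
          if "k \<in> K" "l \<in> K" "k \<noteq> l" for k l
          using cross[OF that] by (simp add: algebra_simps)
      qed (use fin E0 in auto)
      then have IH: "mult0 (g s) = m \<and> sing_type (g s) (replicate n m)"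
        unfolding g_def by (intro Suc.IH) (use Suc in auto)
      have other: "mult0 h \<le> 1" if "e \<noteq> Some s" "strict_transform f e h" for e h
      proof (cases e)
        case None
        then show ?thesis using st_None that by simp
      next
        case (Some s')
        have "h = g s'" using st_eq that(2) unfolding Some by blast
        then have "ev2 h (0, 0) \<noteq> 0" using that(1) Some s fin E0 by (auto simp: g0)
        then show ?thesis using mult0_eq_0 by simp
      qed
      have "sing_type f (mult0 f # replicate n m)"
        by (rule sing_type.intros(2)[where e = "Some s" and g = "g s"]) (use mult assms(3) st IH other in auto)
      then show ?thesis using mult by (simp add: f_def)
    qed
  qed
  then show "mult0 (branches K D E) = m" "sing_type (branches K D E) (replicate n m)"
    using assms by auto
qed

text \<open>Multiplication by \<open>x^n\<close> shifts the Taylor coefficients by \<open>n\<close>;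
  the factorials convert between coefficients and derivatives.\<close>

lemma higher_deriv_power_mult_0:
  assumes "\<phi> holomorphic_on ball 0 r" "r > 0"
  shows "(deriv ^^ l) (\<lambda>x. x ^ n * \<phi> x) 0 = (if l < n then 0 else fact l / fact (l - n) * (deriv ^^ (l - n)) \<phi> 0)"
proof -
  have "\<phi> has_fps_expansion fps_expansion \<phi> 0"
    using assms by (intro has_fps_expansion_fps_expansion[of "ball 0 r"]) auto
  then have "(\<lambda>x. x ^ n * \<phi> x) has_fps_expansion fps_X ^ n * fps_expansion \<phi> 0"
    by (intro fps_expansion_intros)
  from fps_nth_fps_expansion[OF this, of l] show ?thesis
    by (simp add: fps_X_power_mult_nth fps_expansion_def field_simps split: if_splits)
qed

text \<open>The branches are the graphs of \<open>D k / E k\<close>, and two of them differ by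
  \<open>x^(n+1)\<close> times a holomorphic function that is nonzero at 0. So the derivatives agree
  through order \<open>n\<close> and differ pairwise in the next one.\<close>

lemma tacnode0_branches:
  assumes "contact K D E (Suc n)" "card K = m"
  shows "tacnode0 (branches K D E) m n"
proof -
  have fin: "finite K" using assms by (simp add: contact_def)
  have E0: "poly (E k) 0 \<noteq> 0" and D0: "poly (D k) 0 = 0" if "k \<in> K" for k
    using assms that by (auto simp: contact_def)
  obtain h where h: "bij_betw h {..<m} K"
    using ex_bij_betw_nat_finite[OF fin] assms(2) by (auto simp: atLeast0LessThan)
  have "eventually (\<lambda>x. \<forall>k\<in>K. poly (E k) x \<noteq> 0) (nhds 0)"
    using fin
  proof (rule eventually_ball_finite; intro ballI)
    fix k assume "k \<in> K"
    then show "eventually (\<lambda>x. poly (E k) x \<noteq> 0) (nhds 0)"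
      using E0 by (intro tendsto_imp_eventually_ne[of "poly (E k)" "poly (E k) 0"]) (auto intro!: tendsto_intros filterlim_ident)
  qed
  then obtain \<epsilon> where \<epsilon>: "\<epsilon> > 0" "\<And>x k. x \<in> ball 0 \<epsilon> \<Longrightarrow> k \<in> K \<Longrightarrow> poly (E k) x \<noteq> 0"
    unfolding eventually_nhds_metric by (auto simp: dist_commute)
  define G where "G k x = poly (D k) x / poly (E k) x" for k x
  have holG: "G k holomorphic_on ball 0 \<epsilon>" if "k \<in> K" for k
    unfolding G_def using \<epsilon> that by (intro holomorphic_intros) auto
  have diff: "\<exists>c. c \<noteq> 0 \<and> (\<forall>i\<le>Suc n. (deriv ^^ i) (G k) 0 - (deriv ^^ i) (G l) 0 = (if i = Suc n then c else 0))"
    if kl: "k \<in> K" "l \<in> K" "k \<noteq> l" for k l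
  proof -
    obtain U where U: "poly U 0 \<noteq> 0" "D k * E l - D l * E k = monom 1 (Suc n) * U"
      using assms(1) kl unfolding contact_def by blast
    define \<phi> where "\<phi> x = poly U x / (poly (E k) x * poly (E l) x)" for x
    have hol: "\<phi> holomorphic_on ball 0 \<epsilon>"
      unfolding \<phi>_def using \<epsilon> kl by (intro holomorphic_intros) auto
    have eq: "G k x - G l x = x ^ Suc n * \<phi> x" if "x \<in> ball 0 \<epsilon>" for x
    proof -
      have "poly (D k) x * poly (E l) x - poly (D l) x * poly (E k) x = x ^ Suc n * poly U x"
        using arg_cong[OF U(2), of "\<lambda>p. poly p x"] by (simp add: poly_monom)
      then show ?thesis using \<epsilon>(2)[OF that] kl by (simp add: G_def \<phi>_def field_simps)
    qed
    have "(deriv ^^ i) (G k) 0 - (deriv ^^ i) (G l) 0 = (deriv ^^ i) (\<lambda>x. x ^ Suc n * \<phi> x) 0" for i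
    proof -
      have "(deriv ^^ i) (G k) 0 - (deriv ^^ i) (G l) 0 = (deriv ^^ i) (\<lambda>x. G k x - G l x) 0"
        using holG kl \<epsilon>(1) by (intro higher_deriv_diff[symmetric, of _ "ball 0 \<epsilon>"]) auto
      also have "\<dots> = (deriv ^^ i) (\<lambda>x. x ^ Suc n * \<phi> x) 0"
        using \<epsilon>(1) eq by (intro higher_deriv_cong_ev refl) (auto intro!: eventually_nhds_in_open elim!: eventually_mono simp: eventually_nhds_metric dist_commute)
      finally show ?thesis .
    qed
    then have "(deriv ^^ i) (G k) 0 - (deriv ^^ i) (G l) 0 = (if i = Suc n then fact (Suc n) * \<phi> 0 else 0)" if "i \<le> Suc n" for i
      using that unfolding higher_deriv_power_mult_0[OF hol \<epsilon>(1)] by auto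
    moreover have "fact (Suc n) * \<phi> 0 \<noteq> 0"
      using U E0 kl by (simp add: \<phi>_def del: fact_Suc)
    ultimately show ?thesis by blast
  qed
  show ?thesis unfolding tacnode0_def
  proof (rule exI[of _ 1], rule exI[of _ 0], rule exI[of _ 0], rule exI[of _ 1], rule exI[of _ \<epsilon>],
      rule exI[of _ "\<lambda>j. G (h j)"], intro conjI allI ballI impI)
    show "\<epsilon> > 0" by fact
    have hK: "h j \<in> K" if "j < m" for j using h that by (auto simp: bij_betw_def)
    show "G (h j) holomorphic_on ball 0 \<epsilon>" "G (h j) 0 = 0" if "j < m" for j
      using holG[OF hK[OF that]] D0[OF hK[OF that]] by (auto simp: G_def)
    show "(ev2 (branches K D E) (1 * x + 0 * y, 0 * x + 1 * y) = 0) = (\<exists>j<m. y = G (h j) x)"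
      if "x \<in> ball 0 \<epsilon>" for x y
    proof -
      have "ev2 (branches K D E) (x, y) = 0 \<longleftrightarrow> (\<exists>k\<in>K. y = G k x)"
        using fin \<epsilon>(2)[OF that] by (auto simp: ev2_branches G_def field_simps)
      also have "\<dots> \<longleftrightarrow> (\<exists>j<m. y = G (h j) x)"
        using h by (auto simp: bij_betw_def)
      finally show ?thesis by simp
    qed
    show "(deriv ^^ i) (G (h j)) 0 = (deriv ^^ i) (G (h 0)) 0" if "j < m" "i \<le> n" for j i
    proof (cases "h j = h 0")
      case False
      have "0 < m" using that by simp
      from diff[OF hK[OF \<open>j < m\<close>] hK[OF this] False] \<open>i \<le> n\<close> show ?thesis
        by (metis eq_iff_diff_eq_0 le_SucI not_less_eq_eq order_refl)
    qed simp
    show "inj_on (\<lambda>j. (deriv ^^ Suc n) (G (h j)) 0) {..<m}"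
    proof (rule inj_onI, rule ccontr)
      fix i j assume ij: "i \<in> {..<m}" "j \<in> {..<m}" "i \<noteq> j" "(deriv ^^ Suc n) (G (h i)) 0 = (deriv ^^ Suc n) (G (h j)) 0"
      then have "h i \<noteq> h j" using h by (auto simp: bij_betw_def inj_on_def)
      from diff[OF hK hK this] ij show False by auto
    qed
  qed simp
qed

section \<open>Regular maps\<close>

definition quot2 :: "complex poly poly \<Rightarrow> complex poly poly \<Rightarrow> complex poly poly \<Rightarrow> complex \<times> complex \<Rightarrow> complex \<times> complex" where
  "quot2 p1 p2 q w = (ev2 p1 w / ev2 q w, ev2 p2 w / ev2 q w)"

lemma regular_at_quot2:
  "regular_at X f z \<longleftrightarrow> (\<exists>c\<in>X. \<exists>p1 p2 q. ev2 q z \<noteq> 0 \<and> (\<forall>w. ev2 q w \<noteq> 0 \<longrightarrow> f w = c (quot2 p1 p2 q w)))"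
  unfolding regular_at_def quot2_def ..

text \<open>Substituting fractions with denominator \<open>q\<close> into a polynomial leaves a
  power of \<open>q\<close> as the only denominator.\<close>

lemma ev2_quot2:
  "\<exists>A N. \<forall>w. ev2 q w \<noteq> 0 \<longrightarrow> ev2 R (quot2 p1 p2 q w) = ev2 A w / ev2 q w ^ N"
proof -
  define P where "P f \<longleftrightarrow> (\<exists>A N. \<forall>w. ev2 q w \<noteq> 0 \<longrightarrow> f w = ev2 A w / ev2 q w ^ N)" for f
  have P_add: "P (\<lambda>w. f w + g w)" if fg: "P f" "P g" for f g
  proof -
    from fg obtain A N B M where *: "\<And>w. ev2 q w \<noteq> 0 \<Longrightarrow> f w = ev2 A w / ev2 q w ^ N"
      "\<And>w. ev2 q w \<noteq> 0 \<Longrightarrow> g w = ev2 B w / ev2 q w ^ M" unfolding P_def by blast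
    have "\<forall>w. ev2 q w \<noteq> 0 \<longrightarrow> f w + g w = ev2 (A * q ^ M + B * q ^ N) w / ev2 q w ^ (N + M)"
    proof (intro allI impI)
      fix w assume w: "ev2 q w \<noteq> 0"
      then show "f w + g w = ev2 (A * q ^ M + B * q ^ N) w / ev2 q w ^ (N + M)"
        unfolding *(1)[OF w] *(2)[OF w] by (simp add: field_simps power_add)
    qed
    then show ?thesis unfolding P_def by blast
  qed
  have P_mult: "P (\<lambda>w. f w * g w)" if fg: "P f" "P g" for f g
  proof -
    from fg obtain A N B M where *: "\<And>w. ev2 q w \<noteq> 0 \<Longrightarrow> f w = ev2 A w / ev2 q w ^ N"
      "\<And>w. ev2 q w \<noteq> 0 \<Longrightarrow> g w = ev2 B w / ev2 q w ^ M" unfolding P_def by blast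
    have "\<forall>w. ev2 q w \<noteq> 0 \<longrightarrow> f w * g w = ev2 (A * B) w / ev2 q w ^ (N + M)"
      using * by (simp add: power_add)
    then show ?thesis unfolding P_def by blast
  qed
  have P_const: "P (\<lambda>w. c)" for c
    unfolding P_def by (rule exI[of _ "[:[:c:]:]"], rule exI[of _ 0]) (simp add: ev2_def)
  have P1: "P (\<lambda>w. fst (quot2 p1 p2 q w))" "P (\<lambda>w. snd (quot2 p1 p2 q w))"
    unfolding P_def quot2_def by (metis fst_conv snd_conv power_one_right)+
  have "P (\<lambda>w. poly a (fst (quot2 p1 p2 q w)))" for a
    by (induction a) (auto intro!: P_add P_mult P_const P1)
  then have "P (\<lambda>w. ev2 R (quot2 p1 p2 q w))"
    by (induction R) (auto simp: ev2_pCons intro!: P_add P_mult P_const P1)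
  then show ?thesis unfolding P_def .
qed

lemma regular_at_compose:
  assumes f: "regular_at X f z" and g: "\<And>c u. c \<in> X \<Longrightarrow> c u = f z \<Longrightarrow> regular_at Y (g \<circ> c) u"
  shows "regular_at Y (g \<circ> f) z"
proof -
  obtain c p1 p2 q where c: "c \<in> X" "ev2 q z \<noteq> 0" "\<And>w. ev2 q w \<noteq> 0 \<Longrightarrow> f w = c (quot2 p1 p2 q w)"
    using f unfolding regular_at_quot2 by blast
  have "regular_at Y (g \<circ> c) (quot2 p1 p2 q z)"
    using g c by simp
  then obtain d R1 R2 Q where d: "d \<in> Y" "ev2 Q (quot2 p1 p2 q z) \<noteq> 0"
    "\<And>u. ev2 Q u \<noteq> 0 \<Longrightarrow> g (c u) = d (quot2 R1 R2 Q u)"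
    unfolding regular_at_quot2 by auto
  obtain A1 N1 A2 N2 A3 N3 where A:
    "\<And>w. ev2 q w \<noteq> 0 \<Longrightarrow> ev2 R1 (quot2 p1 p2 q w) = ev2 A1 w / ev2 q w ^ N1"
    "\<And>w. ev2 q w \<noteq> 0 \<Longrightarrow> ev2 R2 (quot2 p1 p2 q w) = ev2 A2 w / ev2 q w ^ N2"
    "\<And>w. ev2 q w \<noteq> 0 \<Longrightarrow> ev2 Q (quot2 p1 p2 q w) = ev2 A3 w / ev2 q w ^ N3"
    using ev2_quot2[of q R1 p1 p2] ev2_quot2[of q R2 p1 p2] ev2_quot2[of q Q p1 p2] by metis
  \<comment> \<open>The exponents clear the three denominators. The extra factor \<open>q\<close>
    makes \<open>S\<close> vanish wherever \<open>q\<close> does, even if \<open>N1\<close> and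
    \<open>N2\<close> are zero, so the formula for \<open>f\<close> is available wherever
    \<open>S\<close> is nonzero.\<close>
  define S where "S = A3 * q ^ (N1 + N2 + 1)"
  define T1 where "T1 = A1 * q ^ (N2 + N3 + 1)"
  define T2 where "T2 = A2 * q ^ (N1 + N3 + 1)"
  have S: "ev2 S w \<noteq> 0 \<longleftrightarrow> ev2 q w \<noteq> 0 \<and> ev2 Q (quot2 p1 p2 q w) \<noteq> 0" for w
    by (cases "ev2 q w = 0") (auto simp: S_def A(3))
  have "g (f w) = d (quot2 T1 T2 S w)" if "ev2 S w \<noteq> 0" for w
  proof -
    have w: "ev2 q w \<noteq> 0" "ev2 Q (quot2 p1 p2 q w) \<noteq> 0" using that S by auto
    then have "ev2 A3 w \<noteq> 0" using A(3) by auto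
    then have "quot2 R1 R2 Q (quot2 p1 p2 q w) = quot2 T1 T2 S w"
      using w(1) unfolding quot2_def[of R1] quot2_def[of T1] A(1)[OF w(1)] A(2)[OF w(1)] A(3)[OF w(1)]
      by (simp add: T1_def T2_def S_def field_simps power_add)
    then show ?thesis using d(3)[OF w(2)] c(3)[OF w(1)] by simp
  qed
  moreover have "ev2 S z \<noteq> 0" using S c(2) d(2) by auto
  ultimately show ?thesis
    unfolding regular_at_quot2 using d(1) by (metis comp_apply)
qed

text \<open>Regularity provides a formula in some chart of the atlas; composition with the
  transition map moves it into the chart \<open>d\<close> that contains the value.\<close>

lemma regular_at_chart:
  assumes "is_atlas X" "d \<in> X" "regular_at X f z" "f z \<in> range d"
  shows "regular_at {d} f z"
  using regular_at_compose[of X f z "{d}" id] assms unfolding is_atlas_def by fastforce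

lemma quot2_continuous: "ev2 q z \<noteq> 0 \<Longrightarrow> isCont (quot2 p1 p2 q) z"
  unfolding quot2_def by (intro continuous_intros isCont_ev2)

lemma eventually_ev2_nonzero: "ev2 q z \<noteq> 0 \<Longrightarrow> eventually (\<lambda>w. ev2 q w \<noteq> 0) (nhds z)"
  by (intro tendsto_imp_eventually_ne[of "ev2 q" "ev2 q z"] tendsto_intros filterlim_ident)

lemma holomorphic_on_ev2 [holomorphic_intros]:
  assumes "(\<lambda>t. fst (f t)) holomorphic_on S" "(\<lambda>t. snd (f t)) holomorphic_on S"
  shows "(\<lambda>t. ev2 p (f t)) holomorphic_on S"
proof (induction p)
  case (pCons a p)
  have "(\<lambda>t. poly a (fst (f t))) holomorphic_on S"
    by (induction a) (auto intro!: holomorphic_intros assms)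
  with pCons show ?case by (auto simp: ev2_pCons intro!: holomorphic_intros assms)
qed (simp)

text \<open>An exact first order expansion: the cofactors are polynomials whose values at
  \<open>z\<close> are the partial derivatives, so one can divide by a parameter and then pass to
  the limit.\<close>

lemma ev2_taylor:
  "\<exists>A B. \<forall>w. ev2 p w - ev2 p z = (fst w - fst z) * ev2 A w + (snd w - snd z) * ev2 B w"
proof (induction p)
  case 0
  show ?case by (rule exI[of _ 0], rule exI[of _ 0]) simp
next
  case (pCons a p)
  then obtain A B where *: "\<And>w. ev2 p w - ev2 p z = (fst w - fst z) * ev2 A w + (snd w - snd z) * ev2 B w"
    by blast
  have AB: "ev2 p w = ev2 p z + (fst w - fst z) * ev2 A w + (snd w - snd z) * ev2 B w" for w
    using *[of w] by (simp add: algebra_simps)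
  have "[:- fst z, 1:] dvd a - [:poly a (fst z):]"
    by (simp add: poly_eq_0_iff_dvd[symmetric])
  then obtain c where "a - [:poly a (fst z):] = [:- fst z, 1:] * c" by (auto elim: dvdE)
  from arg_cong[OF this, of "\<lambda>p. poly p x" for x]
  have c: "poly a x = poly a (fst z) + (x - fst z) * poly c x" for x
    by (simp add: algebra_simps)
  have "\<forall>w. ev2 (pCons a p) w - ev2 (pCons a p) z =
     (fst w - fst z) * ev2 ([:c:] + [:[:snd z:]:] * A) w + (snd w - snd z) * ev2 (p + [:[:snd z:]:] * B) w"
  proof
    fix w
    have "ev2 [:c:] w = poly c (fst w)" "ev2 [:[:snd z:]:] w = snd z" by (simp_all add: ev2_def)
    then show "ev2 (pCons a p) w - ev2 (pCons a p) z =
     (fst w - fst z) * ev2 ([:c:] + [:[:snd z:]:] * A) w + (snd w - snd z) * ev2 (p + [:[:snd z:]:] * B) w"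
      unfolding ev2_pCons ev2_add ev2_mult c[of "fst w"] AB[of w] by (simp add: algebra_simps)
  qed
  then show ?case by blast
qed

text \<open>The vanishing is asked for only near \<open>t\<close>, which suits formulas that hold
  where a denominator is nonzero.\<close>

lemma closure_eq_0:
  fixes \<phi> :: "'a::t2_space \<Rightarrow> 'b::{t1_space, zero}"
  assumes "t \<in> closure A" "isCont \<phi> t" "eventually (\<lambda>w. w \<in> A \<longrightarrow> \<phi> w = 0) (nhds t)"
  shows "\<phi> t = 0"
proof (rule ccontr)
  assume "\<phi> t \<noteq> 0"
  then have "eventually (\<lambda>w. \<phi> w \<noteq> 0) (nhds t)"
    using assms(2) by (intro tendsto_imp_eventually_ne) (auto simp: isCont_def tendsto_at_iff_tendsto_nhds)
  with assms(3) have "eventually (\<lambda>w. w \<notin> A) (nhds t)"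
    by eventually_elim auto
  then obtain S where "open S" "t \<in> S" "\<And>w. w \<in> S \<Longrightarrow> w \<notin> A"
    by (auto simp: eventually_nhds)
  then show False using assms(1) by (meson disjoint_iff open_Int_closure_eq_empty)
qed

section \<open>Closed sets and proper transforms, chart by chart\<close>

definition closed_in :: "'a atlas \<Rightarrow> 'a set \<Rightarrow> bool" where
  "closed_in X C \<longleftrightarrow> (\<forall>c\<in>X. closed (c -` C))"

lemma closed_vimage_regular:
  assumes "\<And>z. regular_at X f z" "closed_in X C"
  shows "closed (f -` C)"
proof -
  have "eventually (\<lambda>w. w \<in> - (f -` C)) (nhds z)" if "z \<in> - (f -` C)" for z
  proof -
    obtain c p1 p2 q where c: "c \<in> X" "ev2 q z \<noteq> 0" "\<And>w. ev2 q w \<noteq> 0 \<Longrightarrow> f w = c (quot2 p1 p2 q w)"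
      using assms(1)[of z] unfolding regular_at_quot2 by blast
    have "open (- (c -` C))" using assms(2) c(1) by (auto simp: closed_in_def)
    moreover have "quot2 p1 p2 q z \<in> - (c -` C)" using that c by auto
    ultimately have "eventually (\<lambda>w. quot2 p1 p2 q w \<in> - (c -` C)) (nhds z)"
      using quot2_continuous[OF c(2)] by (intro topological_tendstoD) (auto simp: isCont_def tendsto_at_iff_tendsto_nhds)
    with eventually_ev2_nonzero[OF c(2)] show ?thesis
      by eventually_elim (use c(3) in auto)
  qed
  then have "open (- (f -` C))"
    unfolding eventually_nhds open_subopen[of "- (f -` C)"] subset_iff by (simp add: Ball_def)
  then show ?thesis by (simp add: closed_def)
qed

lemma subset_zclosure:
  assumes "S \<subseteq> points X" shows "S \<subseteq> zclosure X S"
proof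
  fix x assume x: "x \<in> S"
  then obtain c z where c: "c \<in> X" "x = c z" using assms by (auto simp: points_def)
  then have "z \<in> closure (c -` S)" using x closure_subset[of "c -` S"] by auto
  with c show "x \<in> zclosure X S" unfolding zclosure_def by (intro UN_I[of c] image_eqI[of _ c z])
qed

lemma zclosure_eq:
  assumes "closed_in X S" "S \<subseteq> points X" shows "zclosure X S = S"
proof
  show "S \<subseteq> zclosure X S" using assms(2) by (rule subset_zclosure)
  show "zclosure X S \<subseteq> S"
  proof
    fix x assume "x \<in> zclosure X S"
    then obtain c z where "c \<in> X" "z \<in> closure (c -` S)" "x = c z" by (auto simp: zclosure_def)
    then show "x \<in> S" using assms(1) by (auto simp: closed_in_def)
  qed
qed

lemma zclosure_mono: "S \<subseteq> T \<Longrightarrow> zclosure X S \<subseteq> zclosure X T"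
  unfolding zclosure_def by (intro UN_mono order_refl image_mono closure_mono) auto

lemma blow_up_closed_in:
  assumes "blow_up X p Y \<pi>" "closed_in X C"
  shows "closed_in Y {y \<in> points Y. \<pi> y \<in> C}"
  unfolding closed_in_def
proof
  fix d assume d: "d \<in> Y"
  have "d -` {y \<in> points Y. \<pi> y \<in> C} = (\<pi> \<circ> d) -` C"
    using d by (auto simp: points_def)
  moreover have "closed ((\<pi> \<circ> d) -` C)"
    using assms d by (intro closed_vimage_regular[of X]) (auto simp: blow_up_def)
  ultimately show "closed (d -` {y \<in> points Y. \<pi> y \<in> C})" by simp
qed

lemma proper_transform_subset:
  assumes "blow_up X p Y \<pi>" "closed_in X C"
  shows "proper_transform Y \<pi> p C \<subseteq> {y \<in> points Y. \<pi> y \<in> C}"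
proof -
  have "proper_transform Y \<pi> p C \<subseteq> zclosure Y {y \<in> points Y. \<pi> y \<in> C}"
    unfolding proper_transform_def by (intro zclosure_mono) auto
  also have "\<dots> = {y \<in> points Y. \<pi> y \<in> C}"
    by (intro zclosure_eq blow_up_closed_in[OF assms]) auto
  finally show ?thesis .
qed

lemma proper_transform_eq:
  assumes "blow_up X p Y \<pi>" "closed_in X C" "p \<notin> C"
  shows "proper_transform Y \<pi> p C = {y \<in> points Y. \<pi> y \<in> C}"
proof -
  have "{y \<in> points Y. \<pi> y \<in> C - {p}} = {y \<in> points Y. \<pi> y \<in> C}" using assms(3) by auto
  then show ?thesis
    unfolding proper_transform_def using zclosure_eq[OF blow_up_closed_in[OF assms(1,2)]] by auto
qed

lemma subset_proper_transform: "{y \<in> points Y. \<pi> y \<in> C - {p}} \<subseteq> proper_transform Y \<pi> p C"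
  unfolding proper_transform_def by (rule subset_zclosure) auto

section \<open>Tangent directions on the exceptional curve\<close>

text \<open>A point of the exceptional curve determines a tangent direction \<open>\<delta>\<close> at the blown up point, and
  a curve whose proper transform passes through it is tangent to \<open>\<delta>\<close>.\<close>

lemma blow_up_direction:
  assumes bu: "blow_up X p Y \<pi>" and e: "e \<in> X" "e z0 = p" and y: "y \<in> points Y" "\<pi> y = p"
  obtains \<delta>1 \<delta>2 :: complex where "(\<delta>1, \<delta>2) \<noteq> (0, 0)"
    "\<And>C \<alpha> \<beta>. y \<in> proper_transform Y \<pi> p C \<Longrightarrow>
       (\<And>w. e w \<in> C \<Longrightarrow> \<alpha> * (fst w - fst z0) + \<beta> * (snd w - snd z0) = 0) \<Longrightarrow> \<alpha> * \<delta>1 + \<beta> * \<delta>2 = 0"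
proof -
  note result = that
  obtain c d1 d2 where at: "is_atlas (insert c X)" "is_atlas (insert d1 (insert d2 Y))"
    and c0: "c (0, 0) = p" and rng: "range d1 \<union> range d2 = {y \<in> points Y. \<pi> y \<in> range c}"
    and \<pi>12: "\<forall>u v. \<pi> (d1 (u, v)) = c (u, u * v)" "\<forall>u v. \<pi> (d2 (u, v)) = c (u * v, v)"
    using bu[unfolded blow_up_def] by (elim conjE exE) (rule that, assumption+)
  have \<pi>1: "\<pi> (d1 (u, v)) = c (u, u * v)" and \<pi>2: "\<pi> (d2 (u, v)) = c (u * v, v)" for u v
    using \<pi>12 by auto
  have inj: "inj c" "inj e" "inj d1" "inj d2" using at e by (auto simp: is_atlas_def)
  have "c (0, 0) \<in> range e" "e z0 \<in> range c" using c0 e by (metis rangeI)+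
  \<comment> \<open>Both \<open>c\<close> and \<open>e\<close> contain the centre, so the change of
    coordinates is regular in both directions; this will make its differential injective.\<close>
  then have "regular_at {e} c (0, 0)" "regular_at {c} e z0"
    using at(1) e(1) unfolding is_atlas_def by blast+
  then obtain p1 p2 q r1 r2 Q where
    q: "ev2 q (0, 0) \<noteq> 0" "\<And>w. ev2 q w \<noteq> 0 \<Longrightarrow> c w = e (quot2 p1 p2 q w)" and
    Q: "ev2 Q z0 \<noteq> 0" "\<And>w. ev2 Q w \<noteq> 0 \<Longrightarrow> e w = c (quot2 r1 r2 Q w)"
    unfolding regular_at_quot2 by blast
  have H0: "quot2 p1 p2 q (0, 0) = z0" using q c0 e inj by (metis injD)
  have K0: "quot2 r1 r2 Q z0 = (0, 0)" using Q c0 e inj by (metis injD)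
  define X0 Y0 where "X0 = ([:[:fst z0:]:] :: complex poly poly)" and "Y0 = ([:[:snd z0:]:] :: complex poly poly)"
  have XY: "ev2 X0 w = fst z0" "ev2 Y0 w = snd z0" for w by (auto simp: X0_def Y0_def ev2_def)
  obtain A1 B1 A2 B2 where
    t1: "\<And>w. ev2 (p1 - X0 * q) w - ev2 (p1 - X0 * q) (0, 0) = (fst w - 0) * ev2 A1 w + (snd w - 0) * ev2 B1 w" and
    t2: "\<And>w. ev2 (p2 - Y0 * q) w - ev2 (p2 - Y0 * q) (0, 0) = (fst w - 0) * ev2 A2 w + (snd w - 0) * ev2 B2 w"
    using ev2_taylor[of "p1 - X0 * q" "(0, 0)"] ev2_taylor[of "p2 - Y0 * q" "(0, 0)"] by auto
  have "ev2 (p1 - X0 * q) (0, 0) = 0" "ev2 (p2 - Y0 * q) (0, 0) = 0"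
    using H0 q(1) by (auto simp: quot2_def XY)
  then have t1: "ev2 (p1 - X0 * q) w = fst w * ev2 A1 w + snd w * ev2 B1 w"
    and t2: "ev2 (p2 - Y0 * q) w = fst w * ev2 A2 w + snd w * ev2 B2 w" for w
    using t1[of w] t2[of w] by auto
  have H: "fst (quot2 p1 p2 q w) - fst z0 = (fst w * ev2 A1 w + snd w * ev2 B1 w) / ev2 q w"
    "snd (quot2 p1 p2 q w) - snd z0 = (fst w * ev2 A2 w + snd w * ev2 B2 w) / ev2 q w" if "ev2 q w \<noteq> 0" for w
    using that t1[of w, symmetric] t2[of w, symmetric] by (simp_all add: quot2_def XY field_simps)
  obtain A3 B3 A4 B4 where
    t3: "\<And>w. ev2 r1 w - ev2 r1 z0 = (fst w - fst z0) * ev2 A3 w + (snd w - snd z0) * ev2 B3 w" and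
    t4: "\<And>w. ev2 r2 w - ev2 r2 z0 = (fst w - fst z0) * ev2 A4 w + (snd w - snd z0) * ev2 B4 w"
    using ev2_taylor[of r1 z0] ev2_taylor[of r2 z0] by blast
  have "ev2 r1 z0 = 0" "ev2 r2 z0 = 0" using K0 Q(1) by (auto simp: quot2_def)
  then have t3: "ev2 r1 w = (fst w - fst z0) * ev2 A3 w + (snd w - snd z0) * ev2 B3 w"
    and t4: "ev2 r2 w = (fst w - fst z0) * ev2 A4 w + (snd w - snd z0) * ev2 B4 w" for w
    using t3[of w] t4[of w] by auto
  \<comment> \<open>Up to the factor \<open>ev2 q (0, 0)\<close>, the pair of \<open>lin1\<close>
    and \<open>lin2\<close> is the differential at the origin of the change of coordinates from
    \<open>c\<close> to \<open>e\<close>. A scalar factor does not affect linear conditions on a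
    direction.\<close>
  define lin1 lin2 where "lin1 \<tau> = fst \<tau> * ev2 A1 (0, 0) + snd \<tau> * ev2 B1 (0, 0)"
    and "lin2 \<tau> = fst \<tau> * ev2 A2 (0, 0) + snd \<tau> * ev2 B2 (0, 0)" for \<tau>
  have nonzero: "(lin1 \<tau>, lin2 \<tau>) \<noteq> (0, 0)" if "\<tau> \<noteq> (0, 0)" for \<tau>
  proof
    assume l: "(lin1 \<tau>, lin2 \<tau>) = (0, 0)"
    obtain \<tau>1 \<tau>2 where \<tau>: "\<tau> = (\<tau>1, \<tau>2)" by fastforce
    \<comment> \<open>Along the ray in direction \<tau> the inverse change of coordinates recovers
      \<open>w t\<close> from \<open>g t\<close>. Dividing by \<open>t\<close> and letting it tend
      to 0 yields \<tau> = 0 if the differential kills \<tau>.\<close>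
    define w where "w t = (t * \<tau>1, t * \<tau>2)" for t :: complex
    define m1 where "m1 t = (\<tau>1 * ev2 A1 (w t) + \<tau>2 * ev2 B1 (w t)) / ev2 q (w t)" for t
    define m2 where "m2 t = (\<tau>1 * ev2 A2 (w t) + \<tau>2 * ev2 B2 (w t)) / ev2 q (w t)" for t
    define g where "g t = quot2 p1 p2 q (w t)" for t
    have w: "(w \<longlongrightarrow> (0, 0)) (at 0)"
      unfolding w_def by (auto intro!: tendsto_eq_intros)
    have g: "(g \<longlongrightarrow> z0) (at 0)"
      unfolding g_def H0[symmetric] by (rule isCont_tendsto_compose[OF quot2_continuous[OF q(1)] w])
    have m1: "(m1 \<longlongrightarrow> 0) (at 0)"
    proof -
      have "(m1 \<longlongrightarrow> (\<tau>1 * ev2 A1 (0, 0) + \<tau>2 * ev2 B1 (0, 0)) / ev2 q (0, 0)) (at 0)"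
        unfolding m1_def by (intro tendsto_intros w q)
      then show ?thesis using l by (simp add: lin1_def \<tau>)
    qed
    have m2: "(m2 \<longlongrightarrow> 0) (at 0)"
    proof -
      have "(m2 \<longlongrightarrow> (\<tau>1 * ev2 A2 (0, 0) + \<tau>2 * ev2 B2 (0, 0)) / ev2 q (0, 0)) (at 0)"
        unfolding m2_def by (intro tendsto_intros w q)
      then show ?thesis using l by (simp add: lin2_def \<tau>)
    qed
    have ev: "eventually (\<lambda>t. ev2 q (w t) \<noteq> 0 \<and> ev2 Q (g t) \<noteq> 0 \<and> t \<noteq> 0) (at 0)"
      by (intro eventually_conj tendsto_imp_eventually_ne[OF tendsto_ev2[OF w] q(1)]
          tendsto_imp_eventually_ne[OF tendsto_ev2[OF g] Q(1)] eventually_neq_at_within)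
    have eq: "\<tau>1 = (m1 t * ev2 A3 (g t) + m2 t * ev2 B3 (g t)) / ev2 Q (g t) \<and>
        \<tau>2 = (m1 t * ev2 A4 (g t) + m2 t * ev2 B4 (g t)) / ev2 Q (g t)"
      if t: "ev2 q (w t) \<noteq> 0 \<and> ev2 Q (g t) \<noteq> 0 \<and> t \<noteq> 0" for t
    proof -
      have "c (w t) = c (quot2 r1 r2 Q (g t))"
        using q(2)[of "w t"] Q(2)[of "g t"] t by (simp add: g_def)
      then have K: "quot2 r1 r2 Q (g t) = w t" using inj by (metis injD)
      have "fst (g t) - fst z0 = t * m1 t" "snd (g t) - snd z0 = t * m2 t"
        unfolding g_def using H[of "w t"] t by (simp_all add: w_def m1_def m2_def field_simps)
      then have "ev2 r1 (g t) = t * (m1 t * ev2 A3 (g t) + m2 t * ev2 B3 (g t))"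
        "ev2 r2 (g t) = t * (m1 t * ev2 A4 (g t) + m2 t * ev2 B4 (g t))"
        unfolding t3 t4 by (simp_all add: algebra_simps)
      then have "t * \<tau>1 = t * ((m1 t * ev2 A3 (g t) + m2 t * ev2 B3 (g t)) / ev2 Q (g t))"
        "t * \<tau>2 = t * ((m1 t * ev2 A4 (g t) + m2 t * ev2 B4 (g t)) / ev2 Q (g t))"
        using K by (simp_all add: quot2_def w_def)
      then show ?thesis using t unfolding mult_cancel_left by blast
    qed
    have "((\<lambda>t. (m1 t * ev2 A3 (g t) + m2 t * ev2 B3 (g t)) / ev2 Q (g t)) \<longlongrightarrow> (0 * ev2 A3 z0 + 0 * ev2 B3 z0) / ev2 Q z0) (at 0)"
      "((\<lambda>t. (m1 t * ev2 A4 (g t) + m2 t * ev2 B4 (g t)) / ev2 Q (g t)) \<longlongrightarrow> (0 * ev2 A4 z0 + 0 * ev2 B4 z0) / ev2 Q z0) (at 0)"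
      by (intro tendsto_intros m1 m2 g Q)+
    moreover have "eventually (\<lambda>t. (m1 t * ev2 A3 (g t) + m2 t * ev2 B3 (g t)) / ev2 Q (g t) = \<tau>1) (at 0)"
      "eventually (\<lambda>t. (m1 t * ev2 A4 (g t) + m2 t * ev2 B4 (g t)) / ev2 Q (g t) = \<tau>2) (at 0)"
      using ev by (eventually_elim; use eq in auto)+
    ultimately have "((\<lambda>t. \<tau>1) \<longlongrightarrow> 0) (at (0::complex))" "((\<lambda>t. \<tau>2) \<longlongrightarrow> 0) (at (0::complex))"
      using Lim_transform_eventually by (auto simp del: tendsto_const_iff)
    then have "\<tau>1 = 0" "\<tau>2 = 0" by (auto dest!: LIM_const_eq)
    then show False using that \<tau> by simp
  qed
  \<comment> \<open>Both charts of the blow-up have this shape: \<mu> is the equation of the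
    exceptional curve and \<tau> gives the direction that a point of this curve stands for.\<close>
  have main: thesis
    if d: "d \<in> {d1, d2}" and yd: "y = d \<sigma>" and dT: "\<And>z. \<pi> (d z) = c (\<mu> z * fst (\<tau> z), \<mu> z * snd (\<tau> z))"
      and cont: "isCont \<mu> \<sigma>" "isCont \<tau> \<sigma>" and \<mu>: "\<mu> \<sigma> = 0" and \<tau>0: "\<tau> \<sigma> \<noteq> (0, 0)"
    for d \<sigma> and \<mu> :: "complex \<times> complex \<Rightarrow> complex" and \<tau>
  proof (rule result[of "lin1 (\<tau> \<sigma>)" "lin2 (\<tau> \<sigma>)"])
    show "(lin1 (\<tau> \<sigma>), lin2 (\<tau> \<sigma>)) \<noteq> (0, 0)" by (rule nonzero[OF \<tau>0])
    fix C \<alpha> \<beta>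
    assume PT: "y \<in> proper_transform Y \<pi> p C"
      and C: "\<And>w. e w \<in> C \<Longrightarrow> \<alpha> * (fst w - fst z0) + \<beta> * (snd w - snd z0) = 0"
    obtain d' t where d': "d' \<in> Y" "y = d' t" "t \<in> closure (d' -` {y \<in> points Y. \<pi> y \<in> C - {p}})"
      using PT unfolding proper_transform_def zclosure_def by auto
    have "d' t \<in> range d" using yd d'(2) by (metis rangeI)
    then have "regular_at {d} d' t" using at(2) d d'(1) unfolding is_atlas_def by blast
    then obtain s1 s2 S where S: "ev2 S t \<noteq> 0" "\<And>w. ev2 S w \<noteq> 0 \<Longrightarrow> d' w = d (quot2 s1 s2 S w)"
      unfolding regular_at_quot2 by blast
    define r where "r = quot2 s1 s2 S"
    have injd: "inj d" using d inj by auto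
    have rt: "r t = \<sigma>" using S d'(2) yd injd unfolding r_def by (metis injD)
    have cr: "isCont r t" unfolding r_def by (rule quot2_continuous[OF S(1)])
    define W where "W w = (\<mu> (r w) * fst (\<tau> (r w)), \<mu> (r w) * snd (\<tau> (r w)))" for w
    have cW: "isCont W t" "isCont (\<lambda>w. \<tau> (r w)) t"
      unfolding W_def using isCont_o2[OF cr, of \<mu>] isCont_o2[OF cr, of \<tau>] cont rt
      by (auto intro!: continuous_intros)
    have Wt: "W t = (0, 0)" by (simp add: W_def rt \<mu>)
    \<comment> \<open>The linear condition divided by \<mu>. On the part of the curve off the centre
      \<mu> is nonzero and cancels, so \<phi> vanishes there; its value at \<open>t\<close> is the
      condition on the direction.\<close>
    define \<phi> where "\<phi> w = \<alpha> * (fst (\<tau> (r w)) * ev2 A1 (W w) + snd (\<tau> (r w)) * ev2 B1 (W w))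
        + \<beta> * (fst (\<tau> (r w)) * ev2 A2 (W w) + snd (\<tau> (r w)) * ev2 B2 (W w))" for w
    have "\<phi> t = 0"
    proof (rule closure_eq_0[OF d'(3)])
      have "isCont (\<lambda>w. ev2 p (W w)) t" for p
        using isCont_o2[OF cW(1) isCont_ev2] .
      then show "isCont \<phi> t" unfolding \<phi>_def using cW(2) by (intro continuous_intros)
      have "((\<lambda>w. ev2 q (W w)) \<longlongrightarrow> ev2 q (0, 0)) (nhds t)"
        using isCont_o2[OF cW(1) isCont_ev2, of q] tendsto_at_iff_tendsto_nhds[of "\<lambda>w. ev2 q (W w)" t]
        by (simp add: isCont_def Wt)
      then have "eventually (\<lambda>w. ev2 q (W w) \<noteq> 0) (nhds t)"
        using q(1) by (rule tendsto_imp_eventually_ne)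
      with eventually_ev2_nonzero[OF S(1)]
      show "eventually (\<lambda>w. w \<in> d' -` {y \<in> points Y. \<pi> y \<in> C - {p}} \<longrightarrow> \<phi> w = 0) (nhds t)"
      proof eventually_elim
        case (elim w)
        show ?case
        proof
          assume "w \<in> d' -` {y \<in> points Y. \<pi> y \<in> C - {p}}"
          then have "\<pi> (d (r w)) \<in> C - {p}" using S(2)[OF elim(1)] by (simp add: r_def)
          then have WC: "c (W w) \<in> C" "W w \<noteq> (0, 0)" using dT c0 by (auto simp: W_def)
          then have \<mu>0: "\<mu> (r w) \<noteq> 0" by (auto simp: W_def)
          have "e (quot2 p1 p2 q (W w)) \<in> C" using WC(1) q(2)[OF elim(2)] by simp
          from C[OF this] have "(\<alpha> * (fst (W w) * ev2 A1 (W w) + snd (W w) * ev2 B1 (W w))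
             + \<beta> * (fst (W w) * ev2 A2 (W w) + snd (W w) * ev2 B2 (W w))) / ev2 q (W w) = 0"
            unfolding H[OF elim(2)] by (simp add: add_divide_distrib distrib_left)
          then have "\<mu> (r w) * \<phi> w = 0" using elim(2) by (simp add: \<phi>_def W_def algebra_simps)
          then show "\<phi> w = 0" using \<mu>0 by simp
        qed
      qed
    qed
    then show "\<alpha> * lin1 (\<tau> \<sigma>) + \<beta> * lin2 (\<tau> \<sigma>) = 0"
      by (simp add: \<phi>_def lin1_def lin2_def rt Wt)
  qed
  have "y \<in> range d1 \<union> range d2" using y rng c0 by (metis (mono_tags, lifting) mem_Collect_eq rangeI)
  then consider u v where "y = d1 (u, v)" | u v where "y = d2 (u, v)" by auto
  then show thesis
  proof cases
    case 1
    have "u = 0" using y 1 \<pi>1[of u v] c0 inj(1) by (metis Pair_inject injD)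
    show thesis
      by (rule main[of d1 "(u, v)" fst "\<lambda>z. (1, snd z)"])
        (use 1 \<pi>1 \<open>u = 0\<close> in \<open>auto intro!: continuous_intros\<close>)
  next
    case 2
    have "v = 0" using y 2 \<pi>2[of u v] c0 inj(1) by (metis Pair_inject injD)
    show thesis
      by (rule main[of d2 "(u, v)" snd "\<lambda>z. (fst z, 1)"])
        (use 2 \<pi>2 \<open>v = 0\<close> in \<open>auto intro!: continuous_intros simp: mult.commute\<close>)
  qed
qed

section \<open>Regular functions of two variables\<close>

definition regular_fun :: "(complex \<times> complex \<Rightarrow> complex) \<Rightarrow> bool" where
  "regular_fun f \<longleftrightarrow> (\<forall>z. \<exists>p q. ev2 q z \<noteq> 0 \<and> (\<forall>w. ev2 q w \<noteq> 0 \<longrightarrow> f w = ev2 p w / ev2 q w))"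

lemma regular_fun_isCont:
  assumes "regular_fun f" shows "isCont f z"
proof -
  obtain p q where q: "ev2 q z \<noteq> 0" "\<And>w. ev2 q w \<noteq> 0 \<Longrightarrow> f w = ev2 p w / ev2 q w"
    using assms unfolding regular_fun_def by blast
  have "isCont (\<lambda>w. ev2 p w / ev2 q w) z"
    using q(1) by (intro continuous_intros isCont_ev2)
  moreover have "eventually (\<lambda>w. f w = ev2 p w / ev2 q w) (nhds z)"
    using eventually_ev2_nonzero[OF q(1)] by eventually_elim (use q(2) in auto)
  ultimately show ?thesis using isCont_cong[of f "\<lambda>w. ev2 p w / ev2 q w" z] by simp
qed

lemma regular_fun_holomorphic:
  assumes "regular_fun f" "(\<lambda>t. fst (h t)) holomorphic_on UNIV" "(\<lambda>t. snd (h t)) holomorphic_on UNIV"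
  shows "(\<lambda>t. f (h t)) holomorphic_on UNIV"
proof -
  have "(\<lambda>t. f (h t)) field_differentiable (at t)" for t
  proof -
    obtain p q where q: "ev2 q (h t) \<noteq> 0" "\<And>w. ev2 q w \<noteq> 0 \<Longrightarrow> f w = ev2 p w / ev2 q w"
      using assms unfolding regular_fun_def by blast
    define S where "S = {u. ev2 q (h u) \<noteq> 0}"
    have hq: "(\<lambda>u. ev2 q (h u)) holomorphic_on UNIV" by (intro holomorphic_intros assms)
    have "open ((\<lambda>u. ev2 q (h u)) -` (- {0}))"
      using holomorphic_on_imp_continuous_on[OF hq] by (intro open_vimage) auto
    moreover have "(\<lambda>u. ev2 q (h u)) -` (- {0}) = S" by (auto simp: S_def)
    ultimately have S: "open S" "t \<in> S" using q(1) by (auto simp: S_def)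
    have "(\<lambda>u. ev2 p (h u) / ev2 q (h u)) holomorphic_on S"
      by (intro holomorphic_intros holomorphic_on_subset[OF assms(2)] holomorphic_on_subset[OF assms(3)]) (auto simp: S_def)
    then have "(\<lambda>u. f (h u)) holomorphic_on S"
      by (rule holomorphic_transform) (use q(2) in \<open>auto simp: S_def\<close>)
    then show ?thesis using S holomorphic_on_imp_differentiable_at by blast
  qed
  then show ?thesis by (simp add: holomorphic_on_def field_differentiable_at_within)
qed

lemma regular_fun_if_chart:
  assumes "is_atlas X" "e \<in> X" "\<And>z. regular_at X f z" "\<And>w. f w = e (fst w, \<psi> w)"
  shows "regular_fun \<psi>"
  unfolding regular_fun_def
proof
  fix z
  have "regular_at {e} f z"
    by (rule regular_at_chart[OF assms(1-3)]) (auto simp: assms(4))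
  then obtain p1 p2 q where q: "ev2 q z \<noteq> 0" "\<And>w. ev2 q w \<noteq> 0 \<Longrightarrow> f w = e (quot2 p1 p2 q w)"
    unfolding regular_at_quot2 by blast
  have "\<psi> w = ev2 p2 w / ev2 q w" if "ev2 q w \<noteq> 0" for w
  proof -
    have "(fst w, \<psi> w) = quot2 p1 p2 q w"
      using q(2)[OF that] assms(1,2,4) by (metis injD is_atlas_def)
    then show ?thesis by (simp add: quot2_def)
  qed
  then show "\<exists>p q. ev2 q z \<noteq> 0 \<and> (\<forall>w. ev2 q w \<noteq> 0 \<longrightarrow> \<psi> w = ev2 p w / ev2 q w)"
    using q(1) by blast
qed

text \<open>A pole at infinity makes \<open>f\<close> a polynomial, injectivity keeps its derivative
  free of zeros, and a polynomial without zeros is constant.\<close>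

lemma injective_entire_affine:
  fixes f :: "complex \<Rightarrow> complex"
  assumes "f holomorphic_on UNIV" "inj f" "((\<lambda>w. inverse (f (inverse w))) \<longlongrightarrow> 0) (at 0)"
  shows "f y = f 0 + (f 1 - f 0) * y"
proof -
  have "((inverse \<circ> f) \<longlongrightarrow> 0) at_infinity"
    unfolding lim_at_infinity_0 using assms(3) by (simp add: o_def)
  then obtain c n where c: "\<And>z. f z = (\<Sum>i\<le>n. c i * z ^ i)"
    using pole_at_infinity[OF assms(1)] by metis
  define P where "P = (\<Sum>i\<le>n. monom (c i) i)"
  have P: "f z = poly P z" for z by (simp add: c P_def poly_sum poly_monom)
  then have fP: "f = poly P" by auto
  have "poly (pderiv P) z \<noteq> 0" for z
    using holomorphic_injective_imp_regular[OF assms(1) open_UNIV assms(2), of z]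
    by (simp add: fP DERIV_imp_deriv[OF poly_DERIV])
  then have "constant (poly (pderiv P))"
    using fundamental_theorem_of_algebra by blast
  then have "degree (pderiv P) = 0" by (simp add: constant_degree)
  then have "degree P \<le> 1" by (simp add: degree_pderiv)
  then obtain a b where "P = [:a, b:]"
    by (intro that[of "coeff P 0" "coeff P 1"] poly_eqI) (auto simp: coeff_pCons coeff_eq_0 split: nat.splits)
  then show ?thesis unfolding P by simp
qed

section \<open>Sections of the Hirzebruch surfaces\<close>

definition chart1 :: "complex \<times> complex \<Rightarrow> hpt" where "chart1 = (\<lambda>(x, y). (Some x, Some y))"
definition chart2 :: "complex \<times> complex \<Rightarrow> hpt" where "chart2 = (\<lambda>(x, w). (Some x, recip w))"
definition chart3 :: "nat \<Rightarrow> complex \<times> complex \<Rightarrow> hpt" where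
  "chart3 n = (\<lambda>(x, y). (recip x, if x = 0 then Some y else Some (y / x ^ n)))"
definition chart4 :: "nat \<Rightarrow> complex \<times> complex \<Rightarrow> hpt" where
  "chart4 n = (\<lambda>(x, w). (recip x, if x = 0 then recip w else recip (w * x ^ n)))"

lemma hirz_charts: "hirz n = {chart1, chart2, chart3 n, chart4 n}"
  unfolding hirz_def chart1_def chart2_def chart3_def chart4_def ..

lemma recip_eq_iff [simp]: "recip w = Some y \<longleftrightarrow> w \<noteq> 0 \<and> y = 1 / w" "recip w = None \<longleftrightarrow> w = 0"
  "Some y = recip w \<longleftrightarrow> w \<noteq> 0 \<and> y = 1 / w"
  by (auto simp: recip_def)

lemma recip_0 [simp]: "recip 0 = None" by (simp add: recip_def)

lemma points_hirz [simp]: "points (hirz n) = UNIV"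
proof -
  have "\<exists>c\<in>hirz n. z \<in> range c" for z :: hpt
  proof (cases "fst z"; cases "snd z")
    fix x y assume "fst z = Some x" "snd z = Some y"
    then have "z = chart1 (x, y)" by (simp add: chart1_def prod_eq_iff)
    then show ?thesis by (auto simp: hirz_charts)
  next
    fix x assume "fst z = Some x" "snd z = None"
    then have "z = chart2 (x, 0)" by (simp add: chart2_def prod_eq_iff)
    then show ?thesis by (auto simp: hirz_charts)
  next
    fix y assume "fst z = None" "snd z = Some y"
    then have "z = chart3 n (0, y)" by (simp add: chart3_def prod_eq_iff)
    then show ?thesis by (auto simp: hirz_charts)
  next
    assume "fst z = None" "snd z = None"
    then have "z = chart4 n (0, 0)" by (simp add: chart4_def prod_eq_iff)
    then show ?thesis by (auto simp: hirz_charts)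
  qed
  then show ?thesis unfolding points_def by auto
qed

text \<open>Binary forms of degree \<open>n\<close>, as functions; they are the sections of \<open>F\<^sub>n\<close> that avoid the
  exceptional section. The form \<open>linform a\<close> vanishes at the base point \<open>a\<close>.\<close>

definition binary_form :: "nat \<Rightarrow> (complex \<times> complex \<Rightarrow> complex) \<Rightarrow> bool" where
  "binary_form n f \<longleftrightarrow> poly_fun2 f \<and> (\<forall>c s t. f (c * s, c * t) = c ^ n * f (s, t))"

fun hom_coord :: "P1 \<Rightarrow> complex \<times> complex" where
  "hom_coord (Some x) = (1, x)" | "hom_coord None = (0, 1)"

fun linform :: "P1 \<Rightarrow> complex \<times> complex \<Rightarrow> complex" where
  "linform (Some a) w = snd w - a * fst w" | "linform None w = fst w"

lemma poly_fun2_linform: "poly_fun2 (linform a)"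
proof (cases a)
  case None
  then have "linform a = (\<lambda>w. fst w)" by (simp add: fun_eq_iff)
  then show ?thesis using poly_fun2_fst by simp
next
  case (Some x)
  then have "linform a = (\<lambda>w. snd w - x * fst w)" by (simp add: fun_eq_iff)
  then show ?thesis using poly_fun2_diff[OF poly_fun2_snd poly_fun2_mult[OF poly_fun2_const poly_fun2_fst]] by simp
qed

lemma binary_form_linform: "binary_form 1 (linform a)"
proof -
  have "linform a (c * s, c * t) = c * linform a (s, t)" for c s t
    by (cases a) (simp_all add: algebra_simps)
  then show ?thesis using poly_fun2_linform by (simp add: binary_form_def)
qed

lemma binary_form_mult: "binary_form n f \<Longrightarrow> binary_form m g \<Longrightarrow> binary_form (n + m) (\<lambda>w. f w * g w)"
  unfolding binary_form_def using poly_fun2_mult by (simp add: power_add)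

lemma binary_form_cmult: "binary_form n f \<Longrightarrow> binary_form n (\<lambda>w. c * f w)"
  unfolding binary_form_def using poly_fun2_mult[OF poly_fun2_const] by simp

lemma binary_form_power: "binary_form n f \<Longrightarrow> binary_form (n * k) (\<lambda>w. f w ^ k)"
  unfolding binary_form_def using poly_fun2_power by (simp add: power_mult_distrib power_mult)

lemma binary_form_add: "binary_form n f \<Longrightarrow> binary_form n g \<Longrightarrow> binary_form n (\<lambda>w. f w + g w)"
  unfolding binary_form_def using poly_fun2_add by (simp add: distrib_left)

lemma binary_form_diff: "binary_form n f \<Longrightarrow> binary_form n g \<Longrightarrow> binary_form n (\<lambda>w. f w - g w)"
  unfolding binary_form_def using poly_fun2_diff by (simp add: right_diff_distrib)

lemma binary_form_scale: "binary_form n f \<Longrightarrow> f (c * s, c * t) = c ^ n * f (s, t)"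
  by (simp add: binary_form_def)

text \<open>In the coordinate \<open>x\<close> at infinity, homogeneity produces the power of
  \<open>x\<close> that occurs in the gluing of the bundle.\<close>

lemma binary_form_hom_coord:
  assumes "binary_form n f" "x \<noteq> 0" shows "f (hom_coord (recip x)) = f (x, 1) / x ^ n"
proof -
  have "f (x * 1, x * (1 / x)) = x ^ n * f (1, 1 / x)" by (rule binary_form_scale[OF assms(1)])
  then show ?thesis using assms(2) by (simp add: recip_def field_simps)
qed

lemma linform_hom_coord_eq_0 [simp]: "linform a (hom_coord b) = 0 \<longleftrightarrow> a = b"
  by (cases a; cases b) auto

lemma linform_hom_coord_self [simp]: "linform a (hom_coord a) = 0"
  by simp

lemma closed_poly_fun2: "poly_fun2 f \<Longrightarrow> poly_fun2 g \<Longrightarrow> closed {w. f w = g w}"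
  unfolding poly_fun2_def
proof (elim exE)
  fix p q assume "\<forall>w. f w = ev2 p w" "\<forall>w. g w = ev2 q w"
  then show "closed {w. f w = g w}"
    using closed_Collect_eq[OF continuous_on_ev2[OF continuous_on_id] continuous_on_ev2[OF continuous_on_id], of p q]
    by presburger
qed

text \<open>The curve \<open>y l\<^sub>b\<^sup>k = G + \<kappa> W\<close> \<open>(\<kappa> \<in> K)\<close>, which for \<open>k > 0\<close> meets the fibre over \<open>b\<close> in the
  exceptional section.\<close>

definition pencil :: "P1 \<Rightarrow> nat \<Rightarrow> complex set \<Rightarrow> (complex \<times> complex \<Rightarrow> complex) \<Rightarrow> (complex \<times> complex \<Rightarrow> complex) \<Rightarrow> hpt set" where
  "pencil b k K G W = {(a, Some y) |a y. \<exists>\<kappa>\<in>K. y * linform b (hom_coord a) ^ k = G (hom_coord a) + \<kappa> * W (hom_coord a)} \<union>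
     {(a, None) |a. linform b (hom_coord a) ^ k = 0}"

lemma mem_pencil:
  "(a, Some y) \<in> pencil b k K G W \<longleftrightarrow> (\<exists>\<kappa>\<in>K. y * linform b (hom_coord a) ^ k = G (hom_coord a) + \<kappa> * W (hom_coord a))"
  "(a, None) \<in> pencil b k K G W \<longleftrightarrow> linform b (hom_coord a) ^ k = 0"
  by (auto simp: pencil_def)

text \<open>Near the exceptional section the coordinate is \<open>w = 1 / y\<close>. Multiplying the
  equation by \<open>w\<close> also covers \<open>w = 0\<close>, where the condition no longer
  involves \<kappa> and only some element of \<open>K\<close> has to exist.\<close>

lemma mem_pencil_recip:
  assumes "K \<noteq> {}"
  shows "(a, recip w) \<in> pencil b k K G W \<longleftrightarrow>
    (\<exists>\<kappa>\<in>K. linform b (hom_coord a) ^ k = w * (G (hom_coord a) + \<kappa> * W (hom_coord a)))"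
proof (cases "w = 0")
  case True
  then show ?thesis using assms unfolding True recip_0 mem_pencil by auto
next
  case False
  then have eq: "recip w = Some (1 / w)" by simp
  show ?thesis using False unfolding eq mem_pencil by (simp add: field_simps)
qed

text \<open>In every chart the set is a finite union of zero sets of polynomials. The degree
  \<open>n + k\<close> makes the powers of \<open>x\<close> from the gluing cancel: \<open>y\<close>
  has weight \<open>n\<close>, and the power of the linear form has weight \<open>k\<close>.\<close>

lemma closed_in_pencil:
  assumes "finite K" "K \<noteq> {}" and G: "binary_form (n + k) G" and W: "binary_form (n + k) W"
  shows "closed_in (hirz n) (pencil b k K G W)"
proof -
  define A where "A \<kappa> w = G w + \<kappa> * W w" for \<kappa> w
  have A: "binary_form (n + k) (A \<kappa>)" for \<kappa>
    unfolding A_def by (intro binary_form_add binary_form_cmult G W)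
  have pf: "poly_fun2 (\<lambda>w. A \<kappa> (f w, g w))" "poly_fun2 (\<lambda>w. linform b (f w, g w))"
    if "poly_fun2 f" "poly_fun2 g" for \<kappa> f g
  proof -
    have ev: "poly_fun2 (\<lambda>w. ev2 p (f w, g w))" for p
      by (induction p) (auto simp: ev2_pCons intro!: poly_fun2_intros poly_fun2_poly that)
    obtain p where "A \<kappa> = ev2 p" using A[of \<kappa>] unfolding binary_form_def poly_fun2_def by blast
    then show "poly_fun2 (\<lambda>w. A \<kappa> (f w, g w))" using ev by simp
    obtain q where "linform b = ev2 q" using poly_fun2_linform[of b] unfolding poly_fun2_def by blast
    then show "poly_fun2 (\<lambda>w. linform b (f w, g w))" using ev by simp
  qed
  have c1: "chart1 -` pencil b k K G W = (\<Union>\<kappa>\<in>K. {w. snd w * linform b (1, fst w) ^ k = A \<kappa> (1, fst w)})"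
    by (auto simp: chart1_def mem_pencil A_def)
  have c2: "chart2 -` pencil b k K G W = (\<Union>\<kappa>\<in>K. {w. linform b (1, fst w) ^ k = snd w * A \<kappa> (1, fst w)})"
    by (auto simp: chart2_def mem_pencil_recip[OF assms(2)] A_def)
  have A': "G (hom_coord (recip x)) + \<kappa> * W (hom_coord (recip x)) = A \<kappa> (x, 1) / x ^ (n + k)"
    "linform b (hom_coord (recip x)) = linform b (x, 1) / x" if "x \<noteq> 0" for x \<kappa>
    using binary_form_hom_coord[OF A that] binary_form_hom_coord[OF binary_form_linform that] by (auto simp: A_def)
  have A0: "G (hom_coord (recip 0)) + \<kappa> * W (hom_coord (recip 0)) = A \<kappa> (0, 1)" for \<kappa>
    by (simp add: A_def)
  have "(x, y) \<in> chart3 n -` pencil b k K G W \<longleftrightarrow> (\<exists>\<kappa>\<in>K. y * linform b (x, 1) ^ k = A \<kappa> (x, 1))" for x y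
  proof (cases "x = 0")
    case True
    then show ?thesis by (simp add: chart3_def mem_pencil A_def)
  next
    case False
    then have "(x, y) \<in> chart3 n -` pencil b k K G W \<longleftrightarrow> (recip x, Some (y / x ^ n)) \<in> pencil b k K G W"
      by (simp add: chart3_def)
    also have "\<dots> \<longleftrightarrow> (\<exists>\<kappa>\<in>K. y * linform b (x, 1) ^ k = A \<kappa> (x, 1))"
      unfolding mem_pencil A'[OF False] using False by (simp add: power_divide power_add)
    finally show ?thesis .
  qed
  then have c3: "chart3 n -` pencil b k K G W = (\<Union>\<kappa>\<in>K. {w. snd w * linform b (fst w, 1) ^ k = A \<kappa> (fst w, 1)})"
    by (simp add: set_eq_iff split_paired_all)
  have "(x, y) \<in> chart4 n -` pencil b k K G W \<longleftrightarrow> (\<exists>\<kappa>\<in>K. linform b (x, 1) ^ k = y * A \<kappa> (x, 1))" for x y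
  proof (cases "x = 0")
    case True
    then have "(x, y) \<in> chart4 n -` pencil b k K G W \<longleftrightarrow> (None, recip y) \<in> pencil b k K G W"
      by (simp add: chart4_def)
    then show ?thesis unfolding mem_pencil_recip[OF assms(2)] using True by (simp add: A_def)
  next
    case False
    then have "(x, y) \<in> chart4 n -` pencil b k K G W \<longleftrightarrow> (recip x, recip (y * x ^ n)) \<in> pencil b k K G W"
      by (simp add: chart4_def)
    also have "\<dots> \<longleftrightarrow> (\<exists>\<kappa>\<in>K. linform b (x, 1) ^ k = y * A \<kappa> (x, 1))"
      unfolding mem_pencil_recip[OF assms(2)] A'[OF False] using False by (simp add: power_divide power_add)
    finally show ?thesis .
  qed
  then have c4: "chart4 n -` pencil b k K G W = (\<Union>\<kappa>\<in>K. {w. linform b (fst w, 1) ^ k = snd w * A \<kappa> (fst w, 1)})"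
    by (simp add: set_eq_iff split_paired_all)
  have "closed (\<Union>\<kappa>\<in>K. {w. f \<kappa> w = g \<kappa> w})" if "\<And>\<kappa>. poly_fun2 (f \<kappa>)" "\<And>\<kappa>. poly_fun2 (g \<kappa>)" for f g
    using assms(1) by (intro closed_UN ballI closed_poly_fun2 that)
  then show ?thesis
    unfolding closed_in_def hirz_charts
    by (simp add: c1 c2 c3 c4 poly_fun2_intros pf)
qed

section \<open>Elementary transformations in coordinates\<close>

lemma blow_upD:
  assumes "blow_up X p Y \<pi>"
  shows "is_atlas X" "d \<in> Y \<Longrightarrow> regular_at X (\<pi> \<circ> d) z"
    "bij_betw \<pi> {y \<in> points Y. \<pi> y \<noteq> p} (points X - {p})"
    "c \<in> X \<Longrightarrow> c z \<noteq> p \<Longrightarrow> regular_at Y (inv_into {y \<in> points Y. \<pi> y \<noteq> p} \<pi> \<circ> c) z"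
  using assms by (simp_all add: blow_up_def del: split_paired_All split_paired_Ex)

lemma chart_injective:
  assumes "blow_up (hirz n) p Y \<pi>" shows "inj chart1" "inj chart2" "inj (chart3 n)"
  using blow_upD(1)[OF assms] by (simp_all add: is_atlas_def hirz_charts)

text \<open>Continuity in the chart at infinity is polynomial growth in the finite chart, the input
  of the Liouville theorem.\<close>

lemma at_infinity_bounded:
  fixes f g :: "complex \<Rightarrow> complex"
  assumes "isCont g 0" "\<And>s. s \<noteq> 0 \<Longrightarrow> g s = s ^ k * f (1 / s)"
  shows "\<exists>A B. \<forall>x. A \<le> norm x \<longrightarrow> norm (f x) \<le> B * norm x ^ k"
proof -
  have "eventually (\<lambda>s. norm (g s) < norm (g 0) + 1) (nhds 0)"
  proof (rule order_tendstoD(2))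
    show "((\<lambda>s. norm (g s)) \<longlongrightarrow> norm (g 0)) (nhds 0)"
      using assms(1) tendsto_at_iff_tendsto_nhds[of g 0] by (auto simp: isCont_def intro: tendsto_norm)
  qed simp
  then obtain \<delta> where \<delta>: "\<delta> > 0" "\<And>s. norm s < \<delta> \<Longrightarrow> norm (g s) < norm (g 0) + 1"
    unfolding eventually_nhds_metric by (auto simp: dist_norm)
  have "norm (f x) \<le> (norm (g 0) + 1) * norm x ^ k" if "2 / \<delta> \<le> norm x" for x
  proof -
    have "x \<noteq> 0" using that \<delta>(1) by (auto simp: field_simps)
    have "norm (1 / x) < \<delta>"
      using that \<delta>(1) \<open>x \<noteq> 0\<close> by (simp add: norm_divide field_simps)
    then have "norm (g (1 / x)) < norm (g 0) + 1" by (rule \<delta>(2))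
    moreover have "f x = g (1 / x) * x ^ k"
      using assms(2)[of "1 / x"] \<open>x \<noteq> 0\<close> by (simp add: power_divide)
    ultimately show ?thesis by (simp add: norm_mult norm_power mult_right_mono)
  qed
  then show ?thesis by blast
qed

text \<open>An elementary transformation of the first type, or the inverse of one of the second type: \<open>\<pi>\<close> and
  \<open>\<pi>'\<close> are the two projections of the graph, in this or the opposite order.\<close>

locale link =
  fixes n :: nat and a :: P1 and \<eta> :: complex and Y :: graph and \<pi> \<pi>' :: "hpt \<times> hpt \<Rightarrow> hpt"
  assumes bu: "blow_up (hirz n) (a, None) Y \<pi>" and bu': "blow_up (hirz (Suc n)) (a, Some \<eta>) Y \<pi>'"
    and base: "\<And>z. z \<in> points Y \<Longrightarrow> fst (\<pi> z) = fst (\<pi>' z)"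
    and contr: "\<And>z. z \<in> points Y \<Longrightarrow> fst (\<pi> z) = a \<Longrightarrow> \<pi> z \<noteq> (a, None) \<Longrightarrow> \<pi>' z = (a, Some \<eta>)"
    and exc: "\<And>z. z \<in> points Y \<Longrightarrow> fst (\<pi> z) \<noteq> a \<Longrightarrow> snd (\<pi> z) = None \<longleftrightarrow> snd (\<pi>' z) = None"
begin

definition lift :: "hpt \<Rightarrow> hpt \<times> hpt" where
  "lift = inv_into {y \<in> points Y. \<pi> y \<noteq> (a, None)} \<pi>"

text \<open>The rational map of the link, meaningful at every point except the centre
  \<open>(a, None)\<close>.\<close>

definition trans :: "hpt \<Rightarrow> hpt" where "trans x = \<pi>' (lift x)"

lemma lift: assumes "x \<noteq> (a, None)" shows "lift x \<in> points Y" "\<pi> (lift x) = x"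
proof -
  have "\<pi> ` {y \<in> points Y. \<pi> y \<noteq> (a, None)} = UNIV - {(a, None)}"
    using blow_upD(3)[OF bu] by (simp add: bij_betw_def)
  then have h: "x \<in> \<pi> ` {y \<in> points Y. \<pi> y \<noteq> (a, None)}" using assms by simp
  then show "lift x \<in> points Y" "\<pi> (lift x) = x"
    using inv_into_into[OF h] f_inv_into_f[OF h] unfolding lift_def by simp_all
qed

lemma trans_regular:
  assumes "c \<in> hirz n" "c u \<noteq> (a, None)" shows "regular_at (hirz (Suc n)) (trans \<circ> c) u"
proof -
  have "regular_at Y (lift \<circ> c) u"
    unfolding lift_def by (rule blow_upD(4)[OF bu assms])
  moreover have "regular_at (hirz (Suc n)) (\<pi>' \<circ> d) v" if "d \<in> Y" for d v
    by (rule blow_upD(2)[OF bu' that])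
  ultimately have "regular_at (hirz (Suc n)) (\<pi>' \<circ> (lift \<circ> c)) u"
    by (rule regular_at_compose)
  moreover have "\<pi>' \<circ> (lift \<circ> c) = trans \<circ> c" by (simp add: trans_def fun_eq_iff)
  ultimately show ?thesis by simp
qed

lemma trans_off:
  assumes "x \<noteq> a" shows "fst (trans (x, y)) = x" "snd (trans (x, y)) = None \<longleftrightarrow> y = None"
proof -
  have "(x, y) \<noteq> (a, None)" using assms by simp
  note l = lift[OF this]
  show "fst (trans (x, y)) = x" "snd (trans (x, y)) = None \<longleftrightarrow> y = None"
    using base[OF l(1)] exc[OF l(1)] assms unfolding trans_def l(2) by simp_all
qed

lemma trans_on: "trans (a, Some y) = (a, Some \<eta>)"
proof -
  have "(a, Some y) \<noteq> (a, None)" by simp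
  note l = lift[OF this]
  show ?thesis using contr[OF l(1)] unfolding trans_def l(2) by simp
qed

text \<open>Over a base point other than \<open>a\<close> the images avoid the centre of
  \<open>\<pi>'\<close>, off which \<open>\<pi>'\<close> is injective.\<close>

lemma trans_inj:
  assumes "x \<noteq> a" "trans (x, y) = trans (x, y')" shows "y = y'"
proof -
  have "inj_on \<pi>' {z \<in> points Y. \<pi>' z \<noteq> (a, Some \<eta>)}"
    using blow_upD(3)[OF bu'] by (simp add: bij_betw_def)
  moreover have "\<pi>' (lift (x, y)) \<noteq> (a, Some \<eta>)" "\<pi>' (lift (x, y')) \<noteq> (a, Some \<eta>)"
    using trans_off[OF assms(1)] assms(1) unfolding trans_def by (metis fst_conv)+
  ultimately have "lift (x, y) = lift (x, y')"
    using assms lift(1) unfolding trans_def by (auto dest: inj_onD)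
  then show ?thesis using lift(2) assms(1) by (metis Pair_inject)
qed

lemma trans_fin: "\<exists>c. trans (x, Some y) = (x, Some c)"
proof (cases "x = a")
  case True
  then show ?thesis using trans_on by blast
next
  case False
  then have "fst (trans (x, Some y)) = x" "snd (trans (x, Some y)) \<noteq> None" using trans_off by auto
  then show ?thesis by (metis option.exhaust prod.collapse)
qed

definition \<phi> :: "complex \<times> complex \<Rightarrow> complex" where
  "\<phi> w = the (snd (trans (chart1 w)))"

text \<open>The fibre coordinate of the image in the chart at the infinite base point. It is
  specified through the chart because \<open>chart3\<close> is given by cases; uniqueness is
  injectivity of the chart.\<close>

definition \<psi> :: "complex \<times> complex \<Rightarrow> complex" where
  "\<psi> w = (THE c. trans (chart3 n w) = chart3 (Suc n) (fst w, c))"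

lemma \<phi>: "trans (chart1 w) = chart1 (fst w, \<phi> w)"
  using trans_fin[of "Some (fst w)" "snd w"] by (auto simp: chart1_def \<phi>_def case_prod_beta)

lemma \<psi>: "trans (chart3 n w) = chart3 (Suc n) (fst w, \<psi> w)"
proof -
  obtain y where y: "chart3 n w = (recip (fst w), Some y)"
    by (cases "fst w = 0") (simp_all add: chart3_def case_prod_beta)
  obtain c where c: "trans (recip (fst w), Some y) = (recip (fst w), Some c)" using trans_fin by blast
  have "\<exists>c'. (recip (fst w), Some c) = chart3 (Suc n) (fst w, c')"
  proof (cases "fst w = 0")
    case True
    then show ?thesis by (auto simp: chart3_def)
  next
    case False
    then show ?thesis by (intro exI[of _ "c * fst w ^ Suc n"]) (auto simp: chart3_def)
  qed
  then obtain c' where c': "trans (chart3 n w) = chart3 (Suc n) (fst w, c')" using y c by auto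
  moreover have "c'' = c'" if "trans (chart3 n w) = chart3 (Suc n) (fst w, c'')" for c''
    using chart_injective(3)[OF bu'] c' that by (metis Pair_inject injD)
  ultimately show ?thesis unfolding \<psi>_def by (rule theI)
qed

lemma atlas': "is_atlas (hirz (Suc n))" by (rule blow_upD(1)[OF bu'])

lemma regular_\<phi>: "regular_fun \<phi>"
proof (rule regular_fun_if_chart[OF atlas'])
  show "chart1 \<in> hirz (Suc n)" by (simp add: hirz_charts)
  show "regular_at (hirz (Suc n)) (trans \<circ> chart1) z" for z
    by (rule trans_regular) (auto simp: hirz_charts chart1_def case_prod_beta)
  show "(trans \<circ> chart1) w = chart1 (fst w, \<phi> w)" for w using \<phi> by simp
qed

lemma regular_\<psi>: "regular_fun \<psi>"
proof (rule regular_fun_if_chart[OF atlas'])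
  show "chart3 (Suc n) \<in> hirz (Suc n)" by (simp add: hirz_charts)
  show "regular_at (hirz (Suc n)) (trans \<circ> chart3 n) z" for z
    by (rule trans_regular) (auto simp: hirz_charts chart3_def case_prod_beta)
  show "(trans \<circ> chart3 n) w = chart3 (Suc n) (fst w, \<psi> w)" for w using \<psi> by simp
qed

lemma \<psi>_\<phi>: assumes "s \<noteq> 0" shows "\<psi> (s, y) = s ^ Suc n * \<phi> (1 / s, y / s ^ n)"
proof -
  have "chart3 n (s, y) = chart1 (1 / s, y / s ^ n)"
    using assms by (simp add: chart3_def chart1_def recip_def)
  then have "chart3 (Suc n) (s, \<psi> (s, y)) = chart1 (1 / s, \<phi> (1 / s, y / s ^ n))"
    using \<phi>[of "(1 / s, y / s ^ n)"] \<psi>[of "(s, y)"] by simp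
  then show ?thesis using assms by (simp add: chart3_def chart1_def recip_def field_simps)
qed

lemma \<phi>_on: "a = Some x \<Longrightarrow> \<phi> (x, y) = \<eta>"
  using trans_on[of y] \<phi>[of "(x, y)"] by (simp add: chart1_def)

lemma \<psi>_on: "a = None \<Longrightarrow> \<psi> (0, y) = \<eta>"
  using trans_on[of y] \<psi>[of "(0, y)"] by (simp add: chart3_def)

text \<open>Over \<open>a\<close> the fibre is contracted, so \<phi> does not depend on
  \<open>y\<close>. Over any other point \<phi> is entire and injective in \<open>y\<close>, and
  invariance of the exceptional section provides the pole at infinity.\<close>

lemma \<phi>_affine: "\<phi> (x, y) = \<phi> (x, 0) + (\<phi> (x, 1) - \<phi> (x, 0)) * y"
proof (cases "a = Some x")
  case True
  then show ?thesis using \<phi>_on by simp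
next
  case False
  show ?thesis
  proof (rule injective_entire_affine[of "\<lambda>y. \<phi> (x, y)"])
    show "(\<lambda>y. \<phi> (x, y)) holomorphic_on UNIV"
      by (rule regular_fun_holomorphic[OF regular_\<phi>]) (auto intro!: holomorphic_intros)
    show "inj (\<lambda>y. \<phi> (x, y))"
    proof (rule injI)
      fix y y' assume "\<phi> (x, y) = \<phi> (x, y')"
      then have "trans (Some x, Some y) = trans (Some x, Some y')"
        using \<phi>[of "(x, y)"] \<phi>[of "(x, y')"] by (simp add: chart1_def)
      then show "y = y'" using trans_inj[of "Some x" "Some y" "Some y'"] False by auto
    qed
    have "trans (Some x, None) = (Some x, None)" using trans_off[of "Some x" None] False by (simp add: prod_eq_iff)
    then have tr0: "trans (chart2 (x, 0)) = chart2 (x, 0)" by (simp add: chart2_def)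
    have "regular_at (hirz (Suc n)) (trans \<circ> chart2) (x, 0)"
      using False by (intro trans_regular) (auto simp: hirz_charts chart2_def)
    moreover have "(trans \<circ> chart2) (x, 0) \<in> range chart2" using tr0 by simp
    ultimately have "regular_at {chart2} (trans \<circ> chart2) (x, 0)"
      by (intro regular_at_chart[OF atlas']) (auto simp: hirz_charts)
    then obtain p1 p2 q where q: "ev2 q (x, 0) \<noteq> 0"
      "\<And>w. ev2 q w \<noteq> 0 \<Longrightarrow> trans (chart2 w) = chart2 (quot2 p1 p2 q w)"
      unfolding regular_at_quot2 by auto
    \<comment> \<open>The transformed coordinate \<open>1 / y\<close> along the fibre. It vanishes
      at 0 because the point of the exceptional section is fixed, and for small nonzero
      \<open>w\<close> it is the inverse of \<phi> at \<open>1 / w\<close>.\<close>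
    define h where "h w = snd (quot2 p1 p2 q (x, w))" for w
    have "isCont (\<lambda>w. snd (quot2 p1 p2 q (x, w))) 0"
      by (intro continuous_intros isCont_o2[of _ "\<lambda>w. (x, w)" "quot2 p1 p2 q"] quot2_continuous q(1))
    then have "(h \<longlongrightarrow> h 0) (at 0)" by (simp add: isCont_def h_def[abs_def])
    moreover have "chart2 (quot2 p1 p2 q (x, 0)) = chart2 (x, 0)"
      using q tr0 by metis
    then have "h 0 = 0" using chart_injective(2)[OF bu] by (auto simp: h_def dest: injD)
    moreover have "eventually (\<lambda>w. ev2 q (x, w) \<noteq> 0 \<and> w \<noteq> 0) (at 0)"
      by (intro eventually_conj eventually_neq_at_within
          tendsto_imp_eventually_ne[of "\<lambda>w. ev2 q (x, w)" "ev2 q (x, 0)"] tendsto_intros q(1))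
    then have "eventually (\<lambda>w. h w = inverse (\<phi> (x, inverse w))) (at 0)"
    proof eventually_elim
      case (elim w)
      have "chart2 (x, w) = chart1 (x, inverse w)"
        using elim by (simp add: chart1_def chart2_def recip_def divide_inverse)
      then have "chart2 (quot2 p1 p2 q (x, w)) = chart1 (x, \<phi> (x, inverse w))"
        using q(2)[of "(x, w)"] \<phi>[of "(x, inverse w)"] elim by simp
      then have "recip (h w) = Some (\<phi> (x, inverse w))"
        by (simp add: chart1_def chart2_def h_def case_prod_beta)
      then show ?case by (auto simp: divide_inverse)
    qed
    ultimately show "((\<lambda>w. inverse (\<phi> (x, inverse w))) \<longlongrightarrow> 0) (at 0)"
      using Lim_transform_eventually by fastforce
  qed
qed

definition \<alpha> :: "complex \<Rightarrow> complex" where "\<alpha> x = \<phi> (x, 1) - \<phi> (x, 0)"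
definition \<beta> :: "complex \<Rightarrow> complex" where "\<beta> x = \<phi> (x, 0)"

lemma \<phi>_eq: "\<phi> (x, y) = \<alpha> x * y + \<beta> x"
  using \<phi>_affine[of x y] by (simp add: \<alpha>_def \<beta>_def)

lemma \<psi>_eq: "s \<noteq> 0 \<Longrightarrow> \<psi> (s, y) = s * \<alpha> (1 / s) * y + s ^ Suc n * \<beta> (1 / s)"
  by (simp add: \<psi>_\<phi> \<phi>_eq distrib_left mult_ac)

lemma isCont_\<psi>: "isCont (\<lambda>s. \<psi> (s, y)) s0"
  by (rule isCont_o2[of _ "\<lambda>s. (s, y)" \<psi>]) (auto intro!: continuous_intros regular_fun_isCont regular_\<psi>)

text \<open>The function \<alpha> is entire and of at most linear growth, since
  \<open>s * \<alpha> (1 / s)\<close> extends continuously to \<open>s = 0\<close>; hence it is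
  affine. Injectivity excludes zeros off \<open>a\<close> and contraction forces one at
  \<open>a\<close>; for the infinite base point this zero is the vanishing of the leading
  coefficient.\<close>

lemma \<alpha>_form: "\<exists>C. C \<noteq> 0 \<and> (\<forall>x. \<alpha> x = C * linform a (1, x))"
proof -
  have hol: "\<alpha> holomorphic_on UNIV"
    unfolding \<alpha>_def by (intro holomorphic_intros regular_fun_holomorphic[OF regular_\<phi>]) (auto intro!: holomorphic_intros)
  define d where "d s = \<psi> (s, 1) - \<psi> (s, 0)" for s
  have d: "isCont d 0" unfolding d_def by (intro continuous_intros isCont_\<psi>)
  have ds: "d s = s * \<alpha> (1 / s)" if "s \<noteq> 0" for s
    using that by (simp add: d_def \<psi>_eq)
  have "\<exists>A B. \<forall>x. A \<le> norm x \<longrightarrow> norm (\<alpha> x) \<le> B * norm x ^ 1"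
    by (rule at_infinity_bounded[OF d]) (simp add: ds)
  then obtain A B where AB: "\<And>x. A \<le> norm x \<Longrightarrow> norm (\<alpha> x) \<le> B * norm x ^ 1" by blast
  define c0 c1 where "c0 = (deriv ^^ 0) \<alpha> 0 / fact 0" and "c1 = (deriv ^^ 1) \<alpha> 0 / fact 1"
  have c: "\<alpha> x = c0 + c1 * x" for x
  proof -
    have "\<alpha> x = (\<Sum>k\<le>1. (deriv ^^ k) \<alpha> 0 / fact k * x ^ k)"
      by (rule Liouville_polynomial[OF hol AB])
    also have "{..1::nat} = {0, 1}" by auto
    finally show ?thesis unfolding c0_def c1_def by simp
  qed
  have nz: "\<alpha> x \<noteq> 0" if "a \<noteq> Some x" for x
  proof
    assume "\<alpha> x = 0"
    then have "trans (Some x, Some 1) = trans (Some x, Some 0)"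
      using \<phi>[of "(x, 1)"] \<phi>[of "(x, 0)"] by (simp add: chart1_def \<phi>_eq)
    then show False using trans_inj[of "Some x" "Some 1" "Some 0"] that by auto
  qed
  show ?thesis
  proof (cases a)
    case None
    have "((\<lambda>s. c0 * s + c1) \<longlongrightarrow> c0 * 0 + c1) (at 0)" by (intro tendsto_intros)
    moreover have "eventually (\<lambda>s. c0 * s + c1 = d s) (at 0)"
      using eventually_neq_at_within[of 0 0 UNIV] by eventually_elim (simp add: ds c field_simps)
    ultimately have "(d \<longlongrightarrow> c1) (at 0)" using Lim_transform_eventually by fastforce
    moreover have "d 0 = 0" using \<psi>_on[OF None] by (simp add: d_def)
    then have "(d \<longlongrightarrow> 0) (at 0)" using d by (simp add: isCont_def)
    ultimately have "c1 = 0" using tendsto_unique[OF trivial_limit_at] by blast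
    then have "\<alpha> x = c0 * linform a (1, x)" for x using c by (simp add: None)
    moreover have "a \<noteq> Some 0" by (simp add: None)
    then have "c0 \<noteq> 0" using nz[of 0] c[of 0] by auto
    ultimately show ?thesis by blast
  next
    case (Some x0)
    have "\<alpha> x0 = 0" using \<phi>_on[OF Some] by (simp add: \<alpha>_def)
    then have "c0 = - c1 * x0" using c[of x0] by (simp add: eq_neg_iff_add_eq_0)
    then have "\<alpha> x = c1 * linform a (1, x)" for x
      unfolding c by (simp add: Some algebra_simps)
    moreover have "a \<noteq> Some (x0 + 1)" by (simp add: Some)
    then have "c1 \<noteq> 0" using nz[of "x0 + 1"] calculation[of "x0 + 1"] by auto
    ultimately show ?thesis by blast
  qed
qed

text \<open>The gluing now gives growth of order \<open>n + 1\<close>, so \<beta> is a polynomial of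
  at most this degree, and \<open>g\<close> is its homogenization.\<close>

lemma \<beta>_form: "\<exists>g. binary_form (Suc n) g \<and> (\<forall>x. \<beta> x = g (1, x)) \<and> (\<forall>s. \<psi> (s, 0) = g (s, 1))"
proof -
  have hol: "\<beta> holomorphic_on UNIV"
    unfolding \<beta>_def by (intro holomorphic_intros regular_fun_holomorphic[OF regular_\<phi>]) (auto intro!: holomorphic_intros)
  have "\<exists>A B. \<forall>x. A \<le> norm x \<longrightarrow> norm (\<beta> x) \<le> B * norm x ^ Suc n"
    by (rule at_infinity_bounded[OF isCont_\<psi>[where y = 0]]) (simp add: \<psi>_eq)
  then obtain A B where AB: "\<And>x. A \<le> norm x \<Longrightarrow> norm (\<beta> x) \<le> B * norm x ^ Suc n" by blast
  define c where "c k = (deriv ^^ k) \<beta> 0 / fact k" for k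
  have c: "\<beta> x = (\<Sum>k\<le>Suc n. c k * x ^ k)" for x
    unfolding c_def by (rule Liouville_polynomial[OF hol AB])
  define g where "g w = (\<Sum>k\<le>Suc n. c k * fst w ^ (Suc n - k) * snd w ^ k)" for w :: "complex \<times> complex"
  have "poly_fun2 g" unfolding g_def by (intro poly_fun2_intros)
  moreover have "g (r * s, r * t) = r ^ Suc n * g (s, t)" for r s t
    unfolding g_def sum_distrib_left
  proof (intro sum.cong refl)
    fix k assume "k \<in> {..Suc n}"
    then have "r ^ Suc n = r ^ (Suc n - k) * r ^ k" by (simp flip: power_add)
    then show "c k * fst (r * s, r * t) ^ (Suc n - k) * snd (r * s, r * t) ^ k =
      r ^ Suc n * (c k * fst (s, t) ^ (Suc n - k) * snd (s, t) ^ k)"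
      by (simp add: power_mult_distrib)
  qed
  ultimately have g: "binary_form (Suc n) g" by (simp add: binary_form_def)
  have g1: "\<beta> x = g (1, x)" for x by (simp add: c g_def)
  have gs: "\<psi> (s, 0) = g (s, 1)" if "s \<noteq> 0" for s
    using binary_form_scale[OF g, of s 1 "1 / s"] that by (simp add: \<psi>_eq g1)
  have "poly_fun2 g" using g by (simp add: binary_form_def)
  then obtain p where p: "g = ev2 p" unfolding poly_fun2_def by blast
  have "((\<lambda>s. g (s, 1)) \<longlongrightarrow> g (0, 1)) (at 0)" unfolding p by (intro tendsto_intros)
  moreover have "((\<lambda>s. \<psi> (s, 0)) \<longlongrightarrow> \<psi> (0, 0)) (at 0)" using isCont_\<psi> by (simp add: isCont_def)
  moreover have "eventually (\<lambda>s. \<psi> (s, 0) = g (s, 1)) (at 0)"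
    using eventually_neq_at_within[of 0 0 UNIV] by eventually_elim (simp add: gs)
  ultimately have "\<psi> (0, 0) = g (0, 1)"
    using Lim_transform_eventually tendsto_unique[OF trivial_limit_at] by fast
  then have "\<psi> (s, 0) = g (s, 1)" for s using gs by (cases "s = 0") auto
  with g g1 show ?thesis by blast
qed

lemma trans_form:
  "\<exists>C g. C \<noteq> 0 \<and> binary_form (Suc n) g \<and> g (hom_coord a) = \<eta> \<and>
     (\<forall>x y. x \<noteq> a \<longrightarrow> trans (x, Some y) = (x, Some (C * linform a (hom_coord x) * y + g (hom_coord x))))"
proof -
  obtain C where C: "C \<noteq> 0" "\<And>x. \<alpha> x = C * linform a (1, x)" using \<alpha>_form by blast
  obtain g where g: "binary_form (Suc n) g" "\<And>x. \<beta> x = g (1, x)" "\<And>s. \<psi> (s, 0) = g (s, 1)"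
    using \<beta>_form by blast
  have "g (hom_coord a) = \<eta>"
  proof (cases a)
    case None
    then show ?thesis using g(3)[of 0] \<psi>_on by simp
  next
    case (Some x)
    have "g (1, x) = \<eta>" using g(2)[of x] \<phi>_on[OF Some, of 0] by (simp add: \<beta>_def)
    then show ?thesis by (simp add: Some)
  qed
  moreover have "trans (x, Some y) = (x, Some (C * linform a (hom_coord x) * y + g (hom_coord x)))" for x y
  proof (cases x)
    case (Some x')
    then show ?thesis using \<phi>[of "(x', y)"] by (simp add: chart1_def \<phi>_eq C g)
  next
    case None
    \<comment> \<open>In the chart at infinity the formula is known for nonzero \<open>s\<close> and
      passes to \<open>s = 0\<close> by continuity.\<close>
    obtain p where p: "linform a = ev2 p" using poly_fun2_linform unfolding poly_fun2_def by blast
    have "((\<lambda>s. C * linform a (s, 1) * y + \<psi> (s, 0)) \<longlongrightarrow> C * linform a (0, 1) * y + \<psi> (0, 0)) (at 0)"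
      unfolding p using isCont_\<psi>[of 0 0] by (intro tendsto_intros) (auto simp: isCont_def)
    moreover have "((\<lambda>s. \<psi> (s, y)) \<longlongrightarrow> \<psi> (0, y)) (at 0)" using isCont_\<psi> by (simp add: isCont_def)
    moreover have "eventually (\<lambda>s. \<psi> (s, y) = C * linform a (s, 1) * y + \<psi> (s, 0)) (at 0)"
      using eventually_neq_at_within[of 0 0 UNIV]
    proof eventually_elim
      case (elim s)
      have "linform a (s * 1, s * (1 / s)) = s ^ 1 * linform a (1, 1 / s)"
        by (rule binary_form_scale[OF binary_form_linform])
      then show ?case using elim by (simp add: \<psi>_eq C)
    qed
    ultimately have "\<psi> (0, y) = C * linform a (0, 1) * y + \<psi> (0, 0)"
      using Lim_transform_eventually tendsto_unique[OF trivial_limit_at] by fast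
    then show ?thesis using \<psi>[of "(0, y)"] None by (simp add: chart3_def g(3))
  qed
  ultimately show ?thesis using C(1) g(1) by blast
qed

end

section \<open>Elementary transformations of both types as affine maps of the fibres\<close>

lemma closed_in_exc_section: "closed_in (hirz n) exc_section"
proof -
  have eq: "chart1 -` exc_section = {}" "chart2 -` exc_section = {w. snd w = 0}"
    "chart3 n -` exc_section = {}" "chart4 n -` exc_section = {w. snd w = 0}"
    by (auto simp: chart1_def chart2_def chart3_def chart4_def exc_section_def split: if_splits)
  have "closed {w :: complex \<times> complex. snd w = 0}"
    by (intro closed_Collect_eq continuous_intros)
  then show ?thesis unfolding closed_in_def hirz_charts by (simp add: eq)
qed

text \<open>In a chart around the blown up point the two curves are coordinate lines. A common point
  of their proper transforms would determine a nonzero direction on which both coordinates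
  vanish.\<close>

lemma proper_transforms_disjoint:
  assumes bu: "blow_up (hirz n) (a, None) Y \<pi>" and z: "z \<in> points Y" "\<pi> z = (a, None)"
    and 1: "z \<in> proper_transform Y \<pi> (a, None) exc_section"
    and 2: "z \<in> proper_transform Y \<pi> (a, None) (fibre a)"
  shows False
proof -
  have main: False if e: "e \<in> hirz n" "e z0 = (a, None)"
    "\<And>w. e w \<in> exc_section \<Longrightarrow> snd w = snd z0" "\<And>w. e w \<in> fibre a \<Longrightarrow> fst w = fst z0" for e z0
  proof (rule blow_up_direction[OF bu e(1,2) z])
    fix \<delta>1 \<delta>2 :: complex
    assume \<delta>: "(\<delta>1, \<delta>2) \<noteq> (0, 0)" and dir:
      "\<And>C \<alpha> \<beta>. z \<in> proper_transform Y \<pi> (a, None) C \<Longrightarrow>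
         (\<And>w. e w \<in> C \<Longrightarrow> \<alpha> * (fst w - fst z0) + \<beta> * (snd w - snd z0) = 0) \<Longrightarrow> \<alpha> * \<delta>1 + \<beta> * \<delta>2 = 0"
    have "0 * \<delta>1 + 1 * \<delta>2 = 0" by (rule dir[OF 1]) (use e(3) in simp)
    moreover have "1 * \<delta>1 + 0 * \<delta>2 = 0" by (rule dir[OF 2]) (use e(4) in simp)
    ultimately show False using \<delta> by simp
  qed
  show False
  proof (cases a)
    case None
    show False
      by (rule main[of "chart4 n" "(0, 0)"])
        (auto simp: hirz_charts chart4_def exc_section_def fibre_def None split: if_splits)
  next
    case (Some x)
    show False
      by (rule main[of chart2 "(x, 0)"])
        (auto simp: hirz_charts chart2_def exc_section_def fibre_def Some)
  qed
qed

lemma blow_up_fst_image: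
  assumes "blow_up (hirz n) p Y fst" "q \<noteq> p" shows "\<exists>c. points Y `` {q} = {c}"
proof -
  have b: "bij_betw fst {y \<in> points Y. fst y \<noteq> p} (UNIV - {p})"
    using blow_upD(3)[OF assms(1)] by simp
  then have "q \<in> fst ` {y \<in> points Y. fst y \<noteq> p}" using assms(2) by (simp add: bij_betw_def)
  then obtain c where c: "(q, c) \<in> points Y" by auto
  have uniq: "c' = c" if "(q, c') \<in> points Y" for c'
  proof -
    have "(q, c') = (q, c)"
      by (rule inj_onD[OF bij_betw_imp_inj_on[OF b]]) (use c that assms(2) in simp_all)
    then show ?thesis by simp
  qed
  have "d \<in> points Y `` {q} \<longleftrightarrow> d \<in> {c}" for d
    unfolding Image_singleton_iff singleton_iff using c uniq by metis
  then show ?thesis by (intro exI[of _ c] set_eqI)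
qed

text \<open>With the centre off the curve, the proper transform is the whole preimage, so nothing is
  lost by applying the correspondence directly.\<close>

lemma curve_image_eq:
  assumes "blow_up (hirz n) p Y fst" "closed_in (hirz n) C" "p \<notin> C"
  shows "curve_image Y p C = points Y `` C"
proof (rule set_eqI)
  fix x
  show "x \<in> curve_image Y p C \<longleftrightarrow> x \<in> points Y `` C"
    unfolding curve_image_def proper_transform_eq[OF assms] Image_iff image_iff Bex_def mem_Collect_eq
    by (metis fst_conv snd_conv prod.collapse)
qed

text \<open>Both types of transformation feed \<open>link\<close> from here, so the height
  \<open>c\<close> of the centre is left open. Points of the fibre other than the centre lie on its
  proper transform and are therefore contracted.\<close>

lemma elementary_data:
  assumes "elementary n (a, c) n' Y"
  shows "\<exists>c'. blow_up (hirz n) (a, c) Y fst \<and> blow_up (hirz n') (a, c') Y snd \<and>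
    (\<forall>z\<in>points Y. fst (fst z) = fst (snd z)) \<and>
    {z \<in> points Y. snd z = (a, c')} = proper_transform Y fst (a, c) (fibre a) \<and>
    snd ` proper_transform Y fst (a, c) exc_section = exc_section \<and>
    (\<forall>z\<in>points Y. fst (fst z) = a \<longrightarrow> fst z \<noteq> (a, c) \<longrightarrow> snd z = (a, c')) \<and>
    (\<forall>z\<in>points Y. fst (fst z) \<noteq> a \<longrightarrow> snd (fst z) = None \<longleftrightarrow> snd (snd z) = None)"
proof -
  define p where p: "p = (a, c)"
  obtain p' where bu: "blow_up (hirz n) p Y fst" and bu': "blow_up (hirz n') p' Y snd"
    and fib: "{z \<in> points Y. snd z = p'} = proper_transform Y fst p (fibre (fst p))"
    and ex: "snd ` proper_transform Y fst p exc_section = exc_section"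
    and base0: "\<forall>z\<in>points Y. fst (fst z) = fst (snd z)"
    using assms[folded p, unfolded elementary_def] by (elim exE conjE) (rule that, assumption+)
  have base: "fst (fst z) = fst (snd z)" if "z \<in> points Y" for z using bspec[OF base0 that] .
  have fib: "{z \<in> points Y. snd z = p'} = proper_transform Y fst p (fibre a)"
    using fib by (simp add: p)
  have contr: "snd z = p'" if "z \<in> points Y" "fst (fst z) = a" "fst z \<noteq> p" for z
  proof -
    have "z \<in> {y \<in> points Y. fst y \<in> fibre a - {p}}" using that by (simp add: fibre_def)
    then have "z \<in> proper_transform Y fst p (fibre a)" by (rule subsetD[OF subset_proper_transform])
    then have "z \<in> {z \<in> points Y. snd z = p'}" unfolding fib .
    then show ?thesis by simp
  qed
  \<comment> \<open>Some point of the fibre is not the centre; its image is the contraction point,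
    which therefore lies over \<open>a\<close>.\<close>
  obtain y where y: "(a, y) \<noteq> p" unfolding p by (cases c) auto
  obtain q where "points Y `` {(a, y)} = {q}" using blow_up_fst_image[OF bu y] ..
  then have q: "((a, y), q) \<in> points Y" by (metis Image_singleton_iff singletonI)
  then have "fst p' = a" using contr[OF q] base[OF q] y by simp
  then obtain c' where c': "p' = (a, c')" by (metis prod.collapse)
  have exc: "snd (fst z) = None \<longleftrightarrow> snd (snd z) = None" if z: "z \<in> points Y" "fst (fst z) \<noteq> a" for z
  proof
    assume "snd (fst z) = None"
    then have "z \<in> {y \<in> points Y. fst y \<in> exc_section - {p}}" using z by (simp add: p exc_section_def prod_eq_iff)
    then have "z \<in> proper_transform Y fst p exc_section" by (rule subsetD[OF subset_proper_transform])
    from imageI[OF this, of snd] have "snd z \<in> exc_section" unfolding ex .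
    then show "snd (snd z) = None" by (simp add: exc_section_def)
  next
    assume "snd (snd z) = None"
    then have "snd z \<in> snd ` proper_transform Y fst p exc_section" unfolding ex by (simp add: exc_section_def)
    then obtain z' where z': "z' \<in> proper_transform Y fst p exc_section" "snd z = snd z'" by (elim imageE)
    then have "z' \<in> {y \<in> points Y. fst y \<in> exc_section}"
      by (intro subsetD[OF proper_transform_subset[OF bu closed_in_exc_section]])
    then have z'': "z' \<in> points Y" "snd (fst z') = None" by (simp_all add: exc_section_def)
    have "z = z'"
    proof (rule inj_onD[OF bij_betw_imp_inj_on[OF blow_upD(3)[OF bu']]])
      show "z \<in> {y \<in> points Y. snd y \<noteq> p'}" "z' \<in> {y \<in> points Y. snd y \<noteq> p'}"
        using z z'' z'(2) base[OF z(1)] c' by (simp_all add: prod_eq_iff)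
    qed (rule z'(2))
    then show "snd (fst z) = None" using z'' by simp
  qed
  show ?thesis
    unfolding p[symmetric]
  proof (intro exI[of _ c'] conjI ballI impI)
    show "snd z = (a, c')" if "z \<in> points Y" "fst (fst z) = a" "fst z \<noteq> p" for z
      using contr[OF that] c' by simp
  qed (use bu bu' fib ex base exc c' in simp_all)
qed

lemma elementary_first_type:
  assumes "elementary n (a, None) (Suc n) Y"
  shows "\<exists>C g. C \<noteq> 0 \<and> binary_form (Suc n) g \<and>
    (\<forall>x y. points Y `` {(x, Some y)} = {(x, Some (C * linform a (hom_coord x) * y + g (hom_coord x)))})"
proof -
  obtain c' where bu: "blow_up (hirz n) (a, None) Y fst" and bu': "blow_up (hirz (Suc n)) (a, c') Y snd"
    and base0: "\<forall>z\<in>points Y. fst (fst z) = fst (snd z)"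
    and fib: "{z \<in> points Y. snd z = (a, c')} = proper_transform Y fst (a, None) (fibre a)"
    and ex: "snd ` proper_transform Y fst (a, None) exc_section = exc_section"
    and contr0: "\<forall>z\<in>points Y. fst (fst z) = a \<longrightarrow> fst z \<noteq> (a, None) \<longrightarrow> snd z = (a, c')"
    and exc0: "\<forall>z\<in>points Y. fst (fst z) \<noteq> a \<longrightarrow> snd (fst z) = None \<longleftrightarrow> snd (snd z) = None"
    using elementary_data[OF assms] by (elim exE conjE) (rule that, assumption+)
  have base: "fst (fst z) = fst (snd z)" if "z \<in> points Y" for z using bspec[OF base0 that] .
  have contr: "snd z = (a, c')" if "z \<in> points Y" "fst (fst z) = a" "fst z \<noteq> (a, None)" for z
    using bspec[OF contr0 that(1)] that(2,3) by simp
  have exc: "snd (fst z) = None \<longleftrightarrow> snd (snd z) = None" if "z \<in> points Y" "fst (fst z) \<noteq> a" for z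
    using bspec[OF exc0 that(1)] that(2) by simp
  \<comment> \<open>A contraction point on the exceptional section would come from the proper
    transform of that section and, being the contraction point, also from that of the fibre; these
    are disjoint over the centre.\<close>
  have "c' \<noteq> None"
  proof
    assume c': "c' = None"
    then have "(a, c') \<in> snd ` proper_transform Y fst (a, None) exc_section"
      unfolding ex by (simp add: exc_section_def)
    then obtain z where z: "(a, c') = snd z" "z \<in> proper_transform Y fst (a, None) exc_section"
      by (rule imageE)
    note z = z(2) z(1)[symmetric]
    have "z \<in> {y \<in> points Y. fst y \<in> exc_section}"
      by (rule subsetD[OF proper_transform_subset[OF bu closed_in_exc_section] z(1)])
    then have z': "z \<in> points Y" "snd (fst z) = None" by (simp_all add: exc_section_def)
    then have "fst z = (a, None)" using base[OF z'(1)] z(2) by (simp add: prod_eq_iff)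
    moreover have "z \<in> proper_transform Y fst (a, None) (fibre a)"
      unfolding fib[symmetric] using z(2) z'(1) by simp
    ultimately show False by (rule proper_transforms_disjoint[OF bu z'(1) _ z(1)])
  qed
  then obtain \<eta> where \<eta>: "c' = Some \<eta>" by blast
  interpret link n a \<eta> Y fst snd
  proof unfold_locales
    show "blow_up (hirz n) (a, None) Y fst" by (rule bu)
    show "blow_up (hirz (Suc n)) (a, Some \<eta>) Y snd" using bu' \<eta> by simp
    show "fst (fst z) = fst (snd z)" if "z \<in> points Y" for z using base that by simp
    show "snd z = (a, Some \<eta>)" if "z \<in> points Y" "fst (fst z) = a" "fst z \<noteq> (a, None)" for z
      using contr[OF that] \<eta> by simp
    show "(snd (fst z) = None) = (snd (snd z) = None)" if "z \<in> points Y" "fst (fst z) \<noteq> a" for z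
      using exc[OF that] .
  qed
  obtain C g where Cg: "C \<noteq> 0" "binary_form (Suc n) g" "g (hom_coord a) = \<eta>"
    "\<And>x y. x \<noteq> a \<Longrightarrow> trans (x, Some y) = (x, Some (C * linform a (hom_coord x) * y + g (hom_coord x)))"
    using trans_form by blast
  have "points Y `` {(x, Some y)} = {(x, Some (C * linform a (hom_coord x) * y + g (hom_coord x)))}" for x y
  proof -
    have ne: "(x, Some y) \<noteq> (a, None)" by simp
    obtain c where c: "points Y `` {(x, Some y)} = {c}" using blow_up_fst_image[OF bu ne] ..
    have "lift (x, Some y) = ((x, Some y), trans (x, Some y))"
      using lift(2)[OF ne] by (simp add: trans_def prod_eq_iff)
    then have "trans (x, Some y) \<in> points Y `` {(x, Some y)}" using lift(1)[OF ne] by simp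
    then have "points Y `` {(x, Some y)} = {trans (x, Some y)}" using c by simp
    moreover have "trans (x, Some y) = (x, Some (C * linform a (hom_coord x) * y + g (hom_coord x)))"
      using Cg(3,4) trans_on by (cases "x = a") simp_all
    ultimately show ?thesis by simp
  qed
  with Cg show ?thesis by blast
qed

text \<open>\<open>link\<close> applies with the two projections exchanged, so the affine map
  appears solved for \<open>y\<close>. The point \<open>(a, None)\<close> is not the centre, hence
  it is contracted, and its image stays in the exceptional section: this locates the contraction
  point.\<close>

lemma elementary_second_type:
  assumes "elementary (Suc n) (a, Some y0) n Y"
  shows "\<exists>C g. C \<noteq> 0 \<and> binary_form (Suc n) g \<and> g (hom_coord a) = y0 \<and>
    (\<forall>x u. x \<noteq> a \<longrightarrow> points Y `` {(x, Some u)} = {(x, Some ((u - g (hom_coord x)) / (C * linform a (hom_coord x))))}) \<and>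
    (\<forall>c. c \<noteq> Some y0 \<longrightarrow> points Y `` {(a, c)} = {(a, None)})"
proof -
  obtain c' where bu_fst: "blow_up (hirz (Suc n)) (a, Some y0) Y fst" and bu_snd: "blow_up (hirz n) (a, c') Y snd"
    and base0: "\<forall>z\<in>points Y. fst (fst z) = fst (snd z)"
    and ex: "snd ` proper_transform Y fst (a, Some y0) exc_section = exc_section"
    and contr0: "\<forall>z\<in>points Y. fst (fst z) = a \<longrightarrow> fst z \<noteq> (a, Some y0) \<longrightarrow> snd z = (a, c')"
    and exc0: "\<forall>z\<in>points Y. fst (fst z) \<noteq> a \<longrightarrow> snd (fst z) = None \<longleftrightarrow> snd (snd z) = None"
    using elementary_data[OF assms] by (elim exE conjE) (rule that, assumption+)
  have base: "fst (fst z) = fst (snd z)" if "z \<in> points Y" for z using bspec[OF base0 that] .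
  have contr: "snd z = (a, c')" if "z \<in> points Y" "fst (fst z) = a" "fst z \<noteq> (a, Some y0)" for z
    using bspec[OF contr0 that(1)] that(2,3) by simp
  have exc: "snd (fst z) = None \<longleftrightarrow> snd (snd z) = None" if "z \<in> points Y" "fst (fst z) \<noteq> a" for z
    using bspec[OF exc0 that(1)] that(2) by simp
  have ne: "(a, None) \<noteq> (a, Some y0)" by simp
  obtain q where "points Y `` {(a, None)} = {q}" using blow_up_fst_image[OF bu_fst ne] ..
  then have q: "((a, None), q) \<in> points Y" by (metis Image_singleton_iff singletonI)
  have "((a, None), q) \<in> {y \<in> points Y. fst y \<in> exc_section - {(a, Some y0)}}"
    using q by (simp add: exc_section_def)
  then have "((a, None), q) \<in> proper_transform Y fst (a, Some y0) exc_section"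
    by (rule subsetD[OF subset_proper_transform])
  from imageI[OF this, of snd] have "q \<in> exc_section" unfolding ex by simp
  then have c': "c' = None" using contr[OF q] by (simp add: exc_section_def)
  have contr': "fst z = (a, Some y0)" if "z \<in> points Y" "fst (snd z) = a" "snd z \<noteq> (a, None)" for z
    using contr[OF that(1)] base[OF that(1)] that c' by metis
  interpret link n a y0 Y snd fst
  proof unfold_locales
    show "blow_up (hirz n) (a, None) Y snd" using bu_snd c' by simp
    show "blow_up (hirz (Suc n)) (a, Some y0) Y fst" by (rule bu_fst)
    show "fst (snd z) = fst (fst z)" if "z \<in> points Y" for z using base that by simp
    show "fst z = (a, Some y0)" if "z \<in> points Y" "fst (snd z) = a" "snd z \<noteq> (a, None)" for z
      using contr'[OF that] .
    show "(snd (snd z) = None) = (snd (fst z) = None)" if "z \<in> points Y" "fst (snd z) \<noteq> a" for z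
      using exc that base by simp
  qed
  obtain C g where Cg: "C \<noteq> 0" "binary_form (Suc n) g" "g (hom_coord a) = y0"
    "\<And>x y. x \<noteq> a \<Longrightarrow> trans (x, Some y) = (x, Some (C * linform a (hom_coord x) * y + g (hom_coord x)))"
    using trans_form by blast
  have 1: "points Y `` {(x, Some u)} = {(x, Some ((u - g (hom_coord x)) / (C * linform a (hom_coord x))))}"
    if x: "x \<noteq> a" for x u
  proof -
    have ne: "(x, Some u) \<noteq> (a, Some y0)" using x by simp
    obtain c where c: "points Y `` {(x, Some u)} = {c}" using blow_up_fst_image[OF bu_fst ne] ..
    define y where "y = (u - g (hom_coord x)) / (C * linform a (hom_coord x))"
    have ne': "(x, Some y) \<noteq> (a, None)" by simp
    have l0: "linform a (hom_coord x) \<noteq> 0" using x by simp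
    have "trans (x, Some y) = (x, Some u)"
      using Cg(1) l0 unfolding Cg(4)[OF x] by (simp add: y_def)
    then have "lift (x, Some y) = ((x, Some u), (x, Some y))"
      using lift(2)[OF ne'] by (simp add: trans_def prod_eq_iff)
    then have "(x, Some y) \<in> points Y `` {(x, Some u)}" using lift(1)[OF ne'] by simp
    then show ?thesis using c y_def by simp
  qed
  have 2: "points Y `` {(a, c)} = {(a, None)}" if "c \<noteq> Some y0" for c
  proof -
    have ne: "(a, c) \<noteq> (a, Some y0)" using that by simp
    obtain d where d: "points Y `` {(a, c)} = {d}" using blow_up_fst_image[OF bu_fst ne] ..
    then have "((a, c), d) \<in> points Y" by (metis Image_singleton_iff singletonI)
    then have "d = (a, None)" using bspec[OF contr0, of "((a, c), d)"] that c' by simp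
    then show ?thesis using d by simp
  qed
  show ?thesis using Cg 1 2 by blast
qed

section \<open>The image of a pencil\<close>

lemma binary_form_prod_linform:
  "binary_form n W \<Longrightarrow> binary_form (n + length as) (\<lambda>w. W w * (\<Prod>a\<leftarrow>as. linform a w))"
proof (induction as arbitrary: n W)
  case (Cons a as)
  have "binary_form (Suc n) (\<lambda>w. W w * linform a w)"
    using binary_form_mult[OF Cons(2) binary_form_linform] by simp
  from Cons(1)[OF this] show ?case by (simp add: mult.assoc)
qed simp

text \<open>An affine map moves all members by the same form and multiplies their differences by its
  linear coefficient, so \<open>W\<close> alone records the base points. The last clause follows the
  points of the section \<open>G\<close>, among them the common point of the lines.\<close>

lemma first_seq_pencil:
  assumes "first_seq as n C n' C' R" "C = pencil b 0 K G W" "binary_form n G" "binary_form n W" "finite K" "K \<noteq> {}"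
  shows "n' = n + length as \<and> (\<exists>G' c. c \<noteq> 0 \<and> binary_form n' G' \<and>
     C' = pencil b 0 K G' (\<lambda>w. c * (W w * (\<Prod>a\<leftarrow>as. linform a w))) \<and>
     (\<forall>x. R `` {(x, Some (G (hom_coord x)))} = {(x, Some (G' (hom_coord x)))}))"
  using assms
proof (induction arbitrary: G W rule: first_seq.induct)
  case (1 n C)
  have "C = pencil b 0 K G (\<lambda>w. 1 * (W w * (\<Prod>a\<leftarrow>[]. linform a w)))" using 1(1) by simp
  then show ?case using 1(2)
    by (intro conjI exI[of _ G] exI[of _ "1::complex"] allI) simp_all
next
  case (2 n a Y as C n' C' R)
  obtain D g where D: "D \<noteq> 0" "binary_form (Suc n) g"
    "\<And>x y. points Y `` {(x, Some y)} = {(x, Some (D * linform a (hom_coord x) * y + g (hom_coord x)))}"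
    using elementary_first_type[OF 2(1)] by blast
  define G1 where "G1 w = D * (linform a w * G w) + g w" for w
  define W1 where "W1 w = D * (linform a w * W w)" for w
  have G1: "binary_form (Suc n) G1" and W1: "binary_form (Suc n) W1"
    unfolding G1_def W1_def
    using binary_form_add[OF binary_form_cmult[OF binary_form_mult[OF binary_form_linform 2(5)], unfolded plus_1_eq_Suc] D(2)]
      binary_form_cmult[OF binary_form_mult[OF binary_form_linform 2(6)], unfolded plus_1_eq_Suc] by this+
  have bu: "blow_up (hirz n) (a, None) Y fst"
    using elementary_data[OF 2(1)] by (elim exE conjE)
  have cl: "closed_in (hirz n) C" unfolding 2(4) using 2(5-8) by (intro closed_in_pencil) auto
  have "(a, None) \<notin> C" unfolding 2(4) by (simp add: mem_pencil)
  then have ci: "curve_image Y (a, None) C = points Y `` C" by (rule curve_image_eq[OF bu cl])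
  also have "\<dots> = pencil b 0 K G1 W1"
  proof (rule set_eqI)
    fix z :: hpt
    obtain x c where z: "z = (x, c)" by fastforce
    have G1W1: "D * linform a (hom_coord x') * (G (hom_coord x') + \<kappa> * W (hom_coord x')) + g (hom_coord x') =
        G1 (hom_coord x') + \<kappa> * W1 (hom_coord x')" for x' \<kappa>
      by (simp add: G1_def W1_def algebra_simps)
    show "z \<in> points Y `` C \<longleftrightarrow> z \<in> pencil b 0 K G1 W1"
    proof
      assume "z \<in> points Y `` C"
      then obtain q where q: "q \<in> C" "(q, z) \<in> points Y" by (elim ImageE)
      obtain x' d where xd: "q = (x', d)" by (cases q)
      obtain y where y: "d = Some y" using q(1) unfolding 2(4) xd by (cases d) (simp_all add: mem_pencil)
      obtain \<kappa> where \<kappa>: "\<kappa> \<in> K" "y = G (hom_coord x') + \<kappa> * W (hom_coord x')"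
        using q(1) unfolding 2(4) xd y mem_pencil by auto
      have "z \<in> points Y `` {(x', Some y)}" using q(2) unfolding xd y by (simp only: Image_singleton_iff)
      then have "z = (x', Some (G1 (hom_coord x') + \<kappa> * W1 (hom_coord x')))"
        unfolding D(3) \<kappa>(2) G1W1 by (rule singletonD)
      then show "z \<in> pencil b 0 K G1 W1" using \<kappa>(1) by (auto simp: mem_pencil)
    next
      assume "z \<in> pencil b 0 K G1 W1"
      then obtain \<kappa> where \<kappa>: "\<kappa> \<in> K" "c = Some (G1 (hom_coord x) + \<kappa> * W1 (hom_coord x))"
        unfolding z by (cases c) (auto simp: mem_pencil)
      have "(x, Some (G (hom_coord x) + \<kappa> * W (hom_coord x))) \<in> C"
        unfolding 2(4) mem_pencil using \<kappa>(1) by auto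
      moreover have "z \<in> points Y `` {(x, Some (G (hom_coord x) + \<kappa> * W (hom_coord x)))}"
        unfolding D(3) G1W1 z \<kappa>(2) by (rule singletonI)
      ultimately show "z \<in> points Y `` C" unfolding Image_singleton_iff by (intro ImageI)
    qed
  qed
  finally have ci: "curve_image Y (a, None) C = pencil b 0 K G1 W1" .
  from 2(3)[OF ci G1 W1 2(7,8)] obtain G' c where IH: "n' = Suc n + length as" "c \<noteq> 0" "binary_form n' G'"
    "C' = pencil b 0 K G' (\<lambda>w. c * (W1 w * (\<Prod>a\<leftarrow>as. linform a w)))"
    "\<And>x. R `` {(x, Some (G1 (hom_coord x)))} = {(x, Some (G' (hom_coord x)))}" by blast
  have "(\<lambda>w. c * (W1 w * (\<Prod>a\<leftarrow>as. linform a w))) = (\<lambda>w. (c * D) * (W w * (\<Prod>a\<leftarrow>a # as. linform a w)))"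
    by (simp add: W1_def mult_ac)
  then have "C' = pencil b 0 K G' (\<lambda>w. (c * D) * (W w * (\<Prod>a\<leftarrow>a # as. linform a w)))" using IH(4) by simp
  moreover have "(points Y O R) `` {(x, Some (G (hom_coord x)))} = {(x, Some (G' (hom_coord x)))}" for x
    unfolding relcomp_Image D(3) using IH(5)[of x] by (simp add: G1_def mult.assoc)
  moreover have "n' = n + length (a # as)" "c * D \<noteq> 0" using IH(1,2) D(1) by simp_all
  ultimately show ?case using IH(3) by blast
qed

text \<open>With \<open>l = linform b\<close>, the map \<open>y = (u - g) / (D l)\<close> raises the
  exponent of \<open>l\<close> by one, replaces \<open>G\<close> by \<open>(G - g l^k) / D\<close>
  and changes \<open>W\<close> only by a constant. For positive exponent, the nonvanishing at
  \<open>b\<close> keeps the curve off the finite points of the fibre over \<open>b\<close>.\<close>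

lemma second_seq_pencil:
  assumes "second_seq as n C n' C' R" "set as \<subseteq> {b}" "C = pencil b k K G W"
    "binary_form (n + k) G" "binary_form (n + k) W" "finite K" "K \<noteq> {}"
    "k > 0 \<Longrightarrow> \<forall>\<kappa>\<in>K. G (hom_coord b) + \<kappa> * W (hom_coord b) \<noteq> 0"
  shows "n = n' + length as \<and> (\<exists>G' c. c \<noteq> 0 \<and> binary_form (n + k) G' \<and>
     C' = pencil b (k + length as) K G' (\<lambda>w. c * W w) \<and>
     (k + length as > 0 \<longrightarrow> (\<forall>\<kappa>\<in>K. G' (hom_coord b) + \<kappa> * (c * W (hom_coord b)) \<noteq> 0)) \<and>
     (\<forall>x y. x \<noteq> b \<longrightarrow> y * linform b (hom_coord x) ^ k = G (hom_coord x) \<longrightarrow>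
        (\<exists>y'. R `` {(x, Some y)} = {(x, Some y')} \<and> y' * linform b (hom_coord x) ^ (k + length as) = G' (hom_coord x))))"
  using assms
proof (induction arbitrary: G W k rule: second_seq.induct)
  case (1 n C)
  have "C = pencil b k K G (\<lambda>w. 1 * W w)" using 1(2) by simp
  moreover have "\<exists>y'. Id `` {(x, Some y)} = {(x, Some y')} \<and> y' * linform b (hom_coord x) ^ (k + length []) = G (hom_coord x)"
    if "y * linform b (hom_coord x) ^ k = G (hom_coord x)" for x y
    using that by (intro exI[of _ y]) simp
  ultimately show ?case using 1(3,7)
    by (intro conjI, simp, intro exI[of _ G], intro exI[of _ "1::complex"]) simp
next
  case (2 n a y0 Y C as n' C' R)
  have ab: "a = b" using 2(5) by simp
  note pen = 2(6)
  obtain D g where D: "D \<noteq> 0" "binary_form (Suc n) g" "g (hom_coord b) = y0"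
    and im: "\<And>x u. x \<noteq> b \<Longrightarrow> points Y `` {(x, Some u)} = {(x, Some ((u - g (hom_coord x)) / (D * linform b (hom_coord x))))}"
      "\<And>c. c \<noteq> Some y0 \<Longrightarrow> points Y `` {(b, c)} = {(b, None)}"
    using elementary_second_type[OF 2(1)] unfolding ab by blast
  define G1 where "G1 w = (1 / D) * (G w - g w * linform b w ^ k)" for w
  define W1 where "W1 w = (1 / D) * W w" for w
  have "binary_form (Suc n + 1 * k) (\<lambda>w. g w * linform b w ^ k)"
    by (intro binary_form_mult D(2) binary_form_power binary_form_linform)
  then have G1: "binary_form (n + Suc k) G1" and W1: "binary_form (n + Suc k) W1"
    unfolding G1_def W1_def
    using binary_form_cmult[OF binary_form_diff[OF 2(7)], of "\<lambda>w. g w * linform b w ^ k" "1 / D"]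
      binary_form_cmult[OF 2(8), of "1 / D"] by simp_all
  have bu: "blow_up (hirz (Suc n)) (b, Some y0) Y fst"
    using elementary_data[OF 2(1)[unfolded ab]] by (elim exE conjE)
  have cl: "closed_in (hirz (Suc n)) C" unfolding pen using 2(7-10) by (intro closed_in_pencil) auto
  have notin: "(b, Some y0) \<notin> C" using 2(2) ab by simp
  \<comment> \<open>For \<open>k = 0\<close> this says that the centre, whose height is the value of
    \<open>g\<close> at \<open>b\<close>, is off the curve. For positive \<open>k\<close> the
    correction term vanishes at \<open>b\<close> and the inherited nonvanishing applies.\<close>
  have nz: "G1 (hom_coord b) + \<kappa> * W1 (hom_coord b) \<noteq> 0" if "\<kappa> \<in> K" for \<kappa>
  proof -
    have "G (hom_coord b) - g (hom_coord b) * linform b (hom_coord b) ^ k + \<kappa> * W (hom_coord b) \<noteq> 0"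
    proof (cases "k = 0")
      case True
      then show ?thesis using notin that unfolding pen mem_pencil by (auto simp: D(3) algebra_simps)
    next
      case False
      then show ?thesis using 2(11) that by (auto simp: power_0_left)
    qed
    moreover have "G1 (hom_coord b) + \<kappa> * W1 (hom_coord b) =
      (G (hom_coord b) - g (hom_coord b) * linform b (hom_coord b) ^ k + \<kappa> * W (hom_coord b)) / D"
      by (simp add: G1_def W1_def add_divide_distrib diff_divide_distrib)
    ultimately show ?thesis using D(1) by simp
  qed
  have step: "(u - g (hom_coord x)) / (D * linform b (hom_coord x)) * linform b (hom_coord x) ^ Suc k =
     (u * linform b (hom_coord x) ^ k - g (hom_coord x) * linform b (hom_coord x) ^ k) / D" if "x \<noteq> b" for x u
  proof -
    have "linform b (hom_coord x) \<noteq> 0" using that by simp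
    then show ?thesis using D(1) by (simp add: field_simps)
  qed
  have ci: "curve_image Y (b, Some y0) C = points Y `` C" by (rule curve_image_eq[OF bu cl notin])
  also have "\<dots> = pencil b (Suc k) K G1 W1"
  proof (rule set_eqI, rule iffI)
    fix z assume "z \<in> points Y `` C"
    then obtain q where q: "q \<in> C" "(q, z) \<in> points Y" by (elim ImageE)
    obtain x d where xd: "q = (x, d)" by (cases q)
    have d: "(x, d) \<in> C" "z \<in> points Y `` {(x, d)}" unfolding Image_singleton_iff by (rule q[unfolded xd])+
    show "z \<in> pencil b (Suc k) K G1 W1"
    proof (cases "x = b")
      case True
      then have "d \<noteq> Some y0" using d(1) notin by metis
      then have "z = (b, None)" using im(2) d(2) True by (metis singletonD)
      then show ?thesis by (simp add: mem_pencil)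
    next
      case False
      then obtain u where u: "d = Some u" using d(1) unfolding pen by (cases d) (simp_all add: mem_pencil)
      then obtain \<kappa> where \<kappa>: "\<kappa> \<in> K" "u * linform b (hom_coord x) ^ k = G (hom_coord x) + \<kappa> * W (hom_coord x)"
        using d(1) unfolding pen u mem_pencil by blast
      have z: "z = (x, Some ((u - g (hom_coord x)) / (D * linform b (hom_coord x))))"
        using d(2) unfolding u im(1)[OF False] by (rule singletonD)
      show ?thesis unfolding z mem_pencil step[OF False] \<kappa>(2)
        using \<kappa>(1) by (intro bexI[of _ \<kappa>]) (simp_all add: G1_def W1_def add_divide_distrib diff_divide_distrib)
    qed
  next
    fix z assume z: "z \<in> pencil b (Suc k) K G1 W1"
    obtain x d where zx: "z = (x, d)" by fastforce
    show "z \<in> points Y `` C"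
    proof (cases "x = b")
      case True
      have dN: "d = None"
      proof (cases d)
        case (Some y)
        have "\<exists>\<kappa>\<in>K. 0 = G1 (hom_coord b) + \<kappa> * W1 (hom_coord b)"
          using z unfolding zx True Some mem_pencil linform_hom_coord_self by simp
        then show ?thesis using nz by metis
      qed
      \<comment> \<open>For \<open>(b, None)\<close> to be an image point the old curve must meet
        the fibre over \<open>b\<close>: it does so in a finite point if \<open>k = 0\<close>, and
        in the exceptional section otherwise.\<close>
      obtain \<kappa> where \<kappa>: "\<kappa> \<in> K" using 2(10) by blast
      have "\<exists>c. (b, c) \<in> C"
      proof (cases "k = 0")
        case True
        then have "(b, Some (G (hom_coord b) + \<kappa> * W (hom_coord b))) \<in> C" unfolding pen mem_pencil using \<kappa> by auto
        then show ?thesis by blast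
      next
        case False
        then have "(b, None) \<in> C" unfolding pen mem_pencil by simp
        then show ?thesis by blast
      qed
      then obtain c where c: "(b, c) \<in> C" by blast
      then have "c \<noteq> Some y0" using notin by metis
      note this[THEN im(2)]
      then have "z \<in> points Y `` {(b, c)}" unfolding zx dN True by simp
      then show ?thesis using c unfolding Image_singleton_iff by (intro ImageI)
    next
      case False
      then obtain y where y: "d = Some y" using z unfolding zx by (cases d) (simp_all add: mem_pencil)
      obtain \<kappa> where \<kappa>: "\<kappa> \<in> K" "y * linform b (hom_coord x) ^ Suc k = G1 (hom_coord x) + \<kappa> * W1 (hom_coord x)"
        using z unfolding zx y mem_pencil by blast
      define u where "u = D * linform b (hom_coord x) * y + g (hom_coord x)"
      have l0: "linform b (hom_coord x) \<noteq> 0" using False by simp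
      then have yu: "y = (u - g (hom_coord x)) / (D * linform b (hom_coord x))" using D(1) by (simp add: u_def)
      have "(u * linform b (hom_coord x) ^ k - g (hom_coord x) * linform b (hom_coord x) ^ k) / D =
          (G (hom_coord x) - g (hom_coord x) * linform b (hom_coord x) ^ k + \<kappa> * W (hom_coord x)) / D"
        using \<kappa>(2) step[OF False, of u] unfolding yu by (simp add: G1_def W1_def add_divide_distrib diff_divide_distrib)
      then have "u * linform b (hom_coord x) ^ k = G (hom_coord x) + \<kappa> * W (hom_coord x)"
        using D(1) by (simp add: algebra_simps)
      then have "(x, Some u) \<in> C" unfolding pen mem_pencil using \<kappa>(1) by blast
      moreover have "z \<in> points Y `` {(x, Some u)}" unfolding im(1)[OF False] zx y using yu by simp
      ultimately show ?thesis unfolding Image_singleton_iff by (intro ImageI)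
    qed
  qed
  finally have ci: "curve_image Y (a, Some y0) C = pencil b (Suc k) K G1 W1" unfolding ab .
  have "set as \<subseteq> {b}" using 2(5) by simp
  from 2(4)[OF this ci G1 W1 2(9,10)] nz obtain G' c where IH: "n = n' + length as" "c \<noteq> 0" "binary_form (n + Suc k) G'"
    "C' = pencil b (Suc k + length as) K G' (\<lambda>w. c * W1 w)"
    "\<forall>\<kappa>\<in>K. G' (hom_coord b) + \<kappa> * (c * W1 (hom_coord b)) \<noteq> 0"
    "\<And>x y. x \<noteq> b \<Longrightarrow> y * linform b (hom_coord x) ^ Suc k = G1 (hom_coord x) \<Longrightarrow>
        \<exists>y'. R `` {(x, Some y)} = {(x, Some y')} \<and> y' * linform b (hom_coord x) ^ (Suc k + length as) = G' (hom_coord x)"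
    by auto
  have cW: "c * W1 w = (c / D) * W w" for w by (simp add: W1_def)
  have f6: "\<exists>y'. (points Y O R) `` {(x, Some u)} = {(x, Some y')} \<and> y' * linform b (hom_coord x) ^ (k + length (a # as)) = G' (hom_coord x)"
    if x: "x \<noteq> b" and u: "u * linform b (hom_coord x) ^ k = G (hom_coord x)" for x u
  proof -
    have "(u - g (hom_coord x)) / (D * linform b (hom_coord x)) * linform b (hom_coord x) ^ Suc k = G1 (hom_coord x)"
      unfolding step[OF x] u by (simp add: G1_def)
    from IH(6)[OF x this] show ?thesis unfolding relcomp_Image im(1)[OF x] by simp
  qed
  have f1: "Suc n = n' + length (a # as)" "c / D \<noteq> 0" using IH(1,2) D(1) by simp_all
  have f2: "binary_form (Suc n + k) G'" "C' = pencil b (k + length (a # as)) K G' (\<lambda>w. c / D * W w)"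
    using IH(3,4) unfolding cW by simp_all
  have f3: "\<forall>\<kappa>\<in>K. G' (hom_coord b) + \<kappa> * (c / D * W (hom_coord b)) \<noteq> 0" using IH(5) unfolding cW .
  show ?case
    by (intro conjI f1(1), rule exI[of _ G'], rule exI[of _ "c / D"], intro conjI allI impI f1 f2 f3)
      (rule f6; assumption)
qed

section \<open>The resulting plane curve\<close>

lemma vector_3_nth [simp]:
  "(vector [x, y, z] :: complex ^ 3) $ 1 = x" "(vector [x, y, z] :: complex ^ 3) $ 2 = y"
  "(vector [x, y, z] :: complex ^ 3) $ 3 = z"
  by simp_all

lemma vec3_eq_iff: "(v :: complex ^ 3) = w \<longleftrightarrow> v $ 1 = w $ 1 \<and> v $ 2 = w $ 2 \<and> v $ 3 = w $ 3"
  by (auto simp: vec_eq_iff forall_3)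

lemma proj_eq_iff: "proj v = proj w \<longleftrightarrow> (\<exists>c. c \<noteq> 0 \<and> v = c *s w)"
proof
  assume "proj v = proj w"
  moreover have "v \<in> proj v" unfolding proj_def by (auto intro: exI[of _ 1])
  ultimately show "\<exists>c. c \<noteq> 0 \<and> v = c *s w" by (auto simp: proj_def)
next
  assume "\<exists>c. c \<noteq> 0 \<and> v = c *s w"
  then obtain c where c: "c \<noteq> 0" "v = c *s w" by blast
  show "proj v = proj w"
  proof (rule set_eqI, rule iffI)
    fix x assume "x \<in> proj v"
    then show "x \<in> proj w" unfolding proj_def c using c(1) by (auto simp: vector_smult_assoc)
  next
    fix x assume "x \<in> proj w"
    then obtain d where "d \<noteq> 0" "x = d *s w" by (auto simp: proj_def)
    then have "x = (d / c) *s v" "d / c \<noteq> 0" using c by (auto simp: vector_smult_assoc)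
    then show "x \<in> proj v" unfolding proj_def by blast
  qed
qed

lemma proj_scale: "c \<noteq> 0 \<Longrightarrow> proj (c *s v) = proj v"
  using proj_eq_iff by blast

lemma plane_vec_Some: "plane_vec (a, Some y) = vector [fst (hom_coord a), snd (hom_coord a), y]"
  by (cases a) auto

lemma plane_vec_None: "plane_vec (a, None) = vector [0, 0, 1]"
  by (cases a) auto

lemma hom_coord_nonzero: "fst (hom_coord a) \<noteq> 0 \<or> snd (hom_coord a) \<noteq> 0"
  by (cases a) auto

lemma hom_coordE:
  assumes "s \<noteq> 0 \<or> t \<noteq> (0::complex)"
  obtains c a where "c \<noteq> 0" "s = c * fst (hom_coord a)" "t = c * snd (hom_coord a)"
proof (cases "s = 0")
  case True
  then show ?thesis using assms that[of t None] by auto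
next
  case False
  then show ?thesis using that[of s "Some (t / s)"] by auto
qed

text \<open>A second basis vector \<open>dir a\<close>, so that \<open>hom_coord a + u dir a\<close> parametrizes the base near \<open>a\<close>.\<close>

fun dir :: "P1 \<Rightarrow> complex \<times> complex" where
  "dir (Some x) = (0, 1)" | "dir None = (1, 0)"

definition near :: "P1 \<Rightarrow> complex \<Rightarrow> complex \<times> complex" where
  "near a u = (fst (hom_coord a) + u * fst (dir a), snd (hom_coord a) + u * snd (dir a))"

lemma near_0 [simp]: "near a 0 = hom_coord a" by (simp add: near_def)

lemma linform_near: "linform a (near a u) = u"
  by (cases a) (auto simp: near_def)

lemma poly_fun2_line: "poly_fun2 f \<Longrightarrow> \<exists>P. \<forall>u. f (c + u * d, c' + u * d') = poly P u"
  unfolding poly_fun2_def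
proof (elim exE)
  fix p assume f: "\<forall>w. f w = ev2 p w"
  have "\<exists>P. \<forall>u. ev2 p (c + u * d, c' + u * d') = poly P u"
  proof (induction p)
    case (pCons a p)
    then obtain P where P: "\<And>u. ev2 p (c + u * d, c' + u * d') = poly P u" by blast
    have "ev2 (pCons a p) (c + u * d, c' + u * d') = poly (pcompose a [:c, d:] + [:c', d':] * P) u" for u
      unfolding ev2_pCons P by (simp add: poly_pcompose algebra_simps)
    then show ?case by blast
  qed (auto intro: exI[of _ 0])
  then show ?thesis using f by simp
qed

lemma poly_fun2_near: "poly_fun2 f \<Longrightarrow> \<exists>P. \<forall>u. f (near a u) = poly P u"
  unfolding near_def by (rule poly_fun2_line)

lemma poly_fun3_of_poly_fun2: "poly_fun2 f \<Longrightarrow> poly_fun3 (\<lambda>w. f (w $ 1, w $ 2))"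
proof -
  assume "poly_fun2 f"
  then obtain p where "\<And>w. f w = ev2 p w" unfolding poly_fun2_def by blast
  then show ?thesis unfolding poly_fun3_def by (intro exI[of _ "[:p:]"]) (simp add: ev3_pCons)
qed

lemma binary_form_0: "binary_form (Suc n) f \<Longrightarrow> f (0, 0) = 0"
  using binary_form_scale[of "Suc n" f 0 0 0] by simp

text \<open>On a line that misses the origin the polynomial has no zero, hence is constant. Such
  lines connect all points off the origin, and the origin follows by continuity.\<close>

lemma poly_fun2_nonvanishing_const:
  assumes "poly_fun2 h" "\<And>s t. (s, t) \<noteq> (0, 0) \<Longrightarrow> h (s, t) \<noteq> 0"
  shows "h w = h (1, 0)"
proof -
  have line: "h (c + u * d, c' + u * d') = h (c, c')" if nz: "\<And>u. (c + u * d, c' + u * d') \<noteq> (0, 0)" for c d c' d' u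
  proof -
    obtain P where P: "\<And>u. h (c + u * d, c' + u * d') = poly P u" using poly_fun2_line[OF assms(1)] by blast
    have "poly P u \<noteq> 0" for u using assms(2)[OF nz[of u]] P by simp
    then have "constant (poly P)" using fundamental_theorem_of_algebra by blast
    then have "poly P u = poly P 0" by (simp add: constant_def)
    then show ?thesis using P[of u] P[of 0] by simp
  qed
  have 1: "h (1, t) = h (1, 0)" for t using line[of 1 0 0 1 t] by simp
  have 2: "h (s, t) = h (1, 0)" if "t \<noteq> 0" for s t
  proof -
    have "h (1 + (s - 1) * 1, t + (s - 1) * 0) = h (1, t)" by (rule line) (use that in auto)
    then show ?thesis using 1[of t] by simp
  qed
  have 3: "h (s, 0) = h (1, 0)" for s
  proof (cases "s = 0")
    case False
    have "h (s + 1 * 0, 0 + 1 * 1) = h (s, 0)" by (rule line) (use False in auto)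
    then show ?thesis using 2[of 1 s] by simp
  next
    case True
    obtain p where p: "h = ev2 p" using assms(1) unfolding poly_fun2_def by blast
    have "((\<lambda>t. h (0, t)) \<longlongrightarrow> h (0, 0)) (at 0)" unfolding p by (intro tendsto_intros)
    moreover have "eventually (\<lambda>t. h (0, t) = h (1, 0)) (at 0)"
      using eventually_neq_at_within[of 0 0 UNIV] by eventually_elim (simp add: 2)
    ultimately have "((\<lambda>t::complex. h (1, 0)) \<longlongrightarrow> h (0, 0)) (at 0)" by (rule Lim_transform_eventually)
    then show ?thesis using True by (auto dest: LIM_const_eq)
  qed
  show ?thesis using 2 3 by (cases w; cases "snd w = 0") auto
qed

text \<open>\<open>A\<close> is the projective frame of the final blow-down and \<open>Ai\<close>
  its inverse. \<open>nonvanishing\<close> controls the curve along the fibre over \<open>b\<close>,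
  and \<open>Wb\<close> separates its branches there.\<close>

locale plane_pencil =
  fixes b :: P1 and N :: nat and K :: "complex set" and G W :: "complex \<times> complex \<Rightarrow> complex"
    and A Ai :: "complex ^ 3 ^ 3" and m :: nat
  assumes N: "N \<ge> 1" and K: "finite K" "card K = m" "m \<ge> 2"
    and G: "binary_form (Suc N) G" and W: "binary_form (Suc N) W"
    and nonvanishing: "\<And>\<kappa>. \<kappa> \<in> K \<Longrightarrow> G (hom_coord b) + \<kappa> * W (hom_coord b) \<noteq> 0"
    and Wb: "W (hom_coord b) \<noteq> 0"
    and A: "A ** Ai = mat 1" "Ai ** A = mat 1"
begin

definition factor :: "complex \<Rightarrow> complex ^ 3 \<Rightarrow> complex" where
  "factor \<kappa> w = w $ 3 * linform b (w $ 1, w $ 2) ^ N - (G (w $ 1, w $ 2) + \<kappa> * W (w $ 1, w $ 2))"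

lemma Ai_A [simp]: "Ai *v (A *v w) = w" "A *v (Ai *v w) = w"
  by (simp_all add: matrix_vector_mul_assoc A)

lemma A_scale: "A *v (c *s w) = c *s (A *v w)" "Ai *v (c *s w) = c *s (Ai *v w)"
  by (simp_all add: vec.scale)

lemma poly_GW: "poly_fun2 G" "poly_fun2 W" using G W by (simp_all add: binary_form_def)

lemma factor_scale: "factor \<kappa> (c *s w) = c ^ Suc N * factor \<kappa> w"
  using binary_form_scale[OF G] binary_form_scale[OF W] binary_form_scale[OF binary_form_linform]
  by (simp add: factor_def power_mult_distrib algebra_simps)

lemma poly_fun3_factor: "poly_fun3 (factor \<kappa>)"
proof -
  have "poly_fun3 (\<lambda>w. w $ 3 * linform b (w $ 1, w $ 2) ^ N - (G (w $ 1, w $ 2) + \<kappa> * W (w $ 1, w $ 2)))"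
    by (intro poly_fun3_diff poly_fun3_add poly_fun3_mult poly_fun3_power poly_fun3_const poly_fun3_nth
        poly_fun3_of_poly_fun2 poly_GW poly_fun2_linform)
  moreover have "factor \<kappa> = (\<lambda>w. w $ 3 * linform b (w $ 1, w $ 2) ^ N - (G (w $ 1, w $ 2) + \<kappa> * W (w $ 1, w $ 2)))"
    by (simp add: factor_def fun_eq_iff)
  ultimately show ?thesis by simp
qed

lemma equation_exists: "\<exists>F. \<forall>v. ev3 F v = (\<Prod>\<kappa>\<in>K. factor \<kappa> (Ai *v v))"
proof -
  have "poly_fun3 (\<lambda>w. \<Prod>\<kappa>\<in>K. factor \<kappa> w)" by (rule poly_fun3_prod) (rule poly_fun3_factor)
  then obtain P where P: "\<And>w. (\<Prod>\<kappa>\<in>K. factor \<kappa> w) = ev3 P w" unfolding poly_fun3_def by blast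
  show ?thesis using poly_fun3_ev3_linear[of P Ai] unfolding poly_fun3_def P by metis
qed

definition F where "F = (SOME F. \<forall>v. ev3 F v = (\<Prod>\<kappa>\<in>K. factor \<kappa> (Ai *v v)))"

lemma F: "ev3 F v = (\<Prod>\<kappa>\<in>K. factor \<kappa> (Ai *v v))"
  using someI_ex[OF equation_exists] unfolding F_def by blast

lemma F_A: "ev3 F (A *v w) = (\<Prod>\<kappa>\<in>K. factor \<kappa> w)"
  by (simp add: F)

lemma F_scale: "ev3 F (c *s v) = c ^ (m * Suc N) * ev3 F v"
  unfolding F A_scale factor_scale prod.distrib
  by (simp add: K(2) power_mult[symmetric] mult.commute del: power_Suc mult_Suc)

lemma linform_eq_0E:
  assumes "s \<noteq> 0 \<or> t \<noteq> 0" "linform b (s, t) = 0"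
  obtains c where "c \<noteq> 0" "s = c * fst (hom_coord b)" "t = c * snd (hom_coord b)"
proof -
  obtain c a where ca: "c \<noteq> 0" "s = c * fst (hom_coord a)" "t = c * snd (hom_coord a)"
    using hom_coordE[OF assms(1)] by metis
  have "linform b (s, t) = c * linform b (hom_coord a)"
    using binary_form_scale[OF binary_form_linform, of b c "fst (hom_coord a)" "snd (hom_coord a)"] ca by simp
  then have "a = b" using assms(2) ca(1) by simp
  then show ?thesis using ca that by blast
qed

text \<open>Over \<open>b\<close> the term with the power of \<open>linform b\<close> drops out
  because \<open>N\<close> is positive, and a nonzero multiple of the value in
  \<open>nonvanishing\<close> remains. So the curve meets this line only in (0 : 0 : 1).\<close>

lemma factor_nonzero:
  assumes "s \<noteq> 0 \<or> t \<noteq> 0" "linform b (s, t) = 0" "\<kappa> \<in> K"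
  shows "factor \<kappa> (vector [s, t, z]) \<noteq> 0"
proof -
  obtain c where c: "c \<noteq> 0" "s = c * fst (hom_coord b)" "t = c * snd (hom_coord b)"
    using linform_eq_0E[OF assms(1,2)] by metis
  have "G (s, t) + \<kappa> * W (s, t) = c ^ Suc N * (G (hom_coord b) + \<kappa> * W (hom_coord b))"
    using binary_form_scale[OF G, of c "fst (hom_coord b)" "snd (hom_coord b)"]
      binary_form_scale[OF W, of c "fst (hom_coord b)" "snd (hom_coord b)"] c
    by (simp add: algebra_simps)
  then show ?thesis using nonvanishing[OF assms(3)] c(1) N assms(2)
    by (simp add: factor_def power_0_left)
qed

text \<open>Over \<open>b\<close> no factor vanishes, and elsewhere each factor has a single zero in
  \<open>z\<close>. Hence no line through (0 : 0 : 1) lies in the curve.\<close>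

lemma F_nonzero_on_line:
  assumes "s \<noteq> 0 \<or> t \<noteq> 0"
  shows "\<exists>z. ev3 F (A *v vector [s, t, z]) \<noteq> 0"
proof (cases "linform b (s, t) = 0")
  case True
  then show ?thesis using factor_nonzero[OF assms True] K(1) by (auto simp: F_A)
next
  case False
  have "infinite (UNIV - (\<lambda>\<kappa>. (G (s, t) + \<kappa> * W (s, t)) / linform b (s, t) ^ N) ` K)"
    using K(1) infinite_UNIV_char_0 by (metis Diff_infinite_finite finite_imageI)
  then obtain z where "z \<notin> (\<lambda>\<kappa>. (G (s, t) + \<kappa> * W (s, t)) / linform b (s, t) ^ N) ` K"
    by (metis DiffE finite.emptyI ex_in_conv)
  then have "factor \<kappa> (vector [s, t, z]) \<noteq> 0" if "\<kappa> \<in> K" for \<kappa>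
    using that False by (auto simp: factor_def field_simps)
  then show ?thesis using K(1) by (auto simp: F_A)
qed

text \<open>Any two factors differ on this line by a nonzero constant, so just one of them vanishes
  at \<open>z0\<close>, and its slope in \<open>z\<close> is a nonzero power of
  \<open>linform b\<close>.\<close>

lemma transversal_to_fibre:
  assumes "linform b (s, t) \<noteq> 0" "W (s, t) \<noteq> 0" "ev3 F (A *v vector [s, t, z0]) = 0"
    and der: "((\<lambda>z. ev3 F (A *v vector [s, t, z])) has_field_derivative D) (at z0)"
  shows "D \<noteq> 0"
proof -
  obtain \<kappa>0 where \<kappa>0: "\<kappa>0 \<in> K" "factor \<kappa>0 (vector [s, t, z0]) = 0"
    using assms(3) K(1) by (auto simp: F_A)
  define h where "h z = (\<Prod>\<kappa>\<in>K - {\<kappa>0}. factor \<kappa> (vector [s, t, z]))" for z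
  have "factor \<kappa> (vector [s, t, z0]) \<noteq> 0" if "\<kappa> \<in> K - {\<kappa>0}" for \<kappa>
  proof -
    have "factor \<kappa> (vector [s, t, z0]) - factor \<kappa>0 (vector [s, t, z0]) = (\<kappa>0 - \<kappa>) * W (s, t)"
      by (simp add: factor_def algebra_simps)
    then show ?thesis using \<kappa>0(2) that assms(2) by auto
  qed
  then have h0: "h z0 \<noteq> 0" using K(1) by (simp add: h_def)
  have "h field_differentiable (at z0)"
    unfolding h_def[abs_def] factor_def
    by (intro holomorphic_on_imp_differentiable_at[of _ UNIV] holomorphic_intros) auto
  then obtain h' where h': "(h has_field_derivative h') (at z0)" unfolding field_differentiable_def by blast
  have eq: "(\<lambda>z. ev3 F (A *v vector [s, t, z])) = (\<lambda>z. factor \<kappa>0 (vector [s, t, z]) * h z)"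
    unfolding F_A h_def using prod.remove[OF K(1) \<kappa>0(1)] by fastforce
  have "((\<lambda>z. factor \<kappa>0 (vector [s, t, z])) has_field_derivative linform b (s, t) ^ N) (at z0)"
    unfolding factor_def vector_3_nth by (auto intro!: derivative_eq_intros)
  from DERIV_mult[OF this h'] have "((\<lambda>z. ev3 F (A *v vector [s, t, z])) has_field_derivative linform b (s, t) ^ N * h z0) (at z0)"
    unfolding eq by (simp add: \<kappa>0(2) mult.commute)
  then have "D = linform b (s, t) ^ N * h z0" using der DERIV_unique by blast
  then show ?thesis using assms(1) h0 by simp
qed

lemma F_neq_0: "F \<noteq> 0"
  using F_nonzero_on_line[of 1 0] by auto

lemma is_form_F: "is_form (m * Suc N) F"
  by (rule is_form_if_homogeneous[OF F_neq_0 F_scale])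

text \<open>The whole exceptional section collapses to (0 : 0 : 1), which is on the curve as the
  image of the point over \<open>b\<close>. All other vectors are multiples of some
  \<open>plane_vec (a, Some y)\<close>, and the factors are homogeneous.\<close>

lemma curve_F:
  "(\<lambda>z. proj (A *v plane_vec z)) ` pencil b N K G W = {proj v |v. v \<noteq> 0 \<and> ev3 F v = 0}"
proof (rule set_eqI, rule iffI)
  fix x assume "x \<in> (\<lambda>z. proj (A *v plane_vec z)) ` pencil b N K G W"
  then obtain a c where z: "(a, c) \<in> pencil b N K G W" "x = proj (A *v plane_vec (a, c))" by auto
  have "\<exists>\<kappa>\<in>K. factor \<kappa> (plane_vec (a, c)) = 0"
  proof (cases c)
    case None
    obtain \<kappa> where "\<kappa> \<in> K" using K by fastforce
    moreover have "linform b (0, 0) = 0" by (cases b) auto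
    ultimately show ?thesis
      using N binary_form_0[OF G] binary_form_0[OF W]
      by (intro bexI[of _ \<kappa>]) (simp_all add: None plane_vec_None factor_def power_0_left)
  next
    case (Some y)
    then show ?thesis using z(1) unfolding Some mem_pencil plane_vec_Some by (auto simp: factor_def)
  qed
  then have "ev3 F (A *v plane_vec (a, c)) = 0" using K(1) by (auto simp: F_A)
  moreover have "plane_vec (a, c) \<noteq> 0"
    using hom_coord_nonzero[of a] by (cases c) (auto simp: plane_vec_None plane_vec_Some vec3_eq_iff)
  then have "A *v plane_vec (a, c) \<noteq> 0" by (metis Ai_A(1) matrix_vector_mult_0_right)
  ultimately show "x \<in> {proj v |v. v \<noteq> 0 \<and> ev3 F v = 0}" using z(2) by blast
next
  fix x assume "x \<in> {proj v |v. v \<noteq> 0 \<and> ev3 F v = 0}"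
  then obtain v where v: "x = proj v" "v \<noteq> 0" "ev3 F v = 0" by blast
  define w where "w = Ai *v v"
  have w: "v = A *v w" "w \<noteq> 0" using v(2) by (auto simp: w_def) (metis Ai_A(2) matrix_vector_mult_0_right)
  show "x \<in> (\<lambda>z. proj (A *v plane_vec z)) ` pencil b N K G W"
  proof (cases "w $ 1 = 0 \<and> w $ 2 = 0")
    case True
    then have "w = w $ 3 *s plane_vec (b, None)" by (simp add: vec3_eq_iff plane_vec_None)
    moreover from this have "w $ 3 \<noteq> 0" using w(2) by (metis vector_smult_lzero)
    ultimately have "x = proj (A *v plane_vec (b, None))"
      unfolding v(1) w(1) by (metis A_scale(1) proj_scale)
    moreover have "(b, None) \<in> pencil b N K G W" using N by (simp add: mem_pencil)
    ultimately show ?thesis by blast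
  next
    case False
    then obtain c a where c: "c \<noteq> 0" "w $ 1 = c * fst (hom_coord a)" "w $ 2 = c * snd (hom_coord a)"
      using hom_coordE[of "w $ 1" "w $ 2"] by metis
    define y where "y = w $ 3 / c"
    have wc: "w = c *s plane_vec (a, Some y)" using c by (simp add: vec3_eq_iff plane_vec_Some y_def)
    obtain \<kappa> where "\<kappa> \<in> K" "factor \<kappa> w = 0" using v(3) K(1) unfolding w(1) F_A by auto
    then have "\<kappa> \<in> K" "factor \<kappa> (plane_vec (a, Some y)) = 0" unfolding wc factor_scale using c(1) by auto
    then have "(a, Some y) \<in> pencil b N K G W" unfolding mem_pencil plane_vec_Some factor_def by auto
    moreover have "x = proj (A *v plane_vec (a, Some y))" unfolding v(1) w(1) wc A_scale proj_scale[OF c(1)] ..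
    ultimately show ?thesis by blast
  qed
qed

end

text \<open>The derivative of the form vanishes in every direction of the cone, the radial one
  included, where homogeneity and the vanishing of \<open>f\<close> at the origin enter. So
  singularity can be tested along a line given in another chart.\<close>

lemma mult0_gt_1_homogeneous:
  fixes M :: "complex ^ 3 ^ 3"
  assumes hom: "\<And>c v. ev3 F (c *s v) = c ^ d * ev3 F v"
    and f: "\<And>u v. ev2 f (u, v) = ev3 F (M *v vector [u, v, 1])" and "mult0 f > 1"
  shows "((\<lambda>\<tau>. ev3 F (M *v vector [\<tau> * u, \<tau> * v, 1 + \<tau> * w])) has_field_derivative 0) (at 0)"
proof -
  define h where "h \<tau> = (\<tau> * u / (1 + \<tau> * w), \<tau> * v / (1 + \<tau> * w))" for \<tau>
  have "((\<lambda>\<tau>. \<tau> * u / (1 + \<tau> * w)) has_derivative (\<lambda>\<tau>. \<tau> * u)) (at 0)"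
    "((\<lambda>\<tau>. \<tau> * v / (1 + \<tau> * w)) has_derivative (\<lambda>\<tau>. \<tau> * v)) (at 0)"
    by (auto intro!: derivative_eq_intros simp: fun_eq_iff)
  then have "(h has_derivative (\<lambda>\<tau>. (\<tau> * u, \<tau> * v))) (at 0)"
    unfolding h_def by (rule has_derivative_Pair)
  moreover have "(ev2 f has_derivative (\<lambda>_. 0)) (at (h 0))"
    using mult0_gt_1(2)[OF assms(3)] by (simp add: h_def)
  ultimately have "((\<lambda>\<tau>. ev2 f (h \<tau>)) has_derivative (\<lambda>\<tau>. 0)) (at 0)"
    by (rule has_derivative_compose)
  then have 1: "((\<lambda>\<tau>. ev2 f (h \<tau>)) has_field_derivative 0) (at 0)"
    by (simp add: has_field_derivative_def lambda_zero)
  have "((\<lambda>\<tau>. (1 + \<tau> * w) ^ d) has_field_derivative of_nat d * w) (at 0)"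
    by (auto intro!: derivative_eq_intros)
  from DERIV_mult[OF this 1] have 2: "((\<lambda>\<tau>. (1 + \<tau> * w) ^ d * ev2 f (h \<tau>)) has_field_derivative 0) (at 0)"
    using mult0_gt_1(1)[OF assms(3)] by (simp add: h_def)
  have "((\<lambda>\<tau>. 1 + \<tau> * w) \<longlongrightarrow> 1 + 0 * w) (nhds 0)" by (intro tendsto_intros filterlim_ident)
  then have "eventually (\<lambda>\<tau>. 1 + \<tau> * w \<noteq> 0) (nhds 0)"
    by (rule tendsto_imp_eventually_ne) simp
  then have ev: "eventually (\<lambda>\<tau>. ev3 F (M *v vector [\<tau> * u, \<tau> * v, 1 + \<tau> * w]) = (1 + \<tau> * w) ^ d * ev2 f (h \<tau>)) (nhds 0)"
  proof eventually_elim
    case (elim \<tau>)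
    have "(vector [\<tau> * u, \<tau> * v, 1 + \<tau> * w] :: complex ^ 3) = (1 + \<tau> * w) *s vector [\<tau> * u / (1 + \<tau> * w), \<tau> * v / (1 + \<tau> * w), 1]"
      unfolding vec3_eq_iff vector_smult_component vector_3_nth using elim by simp
    then have "ev3 F (M *v vector [\<tau> * u, \<tau> * v, 1 + \<tau> * w]) =
        (1 + \<tau> * w) ^ d * ev3 F (M *v vector [\<tau> * u / (1 + \<tau> * w), \<tau> * v / (1 + \<tau> * w), 1])"
      by (simp only: vec.scale hom)
    then show ?case by (simp only: h_def f)
  qed
  show ?thesis by (rule DERIV_cong_ev[OF refl ev refl, THEN iffD2, OF 2])
qed

lemma sing_type_mult0: "sing_type f ts \<Longrightarrow> mult0 f > 1"
  by (induction rule: sing_type.induct) auto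

section \<open>Reducedness, singular points and their types\<close>

context plane_pencil
begin

text \<open>A double factor \<open>D\<close> has no zero on a general line through (0 : 0 : 1),
  because the zeros of \<open>F\<close> are simple there. So \<open>D\<close> does not depend on
  \<open>z\<close>; a zero of \<open>D\<close> off the origin of the base would put a whole line
  into the curve, hence \<open>D\<close> is constant.\<close>

lemma squarefree_F: "squarefree F"
  unfolding squarefree_def
proof (intro allI impI)
  fix D assume "D ^ 2 dvd F"
  then obtain E where E: "F = D ^ 2 * E" by (auto elim: dvdE)
  have FD: "ev3 F v = ev3 D v ^ 2 * ev3 E v" for v by (simp add: E power2_eq_square)
  have lineP: "\<exists>P. \<forall>z. ev3 H (A *v vector [s, t, z]) = poly P z" for H s t
  proof -
    have lin: "poly_fun2 (\<lambda>w. (A *v vector [s, t, fst w]) $ i)" for i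
      unfolding matrix_vector_mult_def sum_3 by (simp, intro poly_fun2_intros)
    have "poly_fun2 (\<lambda>w. ev3 H (A *v vector [s, t, fst w]))"
      by (rule poly_fun2_ev3) (rule lin)
    from poly_fun2_line[OF this, of 0 1 0 0] show ?thesis by simp
  qed
  have const: "ev3 D (A *v vector [s, t, z]) = ev3 D (A *v vector [s, t, 0])"
    if st: "linform b (s, t) \<noteq> 0" "W (s, t) \<noteq> 0" for s t z
  proof -
    obtain d e where d: "\<And>z. ev3 D (A *v vector [s, t, z]) = poly d z"
      and e: "\<And>z. ev3 E (A *v vector [s, t, z]) = poly e z" using lineP by metis
    have "poly d z \<noteq> 0" for z
    proof
      assume z: "poly d z = 0"
      have "((\<lambda>z. poly d z * poly d z * poly e z) has_field_derivative 0) (at z)"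
        by (rule derivative_eq_intros poly_DERIV refl)+ (simp add: z)
      then have "((\<lambda>z. ev3 F (A *v vector [s, t, z])) has_field_derivative 0) (at z)"
        by (simp add: FD d e power2_eq_square)
      moreover have "ev3 F (A *v vector [s, t, z]) = 0" by (simp add: FD d z)
      ultimately show False using transversal_to_fibre[OF st] by blast
    qed
    then have "constant (poly d)" using fundamental_theorem_of_algebra by blast
    then show ?thesis using d by (simp add: constant_def)
  qed
  have dir: "poly_fun3 (\<lambda>w. ev3 D (A *v w))" "poly_fun3 (\<lambda>w. ev3 D (A *v vector [w $ 1, w $ 2, 0]))"
  proof -
    show "poly_fun3 (\<lambda>w. ev3 D (A *v w))" by (rule poly_fun3_ev3_linear)
    define B where "B = A ** (vector [vector [1, 0, 0], vector [0, 1, 0], vector [0, 0, 0]] :: complex ^ 3 ^ 3)"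
    have "A *v vector [w $ 1, w $ 2, 0] = B *v w" for w
    proof -
      have "vector [w $ 1, w $ 2, 0] = (vector [vector [1, 0, 0], vector [0, 1, 0], vector [0, 0, 0]] :: complex ^ 3 ^ 3) *v w"
        by (simp add: vec3_eq_iff matrix_vector_mult_def sum_3)
      then show ?thesis by (simp add: B_def matrix_vector_mul_assoc)
    qed
    then show "poly_fun3 (\<lambda>w. ev3 D (A *v vector [w $ 1, w $ 2, 0]))"
      using poly_fun3_ev3_linear[of D B] by simp
  qed
  \<comment> \<open>\<open>P1\<close> measures the dependence on \<open>z\<close>, and
    \<open>P2\<close> vanishes exactly on the lines excluded so far. Their product is zero and
    \<open>P2\<close> is not, so the restriction to general lines disappears.\<close>
  obtain P1 where P1: "\<And>w. ev3 D (A *v w) - ev3 D (A *v vector [w $ 1, w $ 2, 0]) = ev3 P1 w"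
    using poly_fun3_diff[OF dir] unfolding poly_fun3_def by blast
  obtain P2 where P2: "\<And>w. linform b (w $ 1, w $ 2) * W (w $ 1, w $ 2) = ev3 P2 w"
    using poly_fun3_mult[OF poly_fun3_of_poly_fun2[OF poly_fun2_linform] poly_fun3_of_poly_fun2[OF poly_GW(2)]]
    unfolding poly_fun3_def by blast
  have "ev3 (P1 * P2) w = ev3 0 w" for w
  proof (cases "linform b (w $ 1, w $ 2) * W (w $ 1, w $ 2) = 0")
    case True
    then show ?thesis by (simp flip: P2)
  next
    case False
    moreover have "vector [w $ 1, w $ 2, w $ 3] = w" by (simp add: vec3_eq_iff)
    ultimately have "ev3 P1 w = 0" using const[of "w $ 1" "w $ 2" "w $ 3"] P1[of w] by simp
    then show ?thesis by simp
  qed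
  then have "P1 * P2 = 0" by (rule ev3_inject)
  moreover have "P2 \<noteq> 0"
  proof
    assume "P2 = 0"
    then have z: "linform b w * W w = 0" for w using P2[of "vector [fst w, snd w, 0]"] by simp
    obtain pl pw where p: "linform b = ev2 pl" "W = ev2 pw"
      using poly_fun2_linform[of b] poly_GW(2) unfolding poly_fun2_def by blast
    have "ev2 (pl * pw) w = ev2 0 w" for w using z[of w] by (simp add: p)
    then have "pl = 0 \<or> pw = 0" using ev2_inject by (metis mult_eq_0_iff)
    moreover have "linform b (near b 1) \<noteq> 0" by (simp add: linform_near)
    ultimately show False using Wb unfolding p by auto
  qed
  ultimately have "P1 = 0" by simp
  then have ind: "ev3 D (A *v vector [s, t, z]) = ev3 D (A *v vector [s, t, 0])" for s t z
    using P1[of "vector [s, t, z]"] by simp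
  define H where "H w = ev3 D (A *v vector [fst w, snd w, 0])" for w
  have "poly_fun2 (\<lambda>w. (A *v vector [fst w, snd w, 0]) $ i)" for i
    unfolding matrix_vector_mult_def sum_3 by (simp, intro poly_fun2_intros)
  then have "poly_fun2 H" unfolding H_def[abs_def] by (rule poly_fun2_ev3)
  moreover have "H (s, t) \<noteq> 0" if "(s, t) \<noteq> (0, 0)" for s t
  proof
    assume "H (s, t) = 0"
    then have "ev3 F (A *v vector [s, t, z]) = 0" for z using ind[of s t z] by (simp add: FD H_def)
    then show False using F_nonzero_on_line[of s t] that by auto
  qed
  ultimately have H: "H w = H (1, 0)" and "H (1, 0) \<noteq> 0" for w
    using poly_fun2_nonvanishing_const by auto
  have "ev3 D v = ev3 [:[:[:H (1, 0):]:]:] v" for v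
  proof -
    have "ev3 D (A *v (Ai *v v)) = H ((Ai *v v) $ 1, (Ai *v v) $ 2)"
    proof -
      have "vector [(Ai *v v) $ 1, (Ai *v v) $ 2, (Ai *v v) $ 3] = Ai *v v" by (simp add: vec3_eq_iff)
      then show ?thesis using ind[of "(Ai *v v) $ 1" "(Ai *v v) $ 2" "(Ai *v v) $ 3"] by (simp add: H_def del: Ai_A)
    qed
    then have "ev3 D v = H (1, 0)" using H by simp
    then show ?thesis by (simp add: ev3_def ev2_def)
  qed
  then have "D = [:[:[:H (1, 0):]:]:]" by (rule ev3_inject)
  then have "1 = D * [:[:[:1 / H (1, 0):]:]:]" using \<open>H (1, 0) \<noteq> 0\<close> by (simp add: one_pCons)
  then show "D dvd 1" by (rule dvdI)
qed

lemma plane_curve_F: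
  "plane_curve (m * Suc N) F ((\<lambda>z. proj (A *v plane_vec z)) ` pencil b N K G W)"
  unfolding plane_curve_def curve_F using is_form_F squarefree_F by simp

definition vertex :: pt2 where "vertex = proj (A *v plane_vec (b, None))"

text \<open>The point over \<open>a\<close> that all branches share when \<open>W\<close> vanishes
  at \<open>a\<close>.\<close>

definition base_point :: "P1 \<Rightarrow> pt2" where
  "base_point a = proj (A *v plane_vec (a, Some (G (hom_coord a) / linform b (hom_coord a) ^ N)))"

text \<open>At a singular point other than the vertex the derivative along the line to the vertex is
  zero, which \<open>transversal_to_fibre\<close> rules out unless \<open>W\<close>
  vanishes.\<close>

lemma singular_pointD:
  assumes "singular_point F x"
  shows "x = vertex \<or> (\<exists>a. W (hom_coord a) = 0 \<and> x = base_point a)"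
proof -
  obtain f and M :: "complex ^ 3 ^ 3" where M: "proj (M *v vector [0, 0, 1]) = x" "invertible M"
    and f0: "\<forall>u v. ev2 f (u, v) = ev3 F (M *v vector [u, v, 1])" and mult: "mult0 f > 1"
    using assms unfolding singular_point_def local_equation_def by (elim exE conjE) (rule that, assumption+)
  have f: "ev2 f (u, v) = ev3 F (M *v vector [u, v, 1])" for u v using f0 by simp
  define w where "w = Ai *v (M *v vector [0, 0, 1])"
  have Aw: "M *v vector [0, 0, 1] = A *v w" by (simp add: w_def)
  obtain Mi where Mi: "M ** Mi = mat 1" "Mi ** M = mat 1" using M(2) unfolding invertible_def by blast
  have "w \<noteq> 0"
  proof
    assume "w = 0"
    then have "Mi *v (M *v vector [0, 0, 1]) = 0" using Aw by simp
    then show False by (simp add: matrix_vector_mul_assoc Mi vec3_eq_iff)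
  qed
  have F0: "ev3 F (A *v w) = 0" using mult0_gt_1(1)[OF mult] f[of 0 0] Aw by simp
  show ?thesis
  proof (cases "w $ 1 = 0 \<and> w $ 2 = 0")
    case True
    then have w: "w = w $ 3 *s plane_vec (b, None)" by (simp add: vec3_eq_iff plane_vec_None)
    then have "w $ 3 \<noteq> 0" using \<open>w \<noteq> 0\<close> by (metis vector_smult_lzero)
    then show ?thesis using M(1) Aw w unfolding vertex_def by (metis A_scale(1) proj_scale)
  next
    case False
    then have st: "w $ 1 \<noteq> 0 \<or> w $ 2 \<noteq> 0" by simp
    have wv: "vector [w $ 1, w $ 2, w $ 3] = w" by (simp add: vec3_eq_iff)
    obtain \<kappa> where \<kappa>: "\<kappa> \<in> K" "factor \<kappa> w = 0" using F0 K(1) by (auto simp: F_A)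
    have l0: "linform b (w $ 1, w $ 2) \<noteq> 0"
      using factor_nonzero[OF st _ \<kappa>(1), of "w $ 3"] \<kappa>(2) wv by auto
    have W0: "W (w $ 1, w $ 2) = 0"
    proof (rule ccontr)
      assume W0: "W (w $ 1, w $ 2) \<noteq> 0"
      \<comment> \<open>The fibre direction in the coordinates of the given chart
        \<open>M\<close>.\<close>
      define d where "d = Mi *v (A *v vector [0, 0, 1])"
      have Ad: "A *v vector [0, 0, 1] = M *v d" by (simp add: d_def matrix_vector_mul_assoc matrix_mul_assoc Mi)
      have eq: "M *v vector [\<tau> * d $ 1, \<tau> * d $ 2, 1 + \<tau> * d $ 3] = A *v vector [w $ 1, w $ 2, \<tau> + w $ 3]" for \<tau>
      proof -
        have "vector [\<tau> * d $ 1, \<tau> * d $ 2, 1 + \<tau> * d $ 3] = vector [0, 0, 1] + \<tau> *s d"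
          by (simp add: vec3_eq_iff)
        then have "M *v vector [\<tau> * d $ 1, \<tau> * d $ 2, 1 + \<tau> * d $ 3] = A *v w + \<tau> *s (A *v vector [0, 0, 1])"
          by (simp add: matrix_vector_right_distrib vec.scale Aw Ad)
        also have "\<dots> = A *v (w + \<tau> *s vector [0, 0, 1])"
          by (simp add: matrix_vector_right_distrib vec.scale)
        also have "w + \<tau> *s vector [0, 0, 1] = vector [w $ 1, w $ 2, \<tau> + w $ 3]" by (simp add: vec3_eq_iff)
        finally show ?thesis .
      qed
      have "((\<lambda>\<tau>. ev3 F (A *v vector [w $ 1, w $ 2, \<tau> + w $ 3])) has_field_derivative 0) (at 0)"
        using mult0_gt_1_homogeneous[OF F_scale f mult, of "d $ 1" "d $ 2" "d $ 3"] unfolding eq .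
      then have "((\<lambda>z. ev3 F (A *v vector [w $ 1, w $ 2, z])) has_field_derivative 0) (at (0 + w $ 3))"
        unfolding DERIV_shift .
      then show False using transversal_to_fibre[OF l0 W0, of "w $ 3" 0] F0 wv by simp
    qed
    obtain c a where c: "c \<noteq> 0" "w $ 1 = c * fst (hom_coord a)" "w $ 2 = c * snd (hom_coord a)"
      using hom_coordE[OF st] by metis
    define y where "y = w $ 3 / c"
    have wc: "w = c *s plane_vec (a, Some y)" using c by (simp add: vec3_eq_iff plane_vec_Some y_def)
    have W0': "W (hom_coord a) = 0"
      using binary_form_scale[OF W, of c "fst (hom_coord a)" "snd (hom_coord a)"] W0 c by simp
    have l0': "linform b (hom_coord a) \<noteq> 0"
      using binary_form_scale[OF binary_form_linform, of b c "fst (hom_coord a)" "snd (hom_coord a)"] l0 c by auto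
    have "factor \<kappa> (plane_vec (a, Some y)) = 0" using \<kappa>(2) c(1) unfolding wc factor_scale by auto
    then have "y = G (hom_coord a) / linform b (hom_coord a) ^ N"
      using l0' W0' by (simp add: factor_def plane_vec_Some field_simps)
    then have "x = base_point a"
      using M(1) unfolding Aw wc A_scale proj_scale[OF c(1)] base_point_def by simp
    then show ?thesis using W0' by blast
  qed
qed

lemma local_equationI:
  assumes "det B \<noteq> 0" "x = proj (A *v (B *v vector [0, 0, 1]))"
    "\<And>u v. ev2 f (u, v) = ev3 F (A *v (B *v vector [u, v, 1]))"
  shows "local_equation F x f"
  unfolding local_equation_def
proof (rule exI[of _ "A ** B"], intro conjI allI)
  have "invertible A" unfolding invertible_def using A by blast
  then show "invertible (A ** B)" using assms(1) by (intro invertible_mult) (simp_all add: invertible_det_nz)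
  show "proj ((A ** B) *v vector [0, 0, 1]) = x" using assms(2) by (simp add: matrix_vector_mul_assoc)
  show "ev2 f (u, v) = ev3 F ((A ** B) *v vector [u, v, 1])" for u v
    using assms(3) by (simp add: matrix_vector_mul_assoc)
qed

text \<open>The chart follows \<open>near a u\<close> along the base and measures \<open>v\<close>
  from the common height \<open>y\<close>. Branch \<kappa> becomes
  \<open>v E = G + \<kappa> W - y E\<close>, and the cross differences are
  \<open>(k - j) W E\<close> with \<open>E\<close> nonzero at 0, so the contact is the order of
  \<open>W\<close>.\<close>

lemma base_point_type:
  assumes "a \<noteq> b" "\<And>u. W (near a u) = u ^ n * poly U u" "poly U 0 \<noteq> 0" "n \<ge> 1"
  shows "tacnode F (base_point a) m (n - 1)" "has_type F (base_point a) (replicate n m)"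
proof -
  define l where "l = linform b (hom_coord a)"
  have l0: "l \<noteq> 0" using assms(1) by (simp add: l_def)
  define y where "y = G (hom_coord a) / l ^ N"
  define B where "B = (vector [vector [fst (dir a), 0, fst (hom_coord a)],
    vector [snd (dir a), 0, snd (hom_coord a)], vector [0, 1, y]] :: complex ^ 3 ^ 3)"
  have detB: "det B \<noteq> 0" by (cases a) (simp_all add: det_3 B_def)
  have B: "B *v vector [u, v, w] = vector [u * fst (dir a) + w * fst (hom_coord a), u * snd (dir a) + w * snd (hom_coord a), v + w * y]" for u v w
    by (simp add: vec3_eq_iff matrix_vector_mult_def sum_3 B_def mult.commute)
  obtain g0 where g0: "\<And>u. G (near a u) = poly g0 u" using poly_fun2_near[OF poly_GW(1)] by blast
  obtain e0 where e0: "\<And>u. linform b (near a u) = poly e0 u" using poly_fun2_near[OF poly_fun2_linform] by blast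
  define E where "E = e0 ^ N"
  define D where "D \<kappa> = g0 + smult \<kappa> (monom 1 n * U) - smult y E" for \<kappa>
  define f where "f = branches K D (\<lambda>_. E)"
  have f: "ev2 f (u, v) = ev3 F (A *v (B *v vector [u, v, 1]))" for u v
  proof -
    have "factor \<kappa> (B *v vector [u, v, 1]) = v * poly E u - poly (D \<kappa>) u" for \<kappa>
      using assms(2)[of u] g0[of u] e0[of u]
      by (simp add: factor_def B near_def add.commute E_def D_def poly_monom algebra_simps)
    then show ?thesis by (simp add: f_def ev2_branches F_A)
  qed
  have loc: "local_equation F (base_point a) f"
  proof (rule local_equationI[OF detB _ f])
    show "base_point a = proj (A *v (B *v vector [0, 0, 1]))"
      unfolding base_point_def B plane_vec_Some y_def l_def by simp
  qed
  have c: "contact K D (\<lambda>_. E) n"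
    unfolding contact_def
  proof (intro conjI ballI impI)
    show "finite K" by (rule K)
    have E0: "poly E 0 = l ^ N" using e0[of 0] by (simp add: E_def l_def)
    then show "poly E 0 \<noteq> 0" using l0 by simp
    show "poly (D \<kappa>) 0 = 0" for \<kappa>
      using g0[of 0] E0 l0 assms(4) by (simp add: D_def poly_monom y_def power_0_left)
    show "\<exists>U. poly U 0 \<noteq> 0 \<and> D k * E - D j * E = monom 1 n * U" if "k \<noteq> j" for k j
    proof (intro exI[of _ "smult (k - j) (U * E)"] conjI)
      show "poly (smult (k - j) (U * E)) 0 \<noteq> 0" using that assms(3) E0 l0 by simp
      show "D k * E - D j * E = monom 1 n * smult (k - j) (U * E)"
        by (simp add: D_def algebra_simps smult_diff_left)
    qed
  qed
  show "tacnode F (base_point a) m (n - 1)"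
    unfolding tacnode_def using loc tacnode0_branches[of K D "\<lambda>_. E" "n - 1" m] c K(2) assms(4)
    by (auto simp: f_def)
  show "has_type F (base_point a) (replicate n m)"
    unfolding has_type_def using loc sing_type_branches(2)[OF c K(2,3) assms(4)] by (auto simp: f_def)
qed

text \<open>The form on the right of the local equation has degree \<open>N + 1\<close>, so the
  tangent cone is the line \<open>u = 0\<close> counted \<open>m N\<close> times and
  \<open>None\<close> is the only direction to follow. The contact after the blow-up is exactly
  \<open>N\<close> because \<open>W\<close> is nonzero at \<open>b\<close>.\<close>

lemma vertex_type:
  "tacnode_blow_down F vertex m (N - 1)" "has_type F vertex (m * N # replicate N m)"
proof -
  define B where "B = (vector [vector [fst (dir b), fst (hom_coord b), 0],
    vector [snd (dir b), snd (hom_coord b), 0], vector [0, 0, 1]] :: complex ^ 3 ^ 3)"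
  have detB: "det B \<noteq> 0" by (cases b) (simp_all add: det_3 B_def)
  \<comment> \<open>\<open>P\<close> writes base vectors in the basis \<open>dir b\<close>,
    \<open>hom_coord b\<close>, in which \<open>linform b\<close> is the first coordinate.\<close>
  define P where "P u v = (u * fst (dir b) + v * fst (hom_coord b), u * snd (dir b) + v * snd (hom_coord b))" for u v
  have B: "B *v vector [u, v, w] = vector [fst (P u v), snd (P u v), w]" for u v w
    by (simp add: vec3_eq_iff matrix_vector_mult_def sum_3 B_def P_def mult.commute)
  have Pl: "linform b (P u v) = u" for u v by (cases b) (simp_all add: P_def)
  have Ps: "P (c * u) (c * v) = (c * fst (P u v), c * snd (P u v))" for c u v
    by (simp add: P_def algebra_simps)
  have Pn: "P u 1 = near b u" for u by (simp add: P_def near_def add.commute)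
  define Q where "Q \<kappa> w = G w + \<kappa> * W w" for \<kappa> w
  have Q: "binary_form (Suc N) (Q \<kappa>)" for \<kappa>
    unfolding Q_def by (intro binary_form_add binary_form_cmult G W)
  have QP: "Q \<kappa> (P (c * u) (c * v)) = c ^ Suc N * Q \<kappa> (P u v)" for \<kappa> c u v
    using binary_form_scale[OF Q, of \<kappa> c "fst (P u v)" "snd (P u v)"] by (simp add: Ps)
  have FB: "ev3 F (A *v (B *v vector [u, v, 1])) = (\<Prod>\<kappa>\<in>K. u ^ N - Q \<kappa> (P u v))" for u v
    using Pl[of u v] by (simp add: F_A B factor_def Q_def)
  have "poly_fun2 (\<lambda>w. (A *v (B *v vector [fst w, snd w, 1])) $ i)" for i
    unfolding B P_def matrix_vector_mult_def sum_3 by (simp, intro poly_fun2_intros)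
  from poly_fun2_ev3[OF this, of F] obtain f where f: "\<And>w. ev3 F (A *v (B *v vector [fst w, snd w, 1])) = ev2 f w"
    unfolding poly_fun2_def by blast
  have f_eq: "ev2 f (u, v) = (\<Prod>\<kappa>\<in>K. u ^ N - Q \<kappa> (P u v))" for u v
    using f[of "(u, v)"] FB[of u v] by simp
  have loc: "local_equation F vertex f"
  proof (rule local_equationI[OF detB])
    show "vertex = proj (A *v (B *v vector [0, 0, 1]))"
      unfolding vertex_def plane_vec_None B by (simp add: P_def)
    show "ev2 f (u, v) = ev3 F (A *v (B *v vector [u, v, 1]))" for u v using f[of "(u, v)"] by simp
  qed
  have "\<exists>D. \<forall>u. Q \<kappa> (near b u) = poly D u" for \<kappa>
    using Q[of \<kappa>] by (intro poly_fun2_near) (simp add: binary_form_def)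
  then obtain D where D: "\<And>\<kappa> u. Q \<kappa> (near b u) = poly (D \<kappa>) u" by metis
  obtain Wp where Wp: "\<And>u. W (near b u) = poly Wp u" using poly_fun2_near[OF poly_GW(2)] by blast
  \<comment> \<open>Numerator and denominator are both negated so that the factors
    \<open>v E - D\<close> match the local equation without a sign that depends on
    \<open>m\<close>.\<close>
  define g where "g = branches K (\<lambda>\<kappa>. - monom 1 N) (\<lambda>\<kappa>. - D \<kappa>)"
  have c: "contact K (\<lambda>\<kappa>. - monom 1 N) (\<lambda>\<kappa>. - D \<kappa>) N"
    unfolding contact_def
  proof (intro conjI ballI impI)
    show "finite K" by (rule K)
    show "poly (- D \<kappa>) 0 \<noteq> 0" if "\<kappa> \<in> K" for \<kappa>
      using nonvanishing[OF that] D[of \<kappa> 0] by (simp add: Q_def)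
    show "poly (- monom (1::complex) N) 0 = 0" using N by (simp add: poly_monom power_0_left)
    show "\<exists>U. poly U 0 \<noteq> 0 \<and> - monom 1 N * - D j - - monom 1 N * - D k = monom 1 N * U" if "k \<noteq> j" for k j
    proof (intro exI[of _ "D j - D k"] conjI)
      have "poly (D j - D k) 0 = (j - k) * W (hom_coord b)"
        using D[of j 0] D[of k 0] by (simp add: Q_def algebra_simps flip: D)
      then show "poly (D j - D k) 0 \<noteq> 0" using that Wb by simp
    qed (simp add: algebra_simps)
  qed
  \<comment> \<open>In a finite direction each factor is \<open>u^N\<close> times a function that
    equals 1 on the exceptional curve, so the proper transform misses that curve there.\<close>
  have gE: "\<exists>h. (\<forall>u v. ev2 f (u, u * (s + v)) = u ^ (m * N) * ev2 h (u, v)) \<and> (\<forall>v. ev2 h (0, v) = 1)" for s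
  proof -
    have "poly_fun2 (\<lambda>w. 1 - fst w * Q \<kappa> (P 1 (s + snd w)))" for \<kappa>
    proof -
      obtain q where q: "Q \<kappa> = ev2 q" using Q[of \<kappa>] unfolding binary_form_def poly_fun2_def by blast
      have "poly_fun2 (\<lambda>w. ev2 q (a + snd w * a', c + snd w * c'))" for a a' c c'
        by (induction q) (auto simp: ev2_pCons intro!: poly_fun2_intros poly_fun2_poly)
      from this[of "fst (dir b) + s * fst (hom_coord b)" "fst (hom_coord b)" "snd (dir b) + s * snd (hom_coord b)" "snd (hom_coord b)"]
      have "poly_fun2 (\<lambda>w. Q \<kappa> (P 1 (s + snd w)))"
        by (simp add: q P_def distrib_right add.assoc)
      then show ?thesis by (intro poly_fun2_diff poly_fun2_mult poly_fun2_const poly_fun2_fst)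
    qed
    then have "poly_fun2 (\<lambda>w. \<Prod>\<kappa>\<in>K. 1 - fst w * Q \<kappa> (P 1 (s + snd w)))" by (rule poly_fun2_prod)
    then obtain h where h: "\<And>w. (\<Prod>\<kappa>\<in>K. 1 - fst w * Q \<kappa> (P 1 (s + snd w))) = ev2 h w"
      unfolding poly_fun2_def by blast
    have "ev2 f (u, u * (s + v)) = u ^ (m * N) * ev2 h (u, v)" for u v
    proof -
      have "u ^ N - Q \<kappa> (P u (u * (s + v))) = u ^ N * (1 - u * Q \<kappa> (P 1 (s + v)))" for \<kappa>
        using QP[of \<kappa> u 1 "s + v"] by (simp add: algebra_simps)
      then show ?thesis using h[of "(u, v)"] unfolding f_eq
        by (simp add: prod.distrib K(2) power_mult[symmetric] mult.commute)
    qed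
    moreover have "ev2 h (0, v) = 1" for v using h[of "(0, v)"] by simp
    ultimately show ?thesis by blast
  qed
  have mult: "mult0 f = m * N"
  proof -
    obtain h where "\<And>u v. ev2 f (u, u * (0 + v)) = u ^ (m * N) * ev2 h (u, v)" "\<And>v. ev2 h (0, v) = 1"
      using gE[of 0] by blast
    then show ?thesis by (intro mult0_eqI[of f "m * N" h 0]) auto
  qed
  have st: "strict_transform f None g"
  proof -
    have "ev2 f (u * v, v) = v ^ (m * N) * ev2 g (u, v)" for u v
    proof -
      have "(u * v) ^ N - Q \<kappa> (P (u * v) v) = v ^ N * (v * poly (- D \<kappa>) u - poly (- monom 1 N) u)" for \<kappa>
        using QP[of \<kappa> v u 1] by (simp add: Pn D poly_monom power_mult_distrib algebra_simps)
      then show ?thesis unfolding f_eq g_def ev2_branches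
        by (simp add: prod.distrib K(2) power_mult[symmetric] mult.commute)
    qed
    then show ?thesis by (simp add: mult)
  qed
  have other: "mult0 g' = 0" if e': "e' \<noteq> None" and g': "strict_transform f e' g'" for e' g'
  proof -
    obtain s where s: "e' = Some s" using e' by blast
    obtain h where h: "\<And>u v. ev2 f (u, u * (s + v)) = u ^ (m * N) * ev2 h (u, v)" "\<And>v. ev2 h (0, v) = 1"
      using gE[of s] by blast
    have "g' = h" using strict_transform_Some_unique[of f s g' h] g' h(1) s mult by simp
    then show ?thesis using h(2)[of 0] by (intro mult0_eq_0) simp
  qed
  have t: "tacnode0 g m (N - 1)"
    unfolding g_def by (rule tacnode0_branches) (use c N K(2) in simp_all)
  have "tacnode_blow_down0 f m (N - 1)"
    unfolding tacnode_blow_down0_def using st t other by blast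
  then show "tacnode_blow_down F vertex m (N - 1)"
    unfolding tacnode_blow_down_def using loc by blast
  have gt: "mult0 f > 1" using mult K(3) N by (metis One_nat_def Suc_1 Suc_le_lessD le_trans mult_le_mono mult_1_right nat_mult_1_right)
  have "sing_type f (mult0 f # replicate N m)"
  proof (rule sing_type.intros(2)[OF gt st])
    show "sing_type g (replicate N m)" unfolding g_def by (rule sing_type_branches(2)[OF c K(2,3) N])
    show "mult0 g' \<le> 1" if "e' \<noteq> None" "strict_transform f e' g'" for e' g'
      using other[OF that] by simp
  qed
  then show "has_type F vertex (m * N # replicate N m)"
    unfolding has_type_def mult using loc by blast
qed

lemma has_type_singular: "has_type F x ts \<Longrightarrow> singular_point F x"
  unfolding has_type_def singular_point_def using sing_type_mult0 by blast

end

section \<open>Lines in the plane\<close>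

locale plane_frame =
  fixes Op :: pt2 and \<sigma> :: "hpt \<Rightarrow> pt2" and M Mi :: "complex ^ 3 ^ 3"
  assumes bu: "blow_up P2 Op (hirz 1) \<sigma>" and exc: "{z. \<sigma> z = Op} = exc_section"
    and \<sigma>: "\<sigma> = (\<lambda>z. proj (M *v plane_vec z))" and M: "M ** Mi = mat 1" "Mi ** M = mat 1"

lemma plane_blow_up_frame:
  assumes "plane_blow_up Op \<sigma>" obtains M Mi where "plane_frame Op \<sigma> M Mi"
proof -
  obtain M :: "complex ^ 3 ^ 3" where "invertible M" "\<sigma> = (\<lambda>z. proj (M *v plane_vec z))"
    using assms unfolding plane_blow_up_def by (elim exE conjE)
  moreover from this obtain Mi where "M ** Mi = mat 1" "Mi ** M = mat 1" unfolding invertible_def by blast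
  ultimately show thesis
    using assms by (intro that[of M Mi]) (simp add: plane_frame_def plane_blow_up_def)
qed

context plane_frame
begin

lemma \<sigma>_eq_Op: "\<sigma> (a, c) = Op \<longleftrightarrow> c = None"
proof -
  have "(a, c) \<in> {z. \<sigma> z = Op} \<longleftrightarrow> (a, c) \<in> exc_section" by (simp add: exc)
  then show ?thesis by (simp add: exc_section_def)
qed

lemma \<sigma>_inj: "\<sigma> (a, Some y) = \<sigma> z \<longleftrightarrow> z = (a, Some y)"
proof
  assume h: "\<sigma> (a, Some y) = \<sigma> z"
  have "\<sigma> (a, Some y) \<noteq> Op" by (simp add: \<sigma>_eq_Op)
  then show "z = (a, Some y)"
    using inj_onD[OF bij_betw_imp_inj_on[OF blow_upD(3)[OF bu]], of z "(a, Some y)"] h by simp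
qed simp

lemma Op_eq: "Op = proj (M *v vector [0, 0, 1])"
proof -
  have "\<sigma> (None, None) = Op" by (simp add: \<sigma>_eq_Op)
  then show ?thesis by (simp add: \<sigma> plane_vec_None)
qed

lemma covering:
  assumes "v \<noteq> 0" "proj v \<noteq> Op" shows "\<exists>a y. proj v = \<sigma> (a, Some y)"
proof -
  define w where "w = Mi *v v"
  have v: "v = M *v w" by (simp add: w_def matrix_vector_mul_assoc M)
  have "w $ 1 \<noteq> 0 \<or> w $ 2 \<noteq> 0"
  proof (rule ccontr)
    assume "\<not> (w $ 1 \<noteq> 0 \<or> w $ 2 \<noteq> 0)"
    then have w: "w = w $ 3 *s vector [0, 0, 1]" by (simp add: vec3_eq_iff)
    then have "w $ 3 \<noteq> 0" using assms(1) v by (metis vector_smult_lzero matrix_vector_mult_0_right)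
    then show False using assms(2) w unfolding v Op_eq by (metis vec.scale proj_scale)
  qed
  then obtain c a where c: "c \<noteq> 0" "w $ 1 = c * fst (hom_coord a)" "w $ 2 = c * snd (hom_coord a)"
    using hom_coordE by metis
  have "w = c *s plane_vec (a, Some (w $ 3 / c))" using c by (simp add: vec3_eq_iff plane_vec_Some)
  then have "proj v = \<sigma> (a, Some (w $ 3 / c))" unfolding v \<sigma> by (metis vec.scale proj_scale c(1))
  then show ?thesis by blast
qed

text \<open>The transposed frame carries the covector of the line into the coordinates of \<sigma>.
  As \<open>Op\<close> is the image of the third basis vector, the line contains it when the third
  coefficient vanishes.\<close>

lemma line_equation:
  assumes "is_line l"
  obtains p q r where "(p, q, r) \<noteq> (0, 0, 0)" "Op \<in> l \<longleftrightarrow> r = 0"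
    "\<And>a y. \<sigma> (a, Some y) \<in> l \<longleftrightarrow> p * fst (hom_coord a) + q * snd (hom_coord a) + r * y = 0"
proof -
  obtain c :: "complex ^ 3" where c: "c \<noteq> 0" "l = {proj v |v. v \<noteq> 0 \<and> (\<Sum>i\<in>UNIV. c $ i * v $ i) = 0}"
    using assms unfolding is_line_def by blast
  define d where "d = transpose M *v c"
  have dot: "(\<Sum>i\<in>UNIV. c $ i * (M *v w) $ i) = d $ 1 * w $ 1 + d $ 2 * w $ 2 + d $ 3 * w $ 3" for w
    by (simp add: d_def matrix_vector_mult_def transpose_def sum_3 algebra_simps)
  have mem: "proj v \<in> l \<longleftrightarrow> (\<Sum>i\<in>UNIV. c $ i * v $ i) = 0" if "v \<noteq> 0" for v
  proof
    assume "proj v \<in> l"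
    then obtain v' where v': "proj v = proj v'" "(\<Sum>i\<in>UNIV. c $ i * v' $ i) = 0" unfolding c(2) by blast
    then obtain k where "v = k *s v'" using proj_eq_iff by blast
    then have "(\<Sum>i\<in>UNIV. c $ i * v $ i) = k * (\<Sum>i\<in>UNIV. c $ i * v' $ i)"
      by (simp add: sum_distrib_left mult_ac)
    then show "(\<Sum>i\<in>UNIV. c $ i * v $ i) = 0" using v'(2) by simp
  qed (use that c(2) in blast)
  have nz: "M *v w \<noteq> 0" if "w \<noteq> 0" for w
  proof
    assume "M *v w = 0"
    then have "Mi *v (M *v w) = 0" by simp
    then show False using that by (simp add: matrix_vector_mul_assoc M)
  qed
  show thesis
  proof (rule that[of "d $ 1" "d $ 2" "d $ 3"])
    show "(d $ 1, d $ 2, d $ 3) \<noteq> (0, 0, 0)"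
    proof
      assume "(d $ 1, d $ 2, d $ 3) = (0, 0, 0)"
      then have "(\<Sum>i\<in>UNIV. c $ i * (M *v (Mi *v v)) $ i) = 0" for v unfolding dot by simp
      then have z: "(\<Sum>i\<in>UNIV. c $ i * v $ i) = 0" for v by (simp add: matrix_vector_mul_assoc M)
      have "c $ 1 = 0" "c $ 2 = 0" "c $ 3 = 0"
        using z[of "vector [1, 0, 0]"] z[of "vector [0, 1, 0]"] z[of "vector [0, 0, 1]"] by (simp_all add: sum_3)
      then show False using c(1) by (simp add: vec3_eq_iff)
    qed
    have "vector [0, 0, 1] \<noteq> (0 :: complex ^ 3)" by (simp add: vec3_eq_iff)
    from mem[OF nz[OF this]] show "Op \<in> l \<longleftrightarrow> d $ 3 = 0" unfolding Op_eq dot by simp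
    show "\<sigma> (a, Some y) \<in> l \<longleftrightarrow> d $ 1 * fst (hom_coord a) + d $ 2 * snd (hom_coord a) + d $ 3 * y = 0" for a y
    proof -
      have "plane_vec (a, Some y) \<noteq> 0" using hom_coord_nonzero[of a] by (auto simp: plane_vec_Some vec3_eq_iff)
      from mem[OF nz[OF this]] show ?thesis unfolding \<sigma> dot by (simp add: plane_vec_Some)
    qed
  qed
qed

lemma line_subset:
  assumes "is_line l" "is_line l'" "Op \<in> l \<Longrightarrow> Op \<in> l'"
    "\<And>a y. \<sigma> (a, Some y) \<in> l \<Longrightarrow> \<sigma> (a, Some y) \<in> l'"
  shows "l \<subseteq> l'"
proof
  fix x assume x: "x \<in> l"
  then obtain v where "v \<noteq> 0" "x = proj v" using assms(1) unfolding is_line_def by blast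
  then show "x \<in> l'" using covering[of v] assms(3,4) x by metis
qed

text \<open>The hypothesis confines the line to the fibre over \<open>a\<close>. Its equation has no
  term in \<open>y\<close>, so it contains all finite points over one base point, which must then be
  \<open>a\<close>.\<close>

lemma line_through_Op:
  assumes "is_line Q" "Op \<in> Q" "proper_transform (hirz 1) \<sigma> Op Q = fibre a"
  shows "\<sigma> (x, Some y) \<in> Q \<longleftrightarrow> x = a"
proof -
  have 1: "x = a" if "\<sigma> (x, Some y) \<in> Q" for x y
  proof -
    have "(x, Some y) \<in> {z \<in> points (hirz 1). \<sigma> z \<in> Q - {Op}}" using that by (simp add: \<sigma>_eq_Op)
    then have "(x, Some y) \<in> fibre a" unfolding assms(3)[symmetric] by (rule subsetD[OF subset_proper_transform])
    then show ?thesis by (simp add: fibre_def)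
  qed
  obtain p q r where pqr: "(p, q, r) \<noteq> (0, 0, 0)" "Op \<in> Q \<longleftrightarrow> r = 0"
    "\<And>a y. \<sigma> (a, Some y) \<in> Q \<longleftrightarrow> p * fst (hom_coord a) + q * snd (hom_coord a) + r * y = 0"
    using line_equation[OF assms(1)] by metis
  have r: "r = 0" using pqr(2) assms(2) by simp
  define x0 where "x0 = (if q = 0 then None else Some (- p / q))"
  have x0: "p * fst (hom_coord x0) + q * snd (hom_coord x0) = 0" by (simp add: x0_def)
  then have "x0 = a" using 1[of x0 0] pqr(3) r by simp
  then have "\<sigma> (a, Some y) \<in> Q" for y using x0 pqr(3) r by simp
  then show ?thesis using 1 by blast
qed

lemma lines_through_Op_eq:
  assumes "is_line Q" "Op \<in> Q" "proper_transform (hirz 1) \<sigma> Op Q = fibre a"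
    "is_line Q'" "Op \<in> Q'" "proper_transform (hirz 1) \<sigma> Op Q' = fibre a"
  shows "Q = Q'"
  using line_subset[OF assms(1,4)] line_subset[OF assms(4,1)] assms(2,5)
    line_through_Op[OF assms(1-3)] line_through_Op[OF assms(4-6)] by blast

text \<open>Lines that miss \<open>Op\<close> are graphs of linear forms. Two such forms that agree
  at the base point of \<open>V\<close> differ by a multiple of its linear form, and distinct lines
  have distinct multiples, so \<open>K\<close> counts the lines.\<close>

lemma pencil_of_lines:
  assumes fin: "finite \<A>" "card \<A> \<ge> 2" and lines: "\<And>l. l \<in> \<A> \<Longrightarrow> is_line l" "\<And>l. l \<in> \<A> \<Longrightarrow> V \<in> l" and "Op \<notin> \<Union>\<A>"
  obtains v G K where "V = \<sigma> (v, Some (G (hom_coord v)))" "binary_form 1 G" "finite K" "card K = card \<A>"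
    "\<And>b. proper_transform (hirz 1) \<sigma> Op (\<Union>\<A>) = pencil b 0 K G (linform v)"
proof -
  note result = that
  have "\<exists>g. (\<exists>p q. g = (\<lambda>w. p * fst w + q * snd w)) \<and> (\<forall>a y. \<sigma> (a, Some y) \<in> l \<longleftrightarrow> y = g (hom_coord a))"
    if l: "l \<in> \<A>" for l
  proof -
    obtain p q r where pqr: "Op \<in> l \<longleftrightarrow> r = 0"
      "\<And>a y. \<sigma> (a, Some y) \<in> l \<longleftrightarrow> p * fst (hom_coord a) + q * snd (hom_coord a) + r * y = 0"
      using line_equation[OF lines(1)[OF l]] by metis
    have r: "r \<noteq> 0" using pqr(1) l assms(5) by auto
    have "\<sigma> (a, Some y) \<in> l \<longleftrightarrow> y = - p / r * fst (hom_coord a) + - q / r * snd (hom_coord a)" for a y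
    proof -
      have "p * fst (hom_coord a) + q * snd (hom_coord a) + r * y = 0 \<longleftrightarrow>
          r * y = - p * fst (hom_coord a) - q * snd (hom_coord a)" by (auto simp: algebra_simps eq_neg_iff_add_eq_0)
      also have "\<dots> \<longleftrightarrow> y = - p / r * fst (hom_coord a) + - q / r * snd (hom_coord a)"
        using r by (auto simp: field_simps)
      finally show ?thesis unfolding pqr(2) .
    qed
    then show ?thesis by (intro exI[of _ "\<lambda>w. - p / r * fst w + - q / r * snd w"] conjI) blast+
  qed
  then obtain g where g: "\<And>l. l \<in> \<A> \<Longrightarrow> \<exists>p q. g l = (\<lambda>w. p * fst w + q * snd w)"
    "\<And>l a y. l \<in> \<A> \<Longrightarrow> \<sigma> (a, Some y) \<in> l \<longleftrightarrow> y = g l (hom_coord a)" by metis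
  have "\<A> \<noteq> {}" using fin by auto
  then obtain l0 where l0: "l0 \<in> \<A>" by blast
  have "V \<in> l0" using lines l0 by blast
  then obtain u where "u \<noteq> 0" "V = proj u" using lines(1)[OF l0] unfolding is_line_def by blast
  moreover have "V \<noteq> Op" using assms(5) l0 lines(2) by blast
  ultimately obtain v yV where V: "V = \<sigma> (v, Some yV)" using covering by blast
  have yV: "g l (hom_coord v) = yV" if "l \<in> \<A>" for l using lines(2)[OF that] V g(2)[OF that] by simp
  have "\<exists>k. \<forall>w. g l w = g l0 w + k * linform v w" if l: "l \<in> \<A>" for l
  proof -
    obtain p q p0 q0 where pq: "g l = (\<lambda>w. p * fst w + q * snd w)" "g l0 = (\<lambda>w. p0 * fst w + q0 * snd w)"
      using g(1)[OF l] g(1)[OF l0] by blast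
    have z: "p * fst (hom_coord v) + q * snd (hom_coord v) = p0 * fst (hom_coord v) + q0 * snd (hom_coord v)"
      using yV[OF l] yV[OF l0] by (simp add: pq)
    show ?thesis
    proof (cases v)
      case None
      then show ?thesis using z by (intro exI[of _ "p - p0"]) (simp add: pq algebra_simps)
    next
      case (Some x)
      then have p: "p = p0 + q0 * x - q * x" using z by (simp add: algebra_simps)
      show ?thesis using Some unfolding pq p by (intro exI[of _ "q - q0"]) (simp add: algebra_simps)
    qed
  qed
  then obtain \<kappa> where \<kappa>: "\<And>l w. l \<in> \<A> \<Longrightarrow> g l w = g l0 w + \<kappa> l * linform v w" by metis
  define K where "K = \<kappa> ` \<A>"
  have "inj_on \<kappa> \<A>"
  proof (rule inj_onI)
    fix l l' assume l: "l \<in> \<A>" "l' \<in> \<A>" "\<kappa> l = \<kappa> l'"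
    then have "\<sigma> (a, Some y) \<in> l \<longleftrightarrow> \<sigma> (a, Some y) \<in> l'" for a y using g(2) \<kappa> by simp
    moreover have "Op \<notin> l" "Op \<notin> l'" using l assms(5) by auto
    ultimately show "l = l'" using line_subset[OF lines(1)[OF l(1)] lines(1)[OF l(2)]]
      line_subset[OF lines(1)[OF l(2)] lines(1)[OF l(1)]] by blast
  qed
  then have card: "card K = card \<A>" by (simp add: K_def card_image)
  have G: "binary_form 1 (g l0)"
  proof -
    obtain p q where "g l0 = (\<lambda>w. p * fst w + q * snd w)" using g(1)[OF l0] by blast
    moreover have "poly_fun2 (\<lambda>w. p * fst w + q * snd w)" by (intro poly_fun2_intros)
    ultimately show ?thesis by (simp add: binary_form_def algebra_simps)
  qed
  have pen: "proper_transform (hirz 1) \<sigma> Op (\<Union>\<A>) = pencil b 0 K (g l0) (linform v)" for b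
  proof -
    have "{z \<in> points (hirz 1). \<sigma> z \<in> \<Union>\<A> - {Op}} = pencil b 0 K (g l0) (linform v)"
    proof (rule set_eqI)
      fix z :: hpt
      obtain a c where z: "z = (a, c)" by fastforce
      show "z \<in> {z \<in> points (hirz 1). \<sigma> z \<in> \<Union>\<A> - {Op}} \<longleftrightarrow> z \<in> pencil b 0 K (g l0) (linform v)"
      proof (cases c)
        case None
        then show ?thesis by (simp add: z mem_pencil \<sigma>_eq_Op)
      next
        case (Some y)
        have "z \<in> {z \<in> points (hirz 1). \<sigma> z \<in> \<Union>\<A> - {Op}} \<longleftrightarrow> (\<exists>l\<in>\<A>. y = g l (hom_coord a))"
          using g(2) by (simp add: z Some \<sigma>_eq_Op)
        also have "\<dots> \<longleftrightarrow> z \<in> pencil b 0 K (g l0) (linform v)"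
          using \<kappa> by (simp add: z Some mem_pencil K_def)
        finally show ?thesis .
      qed
    qed
    moreover have "closed_in (hirz 1) (pencil b 0 K (g l0) (linform v))"
      using fin \<open>\<A> \<noteq> {}\<close> G binary_form_linform[of v] by (intro closed_in_pencil) (simp_all add: K_def)
    ultimately show ?thesis unfolding proper_transform_def by (simp add: zclosure_eq)
  qed
  show thesis
    by (rule result[of v "g l0" K]) (use V yV[OF l0] G card pen fin in \<open>simp_all add: K_def\<close>)
qed

end

lemma prod_list_concat_replicate:
  assumes "length as = length ns"
  shows "(\<Prod>a\<leftarrow>concat (map2 replicate ns as). f a) = (\<Prod>i<length ns. f (as ! i) ^ (ns ! i) :: complex)"
  using assms
proof (induction as ns rule: list_induct2)
  case (Cons a as n ns)
  have "(\<Prod>x\<leftarrow>replicate n a. f x) = f a ^ n" by (induction n) auto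
  then show ?case using Cons by (simp add: prod.lessThan_Suc_shift del: prod.lessThan_Suc)
qed simp

lemma length_concat_replicate:
  "length as = length ns \<Longrightarrow> length (concat (map2 replicate ns as)) = sum_list ns"
  by (induction as ns rule: list_induct2) auto

theorem proposition5p10:
  fixes m :: nat and ns :: "nat list"
    and \<A> :: "pt2 set set" and V Op :: pt2 and Qs :: "pt2 set list" and P :: "pt2 set"
    and C' :: "pt2 set" and R :: "(pt2 \<times> pt2) set"
  assumes "m \<ge> 2" and "finite \<A>" and "card \<A> = m"
    and "\<And>l. l \<in> \<A> \<Longrightarrow> is_line l" and "\<And>l. l \<in> \<A> \<Longrightarrow> V \<in> l"
    and "ns \<noteq> []" and "\<And>n. n \<in> set ns \<Longrightarrow> n \<ge> 1"
    and "Op \<notin> \<Union>\<A>"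
    and "length Qs = length ns" and "distinct Qs"
    and "\<And>Q. Q \<in> set Qs \<Longrightarrow> is_line Q \<and> Op \<in> Q \<and> transversal Q \<A>"
    and "counterclockwise Op Qs"
    and "is_line P" and "Op \<in> P" and "transversal P \<A>" and "P \<notin> set Qs"
    and "cremona ns Op Qs P (\<Union>\<A>) C' R"
  shows "\<exists>F V' p q.
     plane_curve (m * (sum_list ns + 1)) F C' \<and>
     R `` {V} = {V'} \<and>
     distinct (V' # q # map p [0..<length ns]) \<and>
     {x. singular_point F x} = {V', q} \<union> p ` {..<length ns} \<and>
     has_type F V' [m] \<and>
     (\<forall>i<length ns. tacnode F (p i) m (ns ! i - 1) \<and>
        has_type F (p i) (replicate (ns ! i) m)) \<and>
     tacnode_blow_down F q m (sum_list ns - 1) \<and>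
     has_type F q (m * sum_list ns # replicate (sum_list ns) m)"
proof -
  define k where "k = length ns"
  define N where "N = sum_list ns"
  obtain \<sigma> as b C1 R1 C2 R2 Op' \<sigma>' where
    pb: "plane_blow_up Op \<sigma>" and las: "length as = length ns"
    and fQ: "\<forall>i<length ns. proper_transform (hirz 1) \<sigma> Op (Qs ! i) = fibre (as ! i)"
    and fP: "proper_transform (hirz 1) \<sigma> Op P = fibre b"
    and fs: "first_seq (concat (map2 replicate ns as)) 1 (proper_transform (hirz 1) \<sigma> Op (\<Union>\<A>)) (sum_list ns + 1) C1 R1"
    and ss: "second_seq (replicate (sum_list ns) b) (sum_list ns + 1) C1 1 C2 R2"
    and pb': "plane_blow_up Op' \<sigma>'" and C': "C' = \<sigma>' ` C2"
    and R: "R = {(\<sigma> x, \<sigma>' y) |x y. (x, y) \<in> R1 O R2}"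
    using assms(17) unfolding cremona_def by (elim exE conjE) (rule that, assumption+)
  obtain M Mi where "plane_frame Op \<sigma> M Mi" using plane_blow_up_frame[OF pb] by blast
  then interpret fr: plane_frame Op \<sigma> M Mi .
  obtain M' Mi' where "plane_frame Op' \<sigma>' M' Mi'" using plane_blow_up_frame[OF pb'] by blast
  then interpret fr': plane_frame Op' \<sigma>' M' Mi' .
  have "card \<A> \<ge> 2" using assms(1,3) by simp
  then obtain v G0 K where V: "V = \<sigma> (v, Some (G0 (hom_coord v)))" and G0: "binary_form 1 G0"
    and K: "finite K" "card K = m"
    and pen: "\<And>b. proper_transform (hirz 1) \<sigma> Op (\<Union>\<A>) = pencil b 0 K G0 (linform v)"
    using fr.pencil_of_lines[OF assms(2) _ assms(4,5,8)] assms(3) by metis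
  have K0: "K \<noteq> {}" using K assms(1) by auto
  obtain n where n: "n \<in> set ns" using assms(6) by fastforce
  then have "n \<le> N" unfolding N_def by (rule member_le_sum_list) simp
  then have N1: "N \<ge> 1" using assms(7)[OF n] by simp
  have Q: "is_line (Qs ! i)" "Op \<in> Qs ! i" "transversal (Qs ! i) \<A>" if "i < k" for i
    using assms(9,11) that by (simp_all add: k_def)
  \<comment> \<open>At least two lines of the arrangement pass through \<open>V\<close>, so a
    transversal line cannot contain it.\<close>
  have V_notin: "V \<notin> l" if "transversal l \<A>" for l
  proof
    assume "V \<in> l"
    obtain l1 l2 where l: "l1 \<in> \<A>" "l2 \<in> \<A>" "l1 \<noteq> l2"
      using \<open>card \<A> \<ge> 2\<close> assms(2) by (metis card_le_Suc0_iff_eq not_less_eq_eq numeral_2_eq_2)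
    then have "\<exists>!a. a \<in> \<A> \<and> V \<in> a" using that \<open>V \<in> l\<close> assms(5) unfolding transversal_def by blast
    then show False using l assms(5) by blast
  qed
  have memQ: "\<sigma> (x, Some y) \<in> Qs ! i \<longleftrightarrow> x = as ! i" if "i < k" for i x y
    using fr.line_through_Op[OF Q(1,2)[OF that]] fQ that by (simp add: k_def)
  have memP: "\<sigma> (x, Some y) \<in> P \<longleftrightarrow> x = b" for x y
    using fr.line_through_Op[OF assms(13,14) fP] .
  \<comment> \<open>The base points of \<open>V\<close>, of \<open>P\<close> and of the lines in
    \<open>Qs\<close> are pairwise different: a coincidence would put \<open>V\<close> on a
    transversal line or identify two of the lines.\<close>
  have va: "as ! i \<noteq> v" if "i < k" for i
    using V_notin[OF Q(3)[OF that]] memQ[OF that, of v] unfolding V by auto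
  have vb: "b \<noteq> v" using V_notin[OF assms(15)] memP[of v] unfolding V by auto
  have ab: "as ! i \<noteq> b" if "i < k" for i
  proof
    assume "as ! i = b"
    then have "Qs ! i = P"
      using fr.lines_through_Op_eq[OF Q(1,2)[OF that] _ assms(13,14) fP] fQ that by (simp add: k_def)
    then show False using assms(9,16) that by (auto simp: k_def)
  qed
  have aa: "as ! i \<noteq> as ! j" if ij: "i < k" "j < k" "i \<noteq> j" for i j
  proof
    assume "as ! i = as ! j"
    then have "Qs ! i = Qs ! j"
      using fr.lines_through_Op_eq[OF Q(1,2)[OF ij(1)] _ Q(1,2)[OF ij(2)]] fQ ij by (simp add: k_def)
    then show False using assms(9,10) ij by (simp add: k_def nth_eq_iff_index_eq)
  qed
  define as' where "as' = concat (map2 replicate ns as)"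
  have las': "length as' = N" unfolding as'_def N_def by (rule length_concat_replicate[OF las])
  obtain G1 c1 where c1: "c1 \<noteq> 0" and G1: "binary_form (N + 1) G1"
    and C1: "C1 = pencil b 0 K G1 (\<lambda>w. c1 * (linform v w * (\<Prod>a\<leftarrow>as'. linform a w)))"
    and R1: "\<And>x. R1 `` {(x, Some (G0 (hom_coord x)))} = {(x, Some (G1 (hom_coord x)))}"
    using first_seq_pencil[OF fs pen[of b] G0 binary_form_linform K(1) K0] unfolding as'_def N_def by blast
  define W1 where "W1 w = c1 * (linform v w * (\<Prod>a\<leftarrow>as'. linform a w))" for w
  have W1: "binary_form (N + 1) W1"
    using binary_form_cmult[OF binary_form_prod_linform[OF binary_form_linform[of v]], of as' c1] las'
    by (simp add: W1_def[abs_def] add.commute)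
  have C1: "C1 = pencil b 0 K G1 W1" by (simp add: C1 W1_def[abs_def])
  have forms: "binary_form (sum_list ns + 1 + 0) G1" "binary_form (sum_list ns + 1 + 0) W1"
    using G1 W1 by (simp_all add: N_def)
  have rep: "set (replicate (sum_list ns) b) \<subseteq> {b}" by auto
  obtain G2 c2 where c2: "c2 \<noteq> 0" and G2: "binary_form (Suc N) G2"
    and C2: "C2 = pencil b N K G2 (\<lambda>w. c2 * W1 w)"
    and nonv: "\<And>\<kappa>. \<kappa> \<in> K \<Longrightarrow> G2 (hom_coord b) + \<kappa> * (c2 * W1 (hom_coord b)) \<noteq> 0"
    and R2: "\<And>x y. x \<noteq> b \<Longrightarrow> y = G1 (hom_coord x) \<Longrightarrow>
      \<exists>y'. R2 `` {(x, Some y)} = {(x, Some y')} \<and> y' * linform b (hom_coord x) ^ N = G2 (hom_coord x)"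
    using second_seq_pencil[OF ss rep C1 forms K(1) K0] N1 by (auto simp: N_def)
  define W2 where "W2 w = c2 * W1 w" for w
  have W2_eq: "W2 w = c2 * c1 * linform v w * (\<Prod>i<k. linform (as ! i) w ^ (ns ! i))" for w
    unfolding W2_def W1_def as'_def prod_list_concat_replicate[OF las] k_def by (simp add: mult.assoc)
  have ns1: "ns ! i \<ge> 1" if "i < k" for i using assms(7) that by (simp add: k_def)
  have W2_0: "W2 (hom_coord a) = 0 \<longleftrightarrow> a = v \<or> (\<exists>i<k. a = as ! i)" for a
    using c1 c2 ns1 unfolding W2_eq by (force simp: Suc_le_eq)
  interpret pp: plane_pencil b N K G2 W2 M' Mi' m
  proof
    show "binary_form (Suc N) W2" using binary_form_cmult[OF W1] by (simp add: W2_def[abs_def])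
    show "G2 (hom_coord b) + \<kappa> * W2 (hom_coord b) \<noteq> 0" if "\<kappa> \<in> K" for \<kappa>
      using nonv[OF that] by (simp add: W2_def)
    show "W2 (hom_coord b) \<noteq> 0" using vb ab W2_0 by metis
  qed (use N1 K assms(1) G2 fr'.M in simp_all)
  have curve: "C' = (\<lambda>z. proj (M' *v plane_vec z)) ` pencil b N K G2 W2"
    unfolding C' C2 fr'.\<sigma> W2_def[abs_def] ..
  have base: "pp.base_point a = \<sigma>' (a, Some (G2 (hom_coord a) / linform b (hom_coord a) ^ N))" for a
    unfolding pp.base_point_def fr'.\<sigma> ..
  have vertex: "pp.vertex = \<sigma>' (b, None)" unfolding pp.vertex_def fr'.\<sigma> ..
  have base_inj: "pp.base_point a = pp.base_point a' \<longleftrightarrow> a = a'" for a a'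
    unfolding base fr'.\<sigma>_inj by auto
  have base_vertex: "pp.base_point a \<noteq> pp.vertex" for a
    unfolding base vertex fr'.\<sigma>_inj by simp
  have Vtype: "has_type pp.F (pp.base_point v) [m]"
  proof -
    \<comment> \<open>The cofactor of the simple zero of \<open>W2\<close> at \<open>v\<close>,
      nonzero there because no line of \<open>Qs\<close> has this base point.\<close>
    define U where "U w = c2 * c1 * (\<Prod>i<k. linform (as ! i) w ^ (ns ! i))" for w
    have "poly_fun2 U" unfolding U_def by (intro poly_fun2_intros poly_fun2_linform)
    then obtain p where p: "\<And>u. U (near v u) = poly p u" using poly_fun2_near by blast
    have "W2 (near v u) = u ^ 1 * poly p u" for u
      unfolding W2_eq by (simp add: linform_near U_def flip: p)
    moreover have "poly p 0 \<noteq> 0" using p[of 0] c1 c2 va by (auto simp: U_def)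
    ultimately show ?thesis using pp.base_point_type(2)[of v 1 p] vb by simp
  qed
  have Ptype: "tacnode pp.F (pp.base_point (as ! i)) m (ns ! i - 1) \<and> has_type pp.F (pp.base_point (as ! i)) (replicate (ns ! i) m)"
    if i: "i < k" for i
  proof -
    \<comment> \<open>The cofactor of the zero of order \<open>ns ! i\<close>, nonzero there because
      the other base points differ from this one.\<close>
    define U where "U w = c2 * c1 * linform v w * (\<Prod>j\<in>{..<k} - {i}. linform (as ! j) w ^ (ns ! j))" for w
    have "poly_fun2 U" unfolding U_def by (intro poly_fun2_intros poly_fun2_linform)
    then obtain p where p: "\<And>u. U (near (as ! i) u) = poly p u" using poly_fun2_near by blast
    have "W2 (near (as ! i) u) = u ^ (ns ! i) * poly p u" for u
      unfolding W2_eq using prod.remove[of "{..<k}" i "\<lambda>j. linform (as ! j) (near (as ! i) u) ^ (ns ! j)"] i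
      by (simp add: linform_near U_def flip: p)
    moreover have "poly p 0 \<noteq> 0" using p[of 0] c1 c2 va[OF i, symmetric] aa i by (auto simp: U_def)
    ultimately show ?thesis
      using pp.base_point_type[of "as ! i" "ns ! i" p] ab[OF i] ns1[OF i] by simp
  qed
  have sing: "{x. singular_point pp.F x} = {pp.base_point v, pp.vertex} \<union> (\<lambda>i. pp.base_point (as ! i)) ` {..<length ns}"
  proof (rule set_eqI, rule iffI)
    fix x assume "x \<in> {x. singular_point pp.F x}"
    then have "x = pp.vertex \<or> (\<exists>a. W2 (hom_coord a) = 0 \<and> x = pp.base_point a)"
      using pp.singular_pointD by simp
    then show "x \<in> {pp.base_point v, pp.vertex} \<union> (\<lambda>i. pp.base_point (as ! i)) ` {..<length ns}"
      unfolding W2_0 by (auto simp: k_def)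
  next
    fix x assume "x \<in> {pp.base_point v, pp.vertex} \<union> (\<lambda>i. pp.base_point (as ! i)) ` {..<length ns}"
    then have "x = pp.base_point v \<or> x = pp.vertex \<or> (\<exists>i<k. x = pp.base_point (as ! i))" by (auto simp: k_def)
    then show "x \<in> {x. singular_point pp.F x}"
      using pp.has_type_singular[OF Vtype] pp.has_type_singular[OF pp.vertex_type(2)] Ptype pp.has_type_singular by auto
  qed
  \<comment> \<open>\<open>V\<close> lies on the section \<open>G0\<close> off the fibre over
    \<open>b\<close>, where both correspondences are single-valued, and \<sigma> has only one
    preimage of \<open>V\<close>.\<close>
  have RV: "R `` {V} = {pp.base_point v}"
  proof -
    obtain y' where y': "R2 `` {(v, Some (G1 (hom_coord v)))} = {(v, Some y')}"
      "y' * linform b (hom_coord v) ^ N = G2 (hom_coord v)" using R2[of v] vb by auto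
    have "linform b (hom_coord v) \<noteq> 0" using vb by simp
    then have y'_eq: "y' = G2 (hom_coord v) / linform b (hom_coord v) ^ N" using y'(2) by (simp add: field_simps)
    have im: "(R1 O R2) `` {(v, Some (G0 (hom_coord v)))} = {(v, Some y')}"
      unfolding relcomp_Image R1 y'(1) ..
    have "R `` {V} = \<sigma>' ` ((R1 O R2) `` {(v, Some (G0 (hom_coord v)))})"
    proof (rule set_eqI, rule iffI)
      fix x assume "x \<in> R `` {V}"
      then obtain z z' where z: "\<sigma> (v, Some (G0 (hom_coord v))) = \<sigma> z" "x = \<sigma>' z'" "(z, z') \<in> R1 O R2"
        unfolding R V Image_singleton_iff mem_Collect_eq by blast
      have "z = (v, Some (G0 (hom_coord v)))" using z(1) unfolding fr.\<sigma>_inj by simp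
      then show "x \<in> \<sigma>' ` ((R1 O R2) `` {(v, Some (G0 (hom_coord v)))})"
        using z(2,3) by (intro image_eqI[of _ _ z']) (simp_all only: Image_singleton_iff)
    next
      fix x assume "x \<in> \<sigma>' ` ((R1 O R2) `` {(v, Some (G0 (hom_coord v)))})"
      then obtain z' where "x = \<sigma>' z'" "((v, Some (G0 (hom_coord v))), z') \<in> R1 O R2"
        unfolding image_iff Bex_def Image_singleton_iff by blast
      then show "x \<in> R `` {V}" unfolding R V Image_singleton_iff mem_Collect_eq by blast
    qed
    then show ?thesis unfolding im base y'_eq by simp
  qed
  have dist: "distinct (pp.base_point v # pp.vertex # map (\<lambda>i. pp.base_point (as ! i)) [0..<length ns])"
  proof -
    have "inj_on (\<lambda>i. pp.base_point (as ! i)) {..<k}"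
      using aa by (intro inj_onI) (metis base_inj lessThan_iff)
    moreover have "pp.base_point v \<notin> (\<lambda>i. pp.base_point (as ! i)) ` {..<k}"
    proof
      assume "pp.base_point v \<in> (\<lambda>i. pp.base_point (as ! i)) ` {..<k}"
      then obtain i where "i < k" "pp.base_point (as ! i) = pp.base_point v" by force
      then show False using va[of i] by (simp add: base_inj)
    qed
    moreover have "pp.vertex \<notin> (\<lambda>i. pp.base_point (as ! i)) ` {..<k}"
    proof
      assume "pp.vertex \<in> (\<lambda>i. pp.base_point (as ! i)) ` {..<k}"
      then obtain i where "pp.base_point (as ! i) = pp.vertex" by force
      then show False using base_vertex by simp
    qed
    ultimately show ?thesis
      using base_vertex[of v] by (simp add: distinct_map k_def atLeast0LessThan)
  qed
  show ?thesis
  proof (rule exI[of _ pp.F], rule exI[of _ "pp.base_point v"], rule exI[of _ "\<lambda>i. pp.base_point (as ! i)"],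
      rule exI[of _ pp.vertex], intro conjI)
    show "plane_curve (m * (sum_list ns + 1)) pp.F C'"
      using pp.plane_curve_F unfolding curve by (simp add: N_def)
    show "\<forall>i<length ns. tacnode pp.F (pp.base_point (as ! i)) m (ns ! i - 1) \<and>
        has_type pp.F (pp.base_point (as ! i)) (replicate (ns ! i) m)"
      using Ptype by (simp add: k_def)
    show "tacnode_blow_down pp.F pp.vertex m (sum_list ns - 1)" using pp.vertex_type(1) by (simp add: N_def)
    show "has_type pp.F pp.vertex (m * sum_list ns # replicate (sum_list ns) m)"
      using pp.vertex_type(2) by (simp add: N_def)
  qed (rule RV dist sing Vtype)+
qed

end
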